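(* Let $E$ be an arbitrary directed graph, $K$ a field, and $L=L_K(E)$ the Leavitt path algebra. The following are equivalent: (1) every ideal of $L$ is strongly irreducible; (2) all the ideals of $L$ are graded and form a chain under set inclusion; (3) the graph $E$ satisfies Condition (K) and the admissible pairs $(H,S)$ form a chain under the partial ordering of the admissible pairs; (4) every proper ideal of $L$ is a prime ideal.
   Context: A directed graph $E=(E^0,E^1,r,s)$ consists of sets $E^0$ (vertices), $E^1$ (edges) and maps $r,s:E^1\to E^0$; no finiteness or countability is assumed. A vertex is regular if it emits a nonempty finite set of edges, and an infinite emitter if it emits infinitely many. $L_K(E)$ is the (not necessarily unital) $K$-algebra generated by pairwise orthogonal idempotents $v\in E^0$ and elements $e,e^*$ ($e\in E^1$) subject to: $s(e)e=e=er(e)$; $r(e)e^*=e^*=e^*s(e)$; $e^*e=r(e)$ and $e^*f=0$ for edges $e\neq f$; $v=\sum_{s(e)=v}ee^*$ for every regular vertex $v$. It is $\mathbb Z$-graded by $\deg v=0$, $\deg e=1$, $\deg e^*=-1$. "Ideal" means two-sided ideal; prime ideals are proper. An ideal $I$ is strongly irreducible if for all ideals $A,B$, $A\cap B\subseteq I$ implies $A\subseteq I$ or $B\subseteq I$. Write $u\ge v$ if there is a path (possibly of length $0$) from $u$ to $v$. $H\subseteq E^0$ is hereditary if $v\in H$, $v\ge w$ imply $w\in H$; it is saturated if a regular vertex $v$ with $r(s^{-1}(v))\subseteq H$ lies in $H$. For $H$ hereditary saturated, $B_H$ is the set of infinite emitters $w\in E^0\backslash H$ with $0<|s^{-1}(w)\cap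 r^{-1}(E^0\backslash H)|<\infty$. An admissible pair is $(H,S)$ with $H$ hereditary saturated and $S\subseteq B_H$; the partial ordering is $(H_1,S_1)\le(H_2,S_2)$ iff $H_1\subseteq H_2$ and $S_1\subseteq H_2\cup S_2$. A closed path $e_1\cdots e_n$ ($n\ge 1$, $r(e_n)=s(e_1)$), based at $s(e_1)$, is simple if $s(e_i)\ne s(e_1)$ for $i=2,\dots,n$. $E$ satisfies Condition (K) if any vertex that is the base of a simple closed path $c$ is also the base of another simple closed path $c'\ne c$. *)

theory Defs
  imports
    "Graph_Theory.Arc_Walk"
    "HOL-Algebra.QuotRing"
    "HOL-Algebra.Ideal_Product"
    "HOL-Library.Poly_Mapping"
begin

text \<open>
  A directed graph \<open>E = (E\<^sup>0, E\<^sup>1, r, s)\<close> is a \<^locale>\<open>wf_digraph\<close> with \<open>verts\<close>, \<open>arcs\<close>, \<open>head\<close>, \<open>tail\<close>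
  in the roles of \<open>E\<^sup>0\<close>, \<open>E\<^sup>1\<close>, \<open>r\<close>, \<open>s\<close>; that locale imposes no finiteness or nonemptiness.
\<close>

section \<open>Vertices, admissible pairs and Condition (K)\<close>

definition regular_vertex :: "('v,'e) pre_digraph \<Rightarrow> 'v \<Rightarrow> bool" where
  "regular_vertex E v \<longleftrightarrow> v \<in> verts E \<and> finite (out_arcs E v) \<and> out_arcs E v \<noteq> {}"

definition infinite_emitter :: "('v,'e) pre_digraph \<Rightarrow> 'v \<Rightarrow> bool" where
  "infinite_emitter E v \<longleftrightarrow> v \<in> verts E \<and> infinite (out_arcs E v)"

definition hereditary :: "('v,'e) pre_digraph \<Rightarrow> 'v set \<Rightarrow> bool" where
  "hereditary E H \<longleftrightarrow> H \<subseteq> verts E \<and>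
     (\<forall>v w p. v \<in> H \<longrightarrow> pre_digraph.awalk E v p w \<longrightarrow> w \<in> H)"

definition saturated :: "('v,'e) pre_digraph \<Rightarrow> 'v set \<Rightarrow> bool" where
  "saturated E H \<longleftrightarrow>
     (\<forall>v. regular_vertex E v \<longrightarrow> head E ` out_arcs E v \<subseteq> H \<longrightarrow> v \<in> H)"

definition breaking_vertices :: "('v,'e) pre_digraph \<Rightarrow> 'v set \<Rightarrow> 'v set" where
  "breaking_vertices E H =
     {w \<in> verts E - H. infinite_emitter E w \<and>
        finite {e \<in> out_arcs E w. head E e \<in> verts E - H} \<and>
        {e \<in> out_arcs E w. head E e \<in> verts E - H} \<noteq> {}}"

definition admissible_pair :: "('v,'e) pre_digraph \<Rightarrow> 'v set \<times> 'v set \<Rightarrow> bool" where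
  "admissible_pair E = (\<lambda>(H, S). hereditary E H \<and> saturated E H \<and> S \<subseteq> breaking_vertices E H)"

definition admissible_le :: "'v set \<times> 'v set \<Rightarrow> 'v set \<times> 'v set \<Rightarrow> bool" where
  "admissible_le = (\<lambda>(H\<^sub>1, S\<^sub>1) (H\<^sub>2, S\<^sub>2). H\<^sub>1 \<subseteq> H\<^sub>2 \<and> S\<^sub>1 \<subseteq> H\<^sub>2 \<union> S\<^sub>2)"

definition simple_closed_path :: "('v,'e) pre_digraph \<Rightarrow> 'v \<Rightarrow> 'e list \<Rightarrow> bool" where
  "simple_closed_path E v c \<longleftrightarrow>
     pre_digraph.awalk E v c v \<and> c \<noteq> [] \<and> (\<forall>e \<in> set (tl c). tail E e \<noteq> v)"

definition condition_K :: "('v,'e) pre_digraph \<Rightarrow> bool" where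
  "condition_K E \<longleftrightarrow>
     (\<forall>v c. simple_closed_path E v c \<longrightarrow> (\<exists>c'. simple_closed_path E v c' \<and> c' \<noteq> c))"


section \<open>Ideals of rings without unit\<close>

text \<open>
  The ring records below have no meaningful \<open>one\<close> component, so the ideal notions of
  HOL-Algebra that presuppose \<open>ring\<close> do not apply. The notions in this section do not involve it.
\<close>

definition two_sided_ideal :: "('a,'m) ring_scheme \<Rightarrow> 'a set \<Rightarrow> bool" where
  "two_sided_ideal R I \<longleftrightarrow> additive_subgroup I R \<and>
     (\<forall>a \<in> I. \<forall>x \<in> carrier R. x \<otimes>\<^bsub>R\<^esub> a \<in> I \<and> a \<otimes>\<^bsub>R\<^esub> x \<in> I)"

definition strongly_irreducible_ideal :: "('a,'m) ring_scheme \<Rightarrow> 'a set \<Rightarrow> bool" where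
  "strongly_irreducible_ideal R I \<longleftrightarrow> two_sided_ideal R I \<and>
     (\<forall>A B. two_sided_ideal R A \<longrightarrow> two_sided_ideal R B \<longrightarrow> A \<inter> B \<subseteq> I \<longrightarrow> A \<subseteq> I \<or> B \<subseteq> I)"

text \<open>Primeness in the noncommutative sense, through products of ideals.\<close>

definition prime_two_sided_ideal :: "('a,'m) ring_scheme \<Rightarrow> 'a set \<Rightarrow> bool" where
  "prime_two_sided_ideal R P \<longleftrightarrow> two_sided_ideal R P \<and> P \<noteq> carrier R \<and>
     (\<forall>A B. two_sided_ideal R A \<longrightarrow> two_sided_ideal R B \<longrightarrow>
        ideal_prod R A B \<subseteq> P \<longrightarrow> A \<subseteq> P \<or> B \<subseteq> P)"


section \<open>The Leavitt path algebra\<close>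

datatype ('v,'e) lpa_gen = Vert 'v | Edge 'e | Ghost 'e

text \<open>
  Words are a copy of lists carrying concatenation as \<open>+\<close>, so that the convolution product of
  \<^theory>\<open>HOL-Library.Poly_Mapping\<close> makes the finitely supported functions from words to \<open>'k\<close> the
  unital free algebra on the generators.
\<close>

datatype ('v,'e) lpa_word = Word (letters: "('v,'e) lpa_gen list")

instantiation lpa_word :: (type, type) monoid_add
begin

definition zero_lpa_word :: "('a,'b) lpa_word" where
  "0 = Word []"

definition plus_lpa_word :: "('a,'b) lpa_word \<Rightarrow> ('a,'b) lpa_word \<Rightarrow> ('a,'b) lpa_word" where
  "u + w = Word (letters u @ letters w)"

instance
  by standard (auto simp: zero_lpa_word_def plus_lpa_word_def)

end

type_synonym ('v,'e,'k) free_lpa = "('v,'e) lpa_word \<Rightarrow>\<^sub>0 'k"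

definition gens :: "('v,'e) pre_digraph \<Rightarrow> ('v,'e) lpa_gen set" where
  "gens E = Vert ` verts E \<union> Edge ` arcs E \<union> Ghost ` arcs E"

text \<open>
  The free algebra without unit: only nonempty words occur. The \<open>one\<close> component is a dummy,
  not an element of the carrier.
\<close>

definition free_alg :: "('v,'e) pre_digraph \<Rightarrow> ('v,'e,'k::field) free_lpa ring" where
  "free_alg E =
     \<lparr>carrier = {p. \<forall>w \<in> Poly_Mapping.keys p. letters w \<noteq> [] \<and> set (letters w) \<subseteq> gens E},
      mult = (*), one = 1, zero = 0, add = (+)\<rparr>"

definition gen :: "('v,'e) lpa_gen \<Rightarrow> ('v,'e,'k::field) free_lpa" where
  "gen x = Poly_Mapping.single (Word [x]) 1"

definition lpa_relators :: "('v,'e) pre_digraph \<Rightarrow> ('v,'e,'k::field) free_lpa set" where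
  "lpa_relators E =
     {gen (Vert v) * gen (Vert v) - gen (Vert v) | v. v \<in> verts E} \<union>
     {gen (Vert v) * gen (Vert w) | v w. v \<in> verts E \<and> w \<in> verts E \<and> v \<noteq> w} \<union>
     {gen (Vert (tail E e)) * gen (Edge e) - gen (Edge e) | e. e \<in> arcs E} \<union>
     {gen (Edge e) * gen (Vert (head E e)) - gen (Edge e) | e. e \<in> arcs E} \<union>
     {gen (Vert (head E e)) * gen (Ghost e) - gen (Ghost e) | e. e \<in> arcs E} \<union>
     {gen (Ghost e) * gen (Vert (tail E e)) - gen (Ghost e) | e. e \<in> arcs E} \<union>
     {gen (Ghost e) * gen (Edge e) - gen (Vert (head E e)) | e. e \<in> arcs E} \<union>
     {gen (Ghost e) * gen (Edge f) | e f. e \<in> arcs E \<and> f \<in> arcs E \<and> e \<noteq> f} \<union>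
     {gen (Vert v) - (\<Sum>e \<in> out_arcs E v. gen (Edge e) * gen (Ghost e)) | v. regular_vertex E v}"

text \<open>
  The algebra ideal of \<^const>\<open>free_alg\<close> generated by the relators. Multiplication by
  \<open>Poly_Mapping.single 0 c\<close> is the scalar action of \<open>c\<close>; closure under it has to be required
  because \<^const>\<open>free_alg\<close> does not contain the scalars.
\<close>

definition lpa_rel_ideal :: "('v,'e) pre_digraph \<Rightarrow> ('v,'e,'k::field) free_lpa set" where
  "lpa_rel_ideal E =
     \<Inter>{I. two_sided_ideal (free_alg E) I \<and>
         (\<forall>c. \<forall>p \<in> I. Poly_Mapping.single 0 c * p \<in> I) \<and> lpa_relators E \<subseteq> I}"

definition leavitt_path_algebra ::
    "('v,'e) pre_digraph \<Rightarrow> ('v,'e,'k::field) free_lpa set ring" where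
  "leavitt_path_algebra E = free_alg E Quot lpa_rel_ideal E"

fun gen_degree :: "('v,'e) lpa_gen \<Rightarrow> int" where
  "gen_degree (Vert v) = 0"
| "gen_degree (Edge e) = 1"
| "gen_degree (Ghost e) = -1"

definition word_degree :: "('v,'e) lpa_word \<Rightarrow> int" where
  "word_degree w = (\<Sum>x \<leftarrow> letters w. gen_degree x)"

definition lpa_component ::
    "('v,'e) pre_digraph \<Rightarrow> int \<Rightarrow> ('v,'e,'k::field) free_lpa set set" where
  "lpa_component E n =
     {lpa_rel_ideal E +>\<^bsub>free_alg E\<^esub> p | p.
        p \<in> carrier (free_alg E) \<and> (\<forall>w \<in> Poly_Mapping.keys p. word_degree w = n)}"

text \<open>
  \<open>I\<close> is graded if \<open>I = \<Oplus>\<^sub>n (I \<inter> L\<^sub>n)\<close>. For an ideal only the inclusion from left to right has content.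
\<close>

definition lpa_graded_ideal ::
    "('v,'e) pre_digraph \<Rightarrow> ('v,'e,'k::field) free_lpa set set \<Rightarrow> bool" where
  "lpa_graded_ideal E I \<longleftrightarrow> two_sided_ideal (leavitt_path_algebra E) I \<and>
     (\<forall>x \<in> I. \<exists>N f. finite N \<and> (\<forall>n \<in> N. f n \<in> I \<inter> lpa_component E n) \<and>
        x = finsum (leavitt_path_algebra E) f N)"

end

theory Submission
  imports Defs "HOL-Library.Function_Algebras" "HOL-Library.Product_Plus"
begin

text \<open>
  Under Condition (K) an ideal is determined by the vertices \<open>v\<close> and the elements \<open>v\<^sup>H\<close> it contains:
  if \<open>a\<close> lies in an ideal \<open>M\<close>, multiplying by edges on the right removes the ghost edges of \<open>a\<close>, and a
  combination of paths ending at \<open>v\<close> in \<open>M\<close> forces \<open>v \<in> M\<close>, because its leading term can be isolated by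
  \<open>x \<mapsto> p\<^sup>* x p\<close> for a closed path \<open>p\<close> that is not periodic. Those generators are homogeneous idempotents,
  so every ideal is graded and satisfies \<open>I = I\<^sup>2\<close>, and inclusion of ideals is the order of the admissible
  pairs. For idempotent ideals in a chain, \<open>A B \<subseteq> P\<close> and \<open>A \<subseteq> B\<close> give \<open>A = A\<^sup>2 \<subseteq> P\<close>; conversely primeness
  or strong irreducibility of \<open>A \<inter> B\<close> makes \<open>A\<close> and \<open>B\<close> comparable.

  If the ideals form a chain, annihilators of modules of functions on path spaces are comparable. One such
  module realises each admissible pair, which gives the chain of pairs. If some vertex is the base of a
  single simple closed path \<open>c\<close>, letting \<open>c\<close> act by two suitable matrices gives incomparable annihilators.

  All computations take place in the unital free algebra on all letters, modulo its ideals that contain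
  the relators and the letters not belonging to the graph.
\<close>


section \<open>Ideals of the free algebra that contain the relators\<close>

text \<open>\<open>L\<close> has no unit, its ideals are not assumed closed under scalars, and its
  elements are cosets. Preimages in a unital algebra avoid this, at two costs. Closure of a preimage
  under scalars has to be recovered from local units. And an ideal of the unital algebra may contain
  elements with a constant term, which \<open>L\<close> does not see, so ideals are compared only on
  elements \<open>a\<close> with \<open>Poly_Mapping.lookup a 0 = 0\<close>.

  No normal form in \<open>L\<close> is proved: that an element is outside an ideal is always
  certified by an annihilator, by evaluation on a function. The functions take values in a plane
  because a one-dimensional twist sends a cycle to a nonzero scalar, and over the field with two
  elements 1 is the only one.

  The obstacle without Condition (K): if c is the only simple closed path at v, the closed paths at
  v are powers of c. They commute, so x -> p^* x p cannot isolate a leading term, and v - c lies in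
  an ideal without v. Two simple closed paths do not commute, and this is what is exploited.\<close>

lemma sum_single_lookup:
  fixes a :: "'a \<Rightarrow>\<^sub>0 'b::comm_monoid_add"
  shows "(\<Sum>w\<in>Poly_Mapping.keys a. Poly_Mapping.single w (Poly_Mapping.lookup a w)) = a"
  by (rule poly_mapping_eqI) (auto simp: lookup_sum lookup_single when_def in_keys_iff)

lemma poly_mapping_additive_induct [case_names zero add single]:
  fixes a :: "'a \<Rightarrow>\<^sub>0 'b::comm_monoid_add"
  assumes "P 0" "\<And>a b. P a \<Longrightarrow> P b \<Longrightarrow> P (a + b)" "\<And>w c. P (Poly_Mapping.single w c)"
  shows "P a"
proof -
  have "P (\<Sum>w\<in>A. Poly_Mapping.single w (Poly_Mapping.lookup a w))" if "finite A" for A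
    using that by (induction A rule: finite_induct) (auto intro: assms)
  from this[of "Poly_Mapping.keys a"] show ?thesis
    by (simp add: sum_single_lookup)
qed

abbreviation Vt :: "'v \<Rightarrow> ('v,'e,'k::field) free_lpa" where "Vt v \<equiv> gen (Vert v)"
abbreviation Ed :: "'e \<Rightarrow> ('v,'e,'k::field) free_lpa" where "Ed e \<equiv> gen (Edge e)"
abbreviation Gh :: "'e \<Rightarrow> ('v,'e,'k::field) free_lpa" where "Gh e \<equiv> gen (Ghost e)"
abbreviation scal :: "'k \<Rightarrow> ('v,'e,'k::field) free_lpa" where "scal c \<equiv> Poly_Mapping.single 0 c"

lemma zero_word [simp]: "letters 0 = []"
  by (simp add: zero_lpa_word_def)

lemma letters_plus [simp]: "letters (u + w) = letters u @ letters w"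
  by (simp add: plus_lpa_word_def)

lemma Word_plus: "Word xs + Word ys = Word (xs @ ys)"
  by (simp add: plus_lpa_word_def)

lemma Word_Nil: "Word [] = 0"
  by (simp add: zero_lpa_word_def)

lemma scal_commute: "scal c * a = a * scal c"
  by (induction a rule: poly_mapping_additive_induct) (simp_all add: algebra_simps mult_single)

lemma single_Word_Cons:
  "Poly_Mapping.single (Word (x # xs)) c = gen x * Poly_Mapping.single (Word xs) c"
  by (simp add: gen_def mult_single Word_plus)

lemma single_eq_scal: "Poly_Mapping.single w c = scal c * Poly_Mapping.single w 1"
  by (simp add: mult_single)

definition epath :: "'e list \<Rightarrow> ('v,'e,'k::field) free_lpa" where
  "epath p = Poly_Mapping.single (Word (map Edge p)) 1"

text \<open>The element p^*; the star reverses the order of the edges.\<close>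

definition gpath :: "'e list \<Rightarrow> ('v,'e,'k::field) free_lpa" where
  "gpath p = Poly_Mapping.single (Word (map Ghost (rev p))) 1"

lemma epath_Nil [simp]: "epath [] = 1"
  by (simp add: epath_def Word_Nil)

lemma gpath_Nil [simp]: "gpath [] = 1"
  by (simp add: gpath_def Word_Nil)

lemma epath_append: "epath (p @ q) = epath p * epath q"
  by (simp add: epath_def mult_single Word_plus)

lemma epath_Cons: "epath (e # p) = Ed e * epath p"
  by (simp add: epath_def gen_def mult_single Word_plus)

lemma gpath_Cons: "gpath (e # p) = gpath p * Gh e"
  by (simp add: gpath_def gen_def mult_single Word_plus)

text \<open>With the foreign letters in \<open>I\<close>, nearly all relations below hold for every
  letter of the type without side conditions. Scalars are elements of the ambient algebra, so
  \<open>I\<close> is a subspace at no extra cost, and 1 is available as the word of a path of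
  length 0.\<close>

locale lpa_ideal = wf_digraph E for E :: "('v,'e) pre_digraph" +
  fixes I :: "('v,'e,'k::field) free_lpa set"
  assumes zero_mem: "0 \<in> I"
    and add_mem: "a \<in> I \<Longrightarrow> b \<in> I \<Longrightarrow> a + b \<in> I"
    and mult_left_mem: "a \<in> I \<Longrightarrow> x * a \<in> I"
    and mult_right_mem: "a \<in> I \<Longrightarrow> a * x \<in> I"
    and relator_mem: "lpa_relators E \<subseteq> I"
    and foreign_mem: "g \<notin> gens E \<Longrightarrow> gen g \<in> I"
begin

lemma uminus_mem: "a \<in> I \<Longrightarrow> - a \<in> I"
  using mult_left_mem[of a "-1"] by simp

lemma minus_mem: "a \<in> I \<Longrightarrow> b \<in> I \<Longrightarrow> a - b \<in> I"
  using add_mem[of a "- b"] uminus_mem[of b] by simp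

lemma sum_mem: "(\<And>i. i \<in> A \<Longrightarrow> f i \<in> I) \<Longrightarrow> sum f A \<in> I"
  by (induction A rule: infinite_finite_induct) (auto intro: zero_mem add_mem)

definition cong :: "('v,'e,'k) free_lpa \<Rightarrow> ('v,'e,'k) free_lpa \<Rightarrow> bool"  (infix "\<approx>" 50) where
  "a \<approx> b \<longleftrightarrow> a - b \<in> I"

lemma cong_refl [simp, intro]: "a \<approx> a"
  by (simp add: cong_def zero_mem)

lemma cong_sym: "a \<approx> b \<Longrightarrow> b \<approx> a"
  using uminus_mem[of "a - b"] by (simp add: cong_def)

lemma cong_trans [trans]: "a \<approx> b \<Longrightarrow> b \<approx> c \<Longrightarrow> a \<approx> c"
  using add_mem[of "a - b" "b - c"] by (simp add: cong_def)

lemma cong_add: "a \<approx> b \<Longrightarrow> c \<approx> d \<Longrightarrow> a + c \<approx> b + d"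
  using add_mem[of "a - b" "c - d"] by (simp add: cong_def algebra_simps)

lemma cong_minus: "a \<approx> b \<Longrightarrow> c \<approx> d \<Longrightarrow> a - c \<approx> b - d"
  using minus_mem[of "a - b" "c - d"] by (simp add: cong_def algebra_simps)

lemma cong_left: "a \<approx> b \<Longrightarrow> x * a \<approx> x * b"
  using mult_left_mem[of "a - b" x] by (simp add: cong_def algebra_simps)

lemma cong_right: "a \<approx> b \<Longrightarrow> a * x \<approx> b * x"
  using mult_right_mem[of "a - b" x] by (simp add: cong_def algebra_simps)

lemma cong_sum: "(\<And>i. i \<in> A \<Longrightarrow> f i \<approx> g i) \<Longrightarrow> sum f A \<approx> sum g A"
  using sum_mem[of A "\<lambda>i. f i - g i"] by (simp add: cong_def sum_subtractf)

lemma cong_zero_iff: "a \<approx> 0 \<longleftrightarrow> a \<in> I"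
  by (simp add: cong_def)

lemma cong_mem_iff: "a \<approx> b \<Longrightarrow> a \<in> I \<longleftrightarrow> b \<in> I"
  using cong_trans cong_sym cong_zero_iff by blast

lemma foreign_Vert: "v \<notin> verts E \<Longrightarrow> Vt v \<approx> 0"
  by (auto simp: cong_zero_iff gens_def intro: foreign_mem)

lemma foreign_Edge: "e \<notin> arcs E \<Longrightarrow> Ed e \<approx> 0"
  by (auto simp: cong_zero_iff gens_def intro: foreign_mem)

lemma foreign_Ghost: "e \<notin> arcs E \<Longrightarrow> Gh e \<approx> 0"
  by (auto simp: cong_zero_iff gens_def intro: foreign_mem)

lemma cong_zero_left: "a \<approx> 0 \<Longrightarrow> x * a \<approx> 0"
  using cong_left[of a 0 x] by simp

lemma cong_zero_right: "a \<approx> 0 \<Longrightarrow> a * x \<approx> 0"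
  using cong_right[of a 0 x] by simp

lemma zero_eqI: "a \<approx> 0 \<Longrightarrow> b \<approx> 0 \<Longrightarrow> a \<approx> b"
  using cong_trans cong_sym by blast

lemma VV: "Vt v * Vt v \<approx> Vt v"
proof (cases "v \<in> verts E")
  case True
  have "gen (Vert v) * gen (Vert v) - gen (Vert v) \<in> lpa_relators E"
    unfolding lpa_relators_def using True by blast
  then show ?thesis using relator_mem by (auto simp: cong_def)
qed (simp add: zero_eqI cong_zero_left foreign_Vert)

lemma VV_neq: "v \<noteq> w \<Longrightarrow> Vt v * Vt w \<approx> 0"
proof (cases "v \<in> verts E \<and> w \<in> verts E")
  case True
  assume "v \<noteq> w"
  with True have "gen (Vert v) * gen (Vert w) \<in> lpa_relators E"
    unfolding lpa_relators_def by blast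
  then show ?thesis using relator_mem by (auto simp: cong_def)
qed (auto intro: cong_zero_left cong_zero_right foreign_Vert)

lemma V_Ed: "Vt (tail E e) * Ed e \<approx> Ed e"
proof (cases "e \<in> arcs E")
  case True
  have "gen (Vert (tail E e)) * gen (Edge e) - gen (Edge e) \<in> lpa_relators E"
    unfolding lpa_relators_def using True by blast
  then show ?thesis using relator_mem by (auto simp: cong_def)
qed (simp add: zero_eqI cong_zero_left foreign_Edge)

lemma Ed_V: "Ed e * Vt (head E e) \<approx> Ed e"
proof (cases "e \<in> arcs E")
  case True
  have "gen (Edge e) * gen (Vert (head E e)) - gen (Edge e) \<in> lpa_relators E"
    unfolding lpa_relators_def using True by blast
  then show ?thesis using relator_mem by (auto simp: cong_def)
qed (simp add: zero_eqI cong_zero_right foreign_Edge)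

lemma V_Gh: "Vt (head E e) * Gh e \<approx> Gh e"
proof (cases "e \<in> arcs E")
  case True
  have "gen (Vert (head E e)) * gen (Ghost e) - gen (Ghost e) \<in> lpa_relators E"
    unfolding lpa_relators_def using True by blast
  then show ?thesis using relator_mem by (auto simp: cong_def)
qed (simp add: zero_eqI cong_zero_left foreign_Ghost)

lemma Gh_V: "Gh e * Vt (tail E e) \<approx> Gh e"
proof (cases "e \<in> arcs E")
  case True
  have "gen (Ghost e) * gen (Vert (tail E e)) - gen (Ghost e) \<in> lpa_relators E"
    unfolding lpa_relators_def using True by blast
  then show ?thesis using relator_mem by (auto simp: cong_def)
qed (simp add: zero_eqI cong_zero_right foreign_Ghost)

text \<open>Here membership in \<open>arcs E\<close> matters: for a foreign \<open>e\<close> the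
  product vanishes modulo \<open>I\<close>, but \<open>head E e\<close> may well be a vertex of the
  graph.\<close>

lemma Gh_Ed: "e \<in> arcs E \<Longrightarrow> Gh e * Ed e \<approx> Vt (head E e)"
proof -
  assume "e \<in> arcs E"
  then have "gen (Ghost e) * gen (Edge e) - gen (Vert (head E e)) \<in> lpa_relators E"
    unfolding lpa_relators_def by blast
  then show ?thesis using relator_mem by (auto simp: cong_def)
qed

lemma Gh_Ed_neq: "e \<noteq> f \<Longrightarrow> Gh e * Ed f \<approx> 0"
proof (cases "e \<in> arcs E \<and> f \<in> arcs E")
  case True
  assume "e \<noteq> f"
  with True have "gen (Ghost e) * gen (Edge f) \<in> lpa_relators E"
    unfolding lpa_relators_def by blast
  then show ?thesis using relator_mem by (auto simp: cong_def)
qed (auto intro: cong_zero_left cong_zero_right foreign_Edge foreign_Ghost)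

lemma regular_sum: "regular_vertex E v \<Longrightarrow> Vt v \<approx> (\<Sum>e\<in>out_arcs E v. Ed e * Gh e)"
proof -
  assume "regular_vertex E v"
  then have "gen (Vert v) - (\<Sum>e \<in> out_arcs E v. gen (Edge e) * gen (Ghost e)) \<in> lpa_relators E"
    unfolding lpa_relators_def by blast
  then show ?thesis using relator_mem by (auto simp: cong_def)
qed

lemma V_Ed_neq: "v \<noteq> tail E e \<Longrightarrow> Vt v * Ed e \<approx> 0"
proof -
  assume ne: "v \<noteq> tail E e"
  have "Vt v * Ed e \<approx> Vt v * (Vt (tail E e) * Ed e)"
    by (rule cong_left[OF cong_sym[OF V_Ed]])
  also have "\<dots> = (Vt v * Vt (tail E e)) * Ed e" by (simp add: mult.assoc)
  also have "\<dots> \<approx> 0" by (intro cong_zero_right VV_neq ne)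
  finally show ?thesis .
qed

lemma Ed_V_neq: "v \<noteq> head E e \<Longrightarrow> Ed e * Vt v \<approx> 0"
proof -
  assume ne: "v \<noteq> head E e"
  have "Ed e * Vt v \<approx> (Ed e * Vt (head E e)) * Vt v"
    by (rule cong_right[OF cong_sym[OF Ed_V]])
  also have "\<dots> = Ed e * (Vt (head E e) * Vt v)" by (simp add: mult.assoc)
  also have "\<dots> \<approx> 0" using ne by (intro cong_zero_left VV_neq) auto
  finally show ?thesis .
qed

lemma Gh_V_neq: "v \<noteq> tail E e \<Longrightarrow> Gh e * Vt v \<approx> 0"
proof -
  assume ne: "v \<noteq> tail E e"
  have "Gh e * Vt v \<approx> (Gh e * Vt (tail E e)) * Vt v"
    by (rule cong_right[OF cong_sym[OF Gh_V]])
  also have "\<dots> = Gh e * (Vt (tail E e) * Vt v)" by (simp add: mult.assoc)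
  also have "\<dots> \<approx> 0" using ne by (intro cong_zero_left VV_neq) auto
  finally show ?thesis .
qed

text \<open>The right factor \<open>Vt v\<close> records where the path ends; without it the empty
  path would be 1 instead of v.\<close>

lemma V_epath: "awalk u p v \<Longrightarrow> Vt u * (epath p * Vt v) \<approx> epath p * Vt v"
proof (cases p)
  case Nil
  assume "awalk u p v"
  then show ?thesis using Nil VV by (simp add: awalk_Nil_iff)
next
  case (Cons e q)
  assume "awalk u p v"
  then have "u = tail E e" using Cons by (simp add: awalk_Cons_iff)
  then show ?thesis
    using cong_right[OF V_Ed[of e], of "epath q * Vt v"] Cons by (simp add: epath_Cons mult.assoc)
qed

lemma gpath_epath: "awalk u p v \<Longrightarrow> gpath p * (epath p * Vt v) \<approx> Vt v"
proof (induction p arbitrary: u)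
  case Nil
  then show ?case by simp
next
  case (Cons e p)
  then have e: "e \<in> arcs E" and w: "awalk (head E e) p v" by (auto simp: awalk_Cons_iff)
  have "gpath (e # p) * (epath (e # p) * Vt v) = gpath p * ((Gh e * Ed e) * (epath p * Vt v))"
    by (simp add: epath_Cons gpath_Cons mult.assoc)
  also have "\<dots> \<approx> gpath p * (Vt (head E e) * (epath p * Vt v))"
    by (intro cong_left cong_right Gh_Ed e)
  also have "\<dots> \<approx> gpath p * (epath p * Vt v)"
    by (intro cong_left V_epath w)
  also have "\<dots> \<approx> Vt v" by (rule Cons.IH[OF w])
  finally show ?case .
qed

text \<open>Equal first edges cancel until the two sequences differ, where e^* f = 0. If consecutive
  edges of \<open>p\<close> do not compose, the vertex left by a cancellation already kills the
  rest.\<close>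

lemma gpath_epath_neq:
  assumes "\<nexists>r. p = q @ r" "length q \<le> length p"
  shows "gpath q * epath p \<approx> 0"
  using assms
proof (induction q arbitrary: p)
  case Nil
  then show ?case by simp
next
  case (Cons e q)
  then obtain f p' where p: "p = f # p'" by (cases p) auto
  have eq: "gpath (e # q) * epath p = gpath q * ((Gh e * Ed f) * epath p')"
    by (simp add: p epath_Cons gpath_Cons mult.assoc)
  show ?case
  proof (cases "e = f \<and> e \<in> arcs E")
    case False
    then have "Gh e * Ed f \<approx> 0"
      using Gh_Ed_neq foreign_Ghost cong_zero_right by blast
    then show ?thesis unfolding eq by (rule cong_zero_left[OF cong_zero_right])
  next
    case True
    have "\<nexists>r. p' = q @ r" "length q \<le> length p'" using Cons.prems True p by auto
    then have IH: "gpath q * epath p' \<approx> 0" by (rule Cons.IH)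
    have "gpath q * ((Gh e * Ed f) * epath p') \<approx> gpath q * (Vt (head E e) * epath p')"
      using True by (intro cong_left cong_right) (auto intro: Gh_Ed)
    also have "\<dots> \<approx> 0"
    proof (cases p')
      case Nil
      with \<open>\<nexists>r. p' = q @ r\<close> \<open>length q \<le> length p'\<close> show ?thesis by auto
    next
      case (Cons g p'')
      show ?thesis
      proof (cases "head E e = tail E g")
        case True
        have "Vt (head E e) * epath p' \<approx> epath p'"
          using cong_right[OF V_Ed[of g], of "epath p''"] True Cons by (simp add: epath_Cons mult.assoc)
        from cong_left[OF this, of "gpath q"] IH show ?thesis using cong_trans by blast
      next
        case False
        have "Vt (head E e) * epath p' \<approx> 0"
          using cong_zero_right[OF V_Ed_neq[OF False], of "epath p''"] Cons
          by (simp add: epath_Cons mult.assoc)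
        then show ?thesis by (rule cong_zero_left)
      qed
    qed
    finally show ?thesis unfolding eq .
  qed
qed

end

section \<open>Closed paths and Condition (K)\<close>

context wf_digraph
begin

lemma closed_walk_imp_simple_closed_path:
  "awalk v p v \<Longrightarrow> p \<noteq> [] \<Longrightarrow> \<exists>c. simple_closed_path G v c"
proof (induction p rule: length_induct)
  case (1 p)
  show ?case
  proof (cases "\<forall>e\<in>set (tl p). tail G e \<noteq> v")
    case True
    with 1 show ?thesis by (auto simp: simple_closed_path_def)
  next
    case False
    then obtain e where e: "e \<in> set (tl p)" "tail G e = v" by blast
    then obtain ys zs where "tl p = ys @ e # zs" by (meson split_list)
    then have p: "p = (hd p # ys) @ e # zs" using 1(3) by (metis append_Cons list.collapse)
    with 1(2) obtain w where w: "awalk v (hd p # ys) w" "awalk w (e # zs) v"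
      by (metis awalk_append_iff)
    then have "w = v" using e by (auto simp: awalk_Cons_iff)
    with w have "awalk v (hd p # ys) v" by simp
    moreover have "length (hd p # ys) < length p" by (subst p) simp
    ultimately show ?thesis using 1(1) by blast
  qed
qed

text \<open>The simple closed paths at v form a prefix code: where \<open>p\<close> ends it is back
  at v, and \<open>c\<close> does not return to v before its own end.\<close>

lemma simple_closed_path_prefix:
  assumes c: "simple_closed_path G v c" and p: "awalk v p v" "p \<noteq> []" and eq: "c @ x = p @ y"
  shows "\<exists>z. p = c @ z \<and> awalk v z v"
proof -
  have cw: "awalk v c v" using c by (simp add: simple_closed_path_def)
  from eq consider (1) us where "c = p @ us" | (2) us where "c @ us = p"
    by (auto simp: append_eq_append_conv2)
  then show ?thesis
  proof cases
    case 1
    show ?thesis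
    proof (cases us)
      case Nil
      with 1 p have "p = c @ []" "awalk v [] v" by (auto simp: awalk_Nil_iff)
      then show ?thesis by blast
    next
      case (Cons e us')
      have "awalk v us v" using cw p 1 by (metis awalk_append_iff awalk_ends_eqD)
      then have "tail G e = v" using Cons by (simp add: awalk_Cons_iff)
      moreover have "e \<in> set (tl c)" using 1 Cons p(2) by (cases p) auto
      ultimately show ?thesis using c by (auto simp: simple_closed_path_def)
    qed
  next
    case 2
    then have "awalk v us v" using cw p by (metis awalk_append_iff awalk_ends_eqD)
    with 2 show ?thesis by blast
  qed
qed

text \<open>Copies of \<open>c\<close> are stripped from the left of both sides. Each copy taken
  from \<open>p\<close> shortens it, so \<open>p\<close> is used up within \<open>m\<close> rounds,
  and \<open>p \<noteq> [] \<or> m < n\<close> ensures that at the end a copy of \<open>c\<close> on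
  the left faces \<open>c'\<close> on the right. Then \<open>c\<close> and \<open>c'\<close> are
  prefixes of each other.\<close>

lemma not_prefix_of_shift:
  assumes c: "simple_closed_path G v c" and c': "simple_closed_path G v c'" and "c \<noteq> c'"
    and "awalk v p v" "length p \<le> m" "m \<le> n" "p \<noteq> [] \<or> m < n"
    and "p @ concat (replicate n c) @ c' = concat (replicate m c) @ c' @ x"
  shows False
  using assms(4-)
proof (induction m arbitrary: n p)
  case 0
  then have "p = []" "n > 0" by auto
  then obtain n' where "n = Suc n'" by (cases n) auto
  with 0 \<open>p = []\<close> have eq: "c @ concat (replicate n' c) @ c' = c' @ x" by simp
  have w: "awalk v c v" "c \<noteq> []" "awalk v c' v" "c' \<noteq> []"
    using c c' by (auto simp: simple_closed_path_def)
  from simple_closed_path_prefix[OF c w(3,4) eq] obtain z where "c' = c @ z" by blast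
  moreover from simple_closed_path_prefix[OF c' w(1,2) eq[symmetric]] obtain z' where "c = c' @ z'"
    by blast
  ultimately show False using \<open>c \<noteq> c'\<close> by simp
next
  case (Suc m)
  show ?case
  proof (cases "p = []")
    case True
    with Suc.prems obtain n' where n': "n = Suc n'" "m < n'" by (cases n) auto
    with Suc.prems True have "[] @ concat (replicate n' c) @ c' = concat (replicate m c) @ c' @ x"
      by simp
    then show False using Suc.IH[of "[]" n'] n' Suc.prems(1) True by simp
  next
    case False
    from Suc.prems have "c @ (concat (replicate m c) @ c' @ x) = p @ (concat (replicate n c) @ c')"
      by simp
    from simple_closed_path_prefix[OF c Suc.prems(1) False this]
    obtain z where z: "p = c @ z" "awalk v z v" by blast
    have "c \<noteq> []" using c by (simp add: simple_closed_path_def)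
    then have "length z \<le> m" using Suc.prems(2) z by (cases c) auto
    \<comment> \<open>\<open>m\<close> has dropped while \<open>n\<close> stays, so the alternative
      \<open>m < n\<close> is now satisfied even if \<open>z\<close> is empty.\<close>
    then show False using Suc.IH[of z n] z Suc.prems by simp
  qed
qed

text \<open>The path is \<open>c\<^sup>n c'\<close> with \<open>n\<close> large, for two simple closed paths \<open>c\<close>, \<open>c'\<close> at \<open>v\<close>.\<close>

lemma condition_K_aperiodic_closed_path:
  assumes K: "condition_K G" and v: "v \<in> verts G"
    and B: "finite B" "\<And>p. p \<in> B \<Longrightarrow> awalk v p v \<and> p \<noteq> []"
  obtains q where "awalk v q v" "\<And>p. p \<in> B \<Longrightarrow> \<nexists>x. p @ q = q @ x"
proof (cases "B = {}")
  case True
  then show ?thesis using that[of "[]"] v by (simp add: awalk_Nil_iff)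
next
  case False
  then obtain p0 where "awalk v p0 v" "p0 \<noteq> []" using B by blast
  then obtain c where c: "simple_closed_path G v c"
    using closed_walk_imp_simple_closed_path by blast
  with K obtain c' where c': "simple_closed_path G v c'" "c' \<noteq> c"
    unfolding condition_K_def by blast
  \<comment> \<open>A common bound for the lengths of the paths in \<open>B\<close>.\<close>
  define n where "n = sum length B"
  have n: "length p \<le> n" if "p \<in> B" for p
    unfolding n_def using that B(1) by (intro member_le_sum) auto
  have w: "awalk v c v" "awalk v c' v" using c c' by (auto simp: simple_closed_path_def)
  have "awalk v (concat (replicate k c)) v" for k
    by (induction k) (use v w in \<open>auto simp: awalk_Nil_iff intro: awalk_appendI\<close>)
  from awalk_appendI[OF this w(2)] have "awalk v (concat (replicate n c) @ c') v" .
  moreover have "\<nexists>x. p @ (concat (replicate n c) @ c') = (concat (replicate n c) @ c') @ x"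
    if "p \<in> B" for p
    using not_prefix_of_shift[OF c c'(1) c'(2)[symmetric], of p n n] n[OF that] B(2)[OF that] by auto
  ultimately show ?thesis using that by blast
qed

end

section \<open>Leading terms of combinations of paths\<close>

definition walk_words :: "('v,'e) pre_digraph \<Rightarrow> 'v \<Rightarrow> ('v,'e) lpa_word set" where
  "walk_words E v = {Word (map Edge p) | p. \<exists>u. pre_digraph.awalk E u p v}"

text \<open>The element v^H, formed for every \<open>v\<close> and \<open>H\<close>: it is evaluated
  at regular vertices and at vertices with an empty sum as well.\<close>

definition breaking_element :: "('v,'e) pre_digraph \<Rightarrow> 'v set \<Rightarrow> 'v \<Rightarrow> ('v,'e,'k::field) free_lpa" where
  "breaking_element E H v =
     Vt v - (\<Sum>e \<in> {e \<in> out_arcs E v. head E e \<in> verts E - H}. Ed e * Gh e)"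

lemma scal_left_commute: "a * (scal c * b) = scal c * (a * b)"
  by (simp only: mult.assoc[symmetric] scal_commute[of c a])

lemma lookup_mult_single_right:
  fixes z :: "('v,'e,'k::field) free_lpa"
  shows "Poly_Mapping.lookup (z * Poly_Mapping.single w 1) (k + w) = Poly_Mapping.lookup z k"
proof -
  have cancel: "x + w = k + w \<longleftrightarrow> x = k" for x
    by (cases x; cases w; cases k) (simp add: plus_lpa_word_def)
  have "z * Poly_Mapping.single w 1 =
      (\<Sum>x\<in>Poly_Mapping.keys z. Poly_Mapping.single (x + w) (Poly_Mapping.lookup z x))"
    by (subst sum_single_lookup[of z, symmetric]) (simp add: sum_distrib_right mult_single)
  then have "Poly_Mapping.lookup (z * Poly_Mapping.single w 1) (k + w) =
      (\<Sum>x\<in>Poly_Mapping.keys z. Poly_Mapping.lookup z x when x = k)"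
    by (simp add: lookup_sum lookup_single cancel)
  also have "\<dots> = Poly_Mapping.lookup z k"
    by (auto simp: when_def in_keys_iff)
  finally show ?thesis .
qed

text \<open>An equation in the free algebra and not modulo \<open>I\<close>: words cancel on the
  right. Vanishing of a combination of paths always refers to the chosen representative.\<close>

lemma mult_Ed_eq_zero: "z * Ed e = 0 \<Longrightarrow> z = 0"
  by (rule poly_mapping_eqI) (metis gen_def lookup_mult_single_right lookup_zero)

lemma keys_mult_Ed:
  assumes "wf_digraph E" "Poly_Mapping.keys z \<subseteq> walk_words E v" "e \<in> out_arcs E v"
  shows "Poly_Mapping.keys (z * Ed e) \<subseteq> walk_words E (head E e)"
proof
  interpret wf_digraph E by fact
  fix w assume "w \<in> Poly_Mapping.keys (z * Ed e)"
  then obtain a where "a \<in> Poly_Mapping.keys z" "w = a + Word [Edge e]"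
    using keys_mult[of z "Ed e"] by (auto simp: gen_def)
  then obtain u p where "awalk u p v" "w = Word (map Edge (p @ [e]))"
    using assms(2) by (auto simp: walk_words_def Word_plus)
  moreover from this have "awalk u (p @ [e]) (head E e)"
    using assms(3) by (auto simp: awalk_Cons_iff awalk_Nil_iff)
  ultimately show "w \<in> walk_words E (head E e)"
    unfolding walk_words_def by blast
qed

context lpa_ideal
begin

lemma scal_mem_cancel: "k \<noteq> 0 \<Longrightarrow> scal k * a \<in> I \<Longrightarrow> a \<in> I"
  using mult_left_mem[of "scal k * a" "scal (inverse k)"]
  by (simp add: mult.assoc[symmetric] mult_single)

text \<open>Take a shortest path m in the support of \<open>z\<close>. Multiplying by m^* on the
  left kills the paths that do not extend m and strips m from the others; the vertex v in front then
  keeps only closed paths. What becomes of m itself is k v, with k its coefficient.\<close>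

lemma leading_vertex:
  assumes keys: "Poly_Mapping.keys z \<subseteq> walk_words E v" and nz: "z \<noteq> 0"
  obtains k B g c where "k \<noteq> 0" "finite B" "\<forall>p\<in>B. awalk v p v \<and> p \<noteq> []"
    "g * (z * Vt v) \<approx> scal k * Vt v + (\<Sum>p\<in>B. scal (c p) * (epath p * Vt v))"
proof -
  define wd :: "'e list \<Rightarrow> ('v,'e) lpa_word" where "wd p = Word (map Edge p)" for p
  have inj: "inj wd" by (auto simp: inj_def wd_def inj_map_eq_map[OF injI])
  define A where "A = {p. wd p \<in> Poly_Mapping.keys z}"
  define c where "c p = Poly_Mapping.lookup z (wd p)" for p
  have finA: "finite A" unfolding A_def using finite_vimageI[OF finite_keys inj, of z]
    by (simp add: vimage_def)
  have img: "Poly_Mapping.keys z = wd ` A"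
    using keys by (auto simp: A_def walk_words_def wd_def)
  have walkA: "\<exists>u. awalk u p v" if "p \<in> A" for p
  proof -
    from that keys have "wd p \<in> walk_words E v" by (auto simp: A_def)
    then obtain p' u where "wd p = wd p'" "awalk u p' v" by (auto simp: walk_words_def wd_def)
    then show ?thesis using inj by (auto dest: injD)
  qed
  have "z = (\<Sum>w\<in>wd ` A. Poly_Mapping.single w (Poly_Mapping.lookup z w))"
    using sum_single_lookup[of z] img by simp
  also have "\<dots> = (\<Sum>p\<in>A. scal (c p) * epath p)"
    by (subst sum.reindex) (auto simp: inj_on_subset[OF inj] epath_def mult_single c_def wd_def)
  finally have z: "z = (\<Sum>p\<in>A. scal (c p) * epath p)" .
  have "A \<noteq> {}" using nz img by auto
  then obtain m where m: "m \<in> A" "\<And>p. p \<in> A \<Longrightarrow> length m \<le> length p"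
    using ex_has_least_nat[of "\<lambda>p. p \<in> A" _ length] by blast
  define B where "B = {p. p \<noteq> [] \<and> m @ p \<in> A \<and> awalk v p v}"
  have finB: "finite B"
    by (rule finite_subset[OF _ finite_vimageI[OF finA, of "\<lambda>p. m @ p"]]) (auto simp: B_def inj_def)
  define g :: "('v,'e,'k) free_lpa" where "g = Vt v * gpath m"
  have km: "c m \<noteq> 0" using m(1) by (simp add: A_def c_def in_keys_iff)
  \<comment> \<open>The contribution of \<open>p\<close>: the leading term, a closed remainder, or
    nothing.\<close>
  define t where "t p = (if p = m then scal (c m) * Vt v else if \<exists>q\<in>B. p = m @ q then
      scal (c p) * (epath (drop (length m) p) * Vt v) else 0)" for p
  have summand: "g * (epath p * Vt v) * scal (c p) \<approx> t p" if p: "p \<in> A" for p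
  proof (cases "\<exists>r. p = m @ r")
    case False
    then have "gpath m * epath p \<approx> 0" using m(2)[OF p] by (intro gpath_epath_neq) auto
    then have "Vt v * ((gpath m * epath p) * Vt v) * scal (c p) \<approx> 0"
      by (rule cong_zero_right[OF cong_zero_left[OF cong_zero_right]])
    moreover have "t p = 0" using False by (auto simp: t_def)
    ultimately show ?thesis by (simp add: g_def mult.assoc)
  next
    case True
    then obtain r where r: "p = m @ r" by blast
    from walkA[OF p] r obtain u w where w: "awalk u m w" "awalk w r v" by auto
    have wv: "w \<in> verts E" using w by auto
    have "gpath m * (epath p * Vt v) = gpath m * (epath m * (epath r * Vt v))"
      by (simp add: r epath_append mult.assoc)
    also have "\<dots> \<approx> gpath m * (epath m * (Vt w * (epath r * Vt v)))"
      by (rule cong_left[OF cong_left[OF cong_sym[OF V_epath[OF w(2)]]]])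
    also have "\<dots> = (gpath m * (epath m * Vt w)) * (epath r * Vt v)" by (simp add: mult.assoc)
    also have "\<dots> \<approx> Vt w * (epath r * Vt v)"
      by (rule cong_right[OF gpath_epath[OF w(1)]])
    finally have 1: "gpath m * (epath p * Vt v) \<approx> Vt w * (epath r * Vt v)" .
    have 2: "g * (epath p * Vt v) \<approx> Vt v * (Vt w * (epath r * Vt v))"
      using cong_left[OF 1, of "Vt v"] by (simp add: g_def mult.assoc)
    show ?thesis
    proof (cases "w = v")
      \<comment> \<open>This happens only for empty \<open>m\<close>: a nonempty member of
        \<open>A\<close> determines its end, which is v.\<close>
      case False
      have "(Vt v * Vt w) * (epath r * Vt v) \<approx> 0"
        using False by (intro cong_zero_right VV_neq) auto
      with 2 have 3: "g * (epath p * Vt v) \<approx> 0" by (simp add: mult.assoc) (rule cong_trans)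
      have "r \<noteq> []" using w False by (auto simp: awalk_Nil_iff)
      moreover have "\<not> awalk v r v" using w False \<open>r \<noteq> []\<close> by (auto simp: awalk_ends_eqD awalk_Cons_iff neq_Nil_conv)
      ultimately have "t p = 0" by (auto simp: t_def r B_def)
      then show ?thesis using 3 by (simp add: cong_zero_right)
    next
      case True
      have "Vt v * (Vt v * (epath r * Vt v)) \<approx> epath r * Vt v"
        using True cong_left[OF V_epath[OF w(2)], of "Vt v"] V_epath[OF w(2)] cong_trans by auto
      with 2 True have 3: "g * (epath p * Vt v) \<approx> epath r * Vt v" using cong_trans by auto
      have "t p = (epath r * Vt v) * scal (c p)"
      proof (cases "r = []")
        case True
        then show ?thesis by (simp add: t_def r scal_commute)
      next
        case False
        then have "r \<in> B" using p r w(2) True by (auto simp: B_def)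
        then show ?thesis using False by (auto simp: t_def r scal_commute mult.assoc)
      qed
      then show ?thesis using cong_right[OF 3] by simp
    qed
  qed
  have "g * (z * Vt v) = (\<Sum>p\<in>A. g * (epath p * Vt v) * scal (c p))"
    unfolding z by (simp add: sum_distrib_left sum_distrib_right scal_commute[of "c _"] mult.assoc)
  also have "\<dots> \<approx> sum t A" by (rule cong_sum) (rule summand)
  also have "sum t A = t m + sum t (A - {m})"
    using m(1) finA by (simp add: sum.remove)
  also have "sum t (A - {m}) = sum t ((\<lambda>q. m @ q) ` B)"
    by (rule sum.mono_neutral_right) (auto simp: finA B_def t_def)
  also have "\<dots> = (\<Sum>q\<in>B. scal (c (m @ q)) * (epath q * Vt v))"
    by (subst sum.reindex) (auto simp: inj_on_def t_def B_def intro!: sum.cong)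
  finally have "g * (z * Vt v) \<approx> scal (c m) * Vt v + (\<Sum>q\<in>B. scal (c (m @ q)) * (epath q * Vt v))"
    by (simp add: t_def)
  then show ?thesis by (rule that[OF km finB, rotated]) (simp add: B_def)
qed

lemma vertex_mem_of_walk_combination:
  assumes K: "condition_K E" and keys: "Poly_Mapping.keys z \<subseteq> walk_words E v" and nz: "z \<noteq> 0"
    and mem: "z * Vt v \<in> I"
  shows "Vt v \<in> I"
proof (cases "v \<in> verts E")
  case False
  then show ?thesis using foreign_Vert cong_zero_iff by blast
next
  case v: True
  obtain k B g c where k: "k \<noteq> 0" and B: "finite B"
    "\<forall>p\<in>B. awalk v p v \<and> p \<noteq> []"
    and eq: "g * (z * Vt v) \<approx> scal k * Vt v + (\<Sum>p\<in>B. scal (c p) * (epath p * Vt v))" (is "_ \<approx> ?s")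
    by (rule leading_vertex[OF keys nz]) (rule that)
  from mult_left_mem[OF mem] eq have s: "?s \<in> I" using cong_mem_iff by blast
  obtain q where q: "awalk v q v" "\<forall>p\<in>B. \<nexists>x. p @ q = q @ x"
    by (rule condition_K_aperiodic_closed_path[OF K v B(1)]) (use B(2) that in auto)
  have 1: "gpath q * ((scal k * Vt v) * (epath q * Vt v)) \<approx> scal k * Vt v"
  proof -
    have "gpath q * ((scal k * Vt v) * (epath q * Vt v)) = scal k * (gpath q * (Vt v * (epath q * Vt v)))"
      by (simp add: mult.assoc scal_left_commute)
    also have "\<dots> \<approx> scal k * (gpath q * (epath q * Vt v))"
      by (intro cong_left V_epath q(1))
    also have "\<dots> \<approx> scal k * Vt v"
      by (rule cong_left[OF gpath_epath[OF q(1)]])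
    finally show ?thesis .
  qed
  have 2: "gpath q * ((scal (c p) * (epath p * Vt v)) * (epath q * Vt v)) \<approx> 0" if p: "p \<in> B" for p
  proof -
    have "gpath q * ((scal (c p) * (epath p * Vt v)) * (epath q * Vt v)) =
        scal (c p) * (gpath q * (epath p * (Vt v * (epath q * Vt v))))"
      by (simp add: mult.assoc scal_left_commute)
    also have "\<dots> \<approx> scal (c p) * (gpath q * (epath p * (epath q * Vt v)))"
      by (intro cong_left V_epath q(1))
    also have "\<dots> = scal (c p) * ((gpath q * epath (p @ q)) * Vt v)"
      by (simp add: epath_append mult.assoc)
    also have "\<dots> \<approx> 0"
      using q(2) p by (intro cong_zero_left cong_zero_right gpath_epath_neq) auto
    finally show ?thesis .
  qed
  have "gpath q * (?s * (epath q * Vt v)) = gpath q * ((scal k * Vt v) * (epath q * Vt v)) +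
      (\<Sum>p\<in>B. gpath q * ((scal (c p) * (epath p * Vt v)) * (epath q * Vt v)))"
    by (simp add: distrib_left distrib_right sum_distrib_left sum_distrib_right)
  also have "\<dots> \<approx> scal k * Vt v + (\<Sum>p\<in>B. 0)"
    by (intro cong_add cong_sum 1 2)
  finally have "gpath q * (?s * (epath q * Vt v)) \<approx> scal k * Vt v" by simp
  moreover have "gpath q * (?s * (epath q * Vt v)) \<in> I"
    by (intro mult_left_mem mult_right_mem s)
  ultimately have "scal k * Vt v \<in> I" using cong_mem_iff by blast
  then show ?thesis using scal_mem_cancel k by blast
qed

section \<open>Vertices and elements v^H in an ideal\<close>

definition vertex_set :: "'v set" where
  "vertex_set = {v \<in> verts E. Vt v \<in> I}"

lemma Ed_mem_of_tail: "Vt (tail E e) \<in> I \<Longrightarrow> Ed e \<in> I"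
  using V_Ed cong_mem_iff mult_right_mem by blast

lemma Ed_mem_of_head: "Vt (head E e) \<in> I \<Longrightarrow> Ed e \<in> I"
  using Ed_V cong_mem_iff mult_left_mem by blast

lemma head_mem: "e \<in> arcs E \<Longrightarrow> Vt (tail E e) \<in> I \<Longrightarrow> Vt (head E e) \<in> I"
  using Gh_Ed cong_mem_iff mult_left_mem Ed_mem_of_tail by blast

lemma awalk_vertex_mem: "awalk u p v \<Longrightarrow> Vt u \<in> I \<Longrightarrow> Vt v \<in> I"
  by (induction p arbitrary: u) (auto simp: awalk_Nil_iff awalk_Cons_iff intro: head_mem)

lemma hereditary_vertex_set: "hereditary E vertex_set"
  by (auto simp: hereditary_def vertex_set_def intro: awalk_vertex_mem)

lemma saturated_vertex_set: "saturated E vertex_set"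
  unfolding saturated_def
proof (intro allI impI)
  fix v assume v: "regular_vertex E v" "head E ` out_arcs E v \<subseteq> vertex_set"
  have "(\<Sum>e\<in>out_arcs E v. Ed e * Gh e) \<in> I"
    using v(2) by (intro sum_mem mult_right_mem Ed_mem_of_head) (force simp: vertex_set_def)
  then show "v \<in> vertex_set"
    using regular_sum[OF v(1)] cong_mem_iff v(1) by (auto simp: vertex_set_def regular_vertex_def)
qed

lemma V_breaking: "Vt v * breaking_element E H v \<approx> breaking_element E H v"
proof -
  have "Vt v * breaking_element E H v = Vt v * Vt v -
     (\<Sum>e \<in> {e \<in> out_arcs E v. head E e \<in> verts E - H}. (Vt v * Ed e) * Gh e)"
    by (simp add: breaking_element_def right_diff_distrib sum_distrib_left mult.assoc)
  also have "\<dots> \<approx> breaking_element E H v"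
    unfolding breaking_element_def
    using V_Ed by (intro cong_minus VV cong_sum cong_right) auto
  finally show ?thesis .
qed

lemma breaking_V: "breaking_element E H v * Vt v \<approx> breaking_element E H v"
proof -
  have "breaking_element E H v * Vt v = Vt v * Vt v -
     (\<Sum>e \<in> {e \<in> out_arcs E v. head E e \<in> verts E - H}. Ed e * (Gh e * Vt v))"
    by (simp add: breaking_element_def left_diff_distrib sum_distrib_right mult.assoc)
  also have "\<dots> \<approx> breaking_element E H v"
    unfolding breaking_element_def
    using Gh_V by (intro cong_minus VV cong_sum cong_left) auto
  finally show ?thesis .
qed

lemma sum_Ed_Gh_Ed:
  assumes "finite F" "f \<in> F" "F \<subseteq> arcs E"
  shows "(\<Sum>e\<in>F. Ed e * Gh e) * Ed f \<approx> Ed f"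
proof -
  have "(\<Sum>e\<in>F. Ed e * Gh e) * Ed f = (\<Sum>e\<in>F. Ed e * (Gh e * Ed f))"
    by (simp add: sum_distrib_right mult.assoc)
  also have "\<dots> \<approx> (\<Sum>e\<in>F. if e = f then Ed f else 0)"
  proof (rule cong_sum)
    fix e assume "e \<in> F"
    show "Ed e * (Gh e * Ed f) \<approx> (if e = f then Ed f else 0)"
    proof (cases "e = f")
      case True
      have "Ed f * (Gh f * Ed f) \<approx> Ed f * Vt (head E f)"
        using assms by (intro cong_left Gh_Ed) auto
      also have "\<dots> \<approx> Ed f" by (rule Ed_V)
      finally show ?thesis using True by simp
    qed (simp add: cong_zero_left Gh_Ed_neq)
  qed
  also have "\<dots> = Ed f" using assms by simp
  finally show ?thesis .
qed

text \<open>f f^* is among the projections subtracted from v, so v^H f = f - f. The cross terms in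
  the square of v^H vanish for this reason.\<close>

lemma breaking_Ed:
  assumes v: "v \<in> breaking_vertices E H" and f: "f \<in> out_arcs E v" "head E f \<notin> H"
  shows "breaking_element E H v * Ed f \<approx> 0"
proof -
  let ?F = "{e \<in> out_arcs E v. head E e \<in> verts E - H}"
  have "Vt v * Ed f - (\<Sum>e\<in>?F. Ed e * Gh e) * Ed f \<approx> Ed f - Ed f"
    using v f V_Ed[of f] by (intro cong_minus sum_Ed_Gh_Ed) (auto simp: breaking_vertices_def)
  then show ?thesis by (simp add: breaking_element_def left_diff_distrib)
qed

lemma breaking_idem:
  assumes v: "v \<in> breaking_vertices E H"
  shows "breaking_element E H v * breaking_element E H v \<approx> breaking_element E H v"
proof -
  let ?F = "{e \<in> out_arcs E v. head E e \<in> verts E - H}" and ?b = "breaking_element E H v"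
  have "?b * ?b = ?b * Vt v - (\<Sum>e\<in>?F. (?b * Ed e) * Gh e)"
    by (subst (2) breaking_element_def) (simp add: right_diff_distrib sum_distrib_left mult.assoc)
  also have "\<dots> \<approx> ?b - (\<Sum>e\<in>?F. 0)"
    using v by (intro cong_minus cong_sum breaking_V cong_zero_right breaking_Ed) auto
  finally show ?thesis by simp
qed

text \<open>Here v^H itself isolates the leading term. The first edge of a nonempty closed path at v
  has a head that leads back to v, which is outside the hereditary set; hence that head is outside
  too, and v^H kills the edge.\<close>

lemma breaking_mem_of_walk_combination:
  assumes v: "v \<in> breaking_vertices E vertex_set" and keys: "Poly_Mapping.keys z \<subseteq> walk_words E v"
    and nz: "z \<noteq> 0" and mem: "z * breaking_element E vertex_set v \<in> I"
  shows "breaking_element E vertex_set v \<in> I"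
proof -
  let ?b = "breaking_element E vertex_set v"
  have v': "v \<in> verts E" "v \<notin> vertex_set" using v by (auto simp: breaking_vertices_def)
  obtain k B g c where k: "k \<noteq> 0" and B: "finite B"
    "\<forall>p\<in>B. awalk v p v \<and> p \<noteq> []"
    and eq: "g * (z * Vt v) \<approx> scal k * Vt v + (\<Sum>p\<in>B. scal (c p) * (epath p * Vt v))" (is "_ \<approx> ?s")
    by (rule leading_vertex[OF keys nz]) (rule that)
  have 1: "?b * epath p \<approx> 0" if p: "p \<in> B" for p
  proof -
    have "awalk v p v" "p \<noteq> []" using B(2) p by auto
    then obtain f r where fr: "p = f # r" "f \<in> out_arcs E v" "awalk (head E f) r v"
      by (cases p) (auto simp: awalk_Cons_iff)
    have "head E f \<notin> vertex_set"
      using fr(3) v' awalk_vertex_mem by (auto simp: vertex_set_def)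
    then have "(?b * Ed f) * epath r \<approx> 0"
      using fr v by (intro cong_zero_right breaking_Ed) auto
    then show ?thesis by (simp add: fr epath_Cons mult.assoc)
  qed
  have "(?b * g) * (z * ?b) = (?b * g * z) * ?b" by (simp add: mult.assoc)
  also have "\<dots> \<approx> (?b * g * z) * (Vt v * ?b)"
    by (rule cong_left[OF cong_sym[OF V_breaking]])
  also have "\<dots> = ?b * (g * (z * Vt v)) * ?b" by (simp add: mult.assoc)
  also have "\<dots> \<approx> ?b * ?s * ?b" by (intro cong_left cong_right eq)
  also have "\<dots> = scal k * ((?b * Vt v) * ?b) + (\<Sum>p\<in>B. scal (c p) * ((?b * epath p) * (Vt v * ?b)))"
    by (simp add: distrib_left distrib_right sum_distrib_left sum_distrib_right mult.assoc
        scal_left_commute)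
  also have "\<dots> \<approx> scal k * (?b * ?b) + (\<Sum>p\<in>B. 0)"
    by (intro cong_add cong_sum cong_left cong_right breaking_V cong_zero_left cong_zero_right 1)
  also have "\<dots> \<approx> scal k * ?b"
    using cong_left[OF breaking_idem[OF v]] by simp
  finally have "(?b * g) * (z * ?b) \<approx> scal k * ?b" .
  then have "scal k * ?b \<in> I" using mult_left_mem[OF mem] cong_mem_iff by blast
  then show ?thesis using scal_mem_cancel k by blast
qed

end

section \<open>Reduction of ghost edges\<close>

context lpa_ideal
begin

text \<open>
  Elements of the form \<open>x v\<close>, built up by the number of ghost edges at the right end.
\<close>

inductive ghost_form :: "'v \<Rightarrow> ('v,'e,'k) free_lpa \<Rightarrow> bool" where
  zero: "ghost_form v 0"
| step: "finite F \<Longrightarrow> F \<subseteq> out_arcs E v \<Longrightarrow> (\<And>e. ghost_form (head E e) (b e)) \<Longrightarrow>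
    (\<And>e. e \<notin> F \<Longrightarrow> b e = 0) \<Longrightarrow> Poly_Mapping.keys x \<subseteq> walk_words E v \<Longrightarrow>
    ghost_form v ((\<Sum>e\<in>F. b e * Gh e) + x * Vt v)"
| resp: "ghost_form v a \<Longrightarrow> a \<approx> b \<Longrightarrow> ghost_form v b"

lemma ghost_form_V: "ghost_form v a \<Longrightarrow> a * Vt v \<approx> a"
proof (induction rule: ghost_form.induct)
  case (zero v)
  then show ?case by simp
next
  case (step F v b x)
  have "((\<Sum>e\<in>F. b e * Gh e) + x * Vt v) * Vt v = (\<Sum>e\<in>F. b e * (Gh e * Vt v)) + x * (Vt v * Vt v)"
    by (simp add: distrib_right sum_distrib_right mult.assoc)
  also have "\<dots> \<approx> (\<Sum>e\<in>F. b e * Gh e) + x * Vt v"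
    by (intro cong_add cong_sum cong_left VV) (metis Gh_V in_out_arcs_conv step.hyps(2) subsetD)
  finally show ?case .
next
  case (resp v a b)
  from cong_trans[OF cong_trans[OF cong_right[OF cong_sym[OF resp.hyps(2)]] resp.IH] resp.hyps(2)]
  show ?case .
qed

text \<open>The rule \<open>resp\<close> blocks plain inversion. Modulo \<open>I\<close>, one layer
  of ghost edges can nevertheless be split off from every ghost form, zero being the case of an
  empty layer.\<close>

lemma ghost_form_normal:
  "ghost_form v a \<Longrightarrow> \<exists>F b x. finite F \<and> F \<subseteq> out_arcs E v \<and> (\<forall>e. ghost_form (head E e) (b e)) \<and>
    (\<forall>e. e \<notin> F \<longrightarrow> b e = 0) \<and> Poly_Mapping.keys x \<subseteq> walk_words E v \<and>
    a \<approx> (\<Sum>e\<in>F. b e * Gh e) + x * Vt v"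
proof (induction rule: ghost_form.induct)
  case (zero v)
  show ?case
    by (rule exI[of _ "{}"], rule exI[of _ "\<lambda>_. 0"], rule exI[of _ 0]) (simp add: ghost_form.zero)
next
  case (step F v b x)
  then show ?case by (intro exI[of _ F] exI[of _ b] exI[of _ x]) simp
next
  case (resp v a a')
  have "a \<approx> c \<Longrightarrow> a' \<approx> c" for c by (rule cong_trans[OF cong_sym[OF resp.hyps(2)]])
  with resp.IH show ?case by blast
qed

lemma ghost_form_add: "ghost_form v a \<Longrightarrow> ghost_form v t \<Longrightarrow> ghost_form v (a + t)"
proof (induction arbitrary: t rule: ghost_form.induct)
  case (zero v)
  then show ?case by simp
next
  case (step F v b x)
  from ghost_form_normal[OF step.prems] obtain F' b' x' where F': "finite F'" "F' \<subseteq> out_arcs E v"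
    "\<And>e. ghost_form (head E e) (b' e)" "\<And>e. e \<notin> F' \<Longrightarrow> b' e = 0" "Poly_Mapping.keys x' \<subseteq> walk_words E v"
    "t \<approx> (\<Sum>e\<in>F'. b' e * Gh e) + x' * Vt v" by blast
  define b'' where "b'' e = b e + b' e" for e
  \<comment> \<open>\<open>b\<close> and \<open>b'\<close> are 0 outside \<open>F\<close> and
    \<open>F'\<close>, so both sums extend to the union.\<close>
  have "(\<Sum>e\<in>F. b e * Gh e) = (\<Sum>e\<in>F \<union> F'. b e * Gh e)"
    "(\<Sum>e\<in>F'. b' e * Gh e) = (\<Sum>e\<in>F \<union> F'. b' e * Gh e)"
    using step.hyps F' by (auto intro!: sum.mono_neutral_left)
  then have eq: "((\<Sum>e\<in>F. b e * Gh e) + x * Vt v) + ((\<Sum>e\<in>F'. b' e * Gh e) + x' * Vt v) =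
      (\<Sum>e\<in>F \<union> F'. b'' e * Gh e) + (x + x') * Vt v"
    by (simp add: b''_def distrib_right sum.distrib algebra_simps)
  have "ghost_form v ((\<Sum>e\<in>F \<union> F'. b'' e * Gh e) + (x + x') * Vt v)"
  proof (rule ghost_form.step)
    show "ghost_form (head E e) (b'' e)" for e
      using step.IH F' unfolding b''_def by blast
    show "Poly_Mapping.keys (x + x') \<subseteq> walk_words E v"
      using keys_add[of x x'] step.hyps F' by blast
  qed (use step.hyps F' in \<open>auto simp: b''_def\<close>)
  then show ?case unfolding eq[symmetric]
    by (rule ghost_form.resp) (intro cong_add cong_refl cong_sym[OF F'(6)])
next
  case (resp v a a')
  then have "ghost_form v (a + t)" by simp
  then show ?case by (rule ghost_form.resp) (intro cong_add cong_refl resp)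
qed

lemma ghost_form_sum: "(\<And>i. i \<in> A \<Longrightarrow> ghost_form v (f i)) \<Longrightarrow> ghost_form v (sum f A)"
  by (induction A rule: infinite_finite_induct) (auto intro: ghost_form.zero ghost_form_add)

lemma ghost_form_of_zero: "a \<approx> 0 \<Longrightarrow> ghost_form v a"
  using ghost_form.resp[OF ghost_form.zero] cong_sym by blast

lemma ghost_form_walks: "Poly_Mapping.keys x \<subseteq> walk_words E v \<Longrightarrow> ghost_form v (x * Vt v)"
  using ghost_form.step[of "{}" v "\<lambda>_. 0" x] by (simp add: ghost_form.zero)

lemma ghost_form_walk: "awalk u p v \<Longrightarrow> ghost_form v (scal c * (epath p * Vt v))"
  unfolding mult.assoc[symmetric]
  by (rule ghost_form_walks) (auto simp: epath_def mult_single walk_words_def)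

text \<open>Against a path, a vertex or an edge gives a path or 0, and a ghost edge cancels the
  first edge or gives 0. Only a ghost edge against the empty path creates a new layer, with
  coefficient r(e) because e^* = r(e) e^* modulo \<open>I\<close>.\<close>

lemma ghost_form_gen_walk:
  assumes w: "awalk u p v"
  shows "ghost_form v (gen g * (epath p * Vt v))"
proof (cases g)
  case (Vert u')
  have 1: "Vt u' * (epath p * Vt v) \<approx> (Vt u' * Vt u) * (epath p * Vt v)"
    using cong_left[OF cong_sym[OF V_epath[OF w]]] by (simp add: mult.assoc)
  show ?thesis
  proof (cases "u' = u")
    case True
    then have "epath p * Vt v \<approx> gen g * (epath p * Vt v)" using V_epath[OF w] cong_sym Vert by auto
    moreover have "ghost_form v (epath p * Vt v)" using ghost_form_walk[OF w, of 1] by simp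
    ultimately show ?thesis using ghost_form.resp by blast
  next
    case False
    then have "gen g * (epath p * Vt v) \<approx> 0"
      using 1 cong_zero_right[OF VV_neq] cong_trans Vert by blast
    then show ?thesis by (rule ghost_form_of_zero)
  qed
next
  case (Edge e)
  show ?thesis
  proof (cases "e \<in> arcs E \<and> head E e = u")
    case True
    then have "awalk (tail E e) (e # p) v" using w by (auto simp: awalk_Cons_iff)
    from ghost_form_walk[OF this, of 1] show ?thesis by (simp add: Edge epath_Cons mult.assoc)
  next
    case False
    have "gen g * (epath p * Vt v) \<approx> 0"
    proof (cases "e \<in> arcs E")
      case True
      have "gen g * (epath p * Vt v) \<approx> (Ed e * Vt u) * (epath p * Vt v)"
        using cong_left[OF cong_sym[OF V_epath[OF w]]] by (simp add: mult.assoc Edge)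
      also have "\<dots> \<approx> 0" using True False by (intro cong_zero_right Ed_V_neq) auto
      finally show ?thesis .
    qed (simp add: Edge cong_zero_right foreign_Edge)
    then show ?thesis by (rule ghost_form_of_zero)
  qed
next
  case (Ghost e)
  show ?thesis
  proof (cases p)
    case Nil
    show ?thesis
    proof (cases "e \<in> out_arcs E v")
      case True
      have "ghost_form v ((\<Sum>f\<in>{e}. (if f = e then Vt (head E e) else 0) * Gh f) + 0 * Vt v)"
      proof (rule ghost_form.step)
        have "awalk (head E e) [] (head E e)" using True by (simp add: awalk_Nil_iff)
        from ghost_form_walk[OF this, of 1] ghost_form.zero
        show "ghost_form (head E f) (if f = e then Vt (head E e) else 0)" for f by auto
      qed (use True in auto)
      moreover have "Vt (head E e) * Gh e \<approx> Gh e * Vt v"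
        using cong_trans[OF V_Gh[of e] cong_sym[OF Gh_V[of e]]] True by simp
      ultimately show ?thesis using Nil Ghost ghost_form.resp by auto
    next
      case False
      then have "Gh e * Vt v \<approx> 0"
        using Gh_V_neq foreign_Ghost[THEN cong_zero_right] by fastforce
      then show ?thesis using Nil Ghost ghost_form_of_zero by auto
    qed
  next
    case (Cons f q)
    then have f: "f \<in> arcs E" and q: "awalk (head E f) q v" using w by (auto simp: awalk_Cons_iff)
    have eq: "gen g * (epath p * Vt v) = (Gh e * Ed f) * (epath q * Vt v)"
      by (simp add: Ghost Cons epath_Cons mult.assoc)
    show ?thesis
    proof (cases "e = f")
      case True
      have "gen g * (epath p * Vt v) \<approx> Vt (head E f) * (epath q * Vt v)"
        unfolding eq True by (intro cong_right Gh_Ed f)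
      also have "\<dots> \<approx> epath q * Vt v" by (rule V_epath[OF q])
      finally show ?thesis
        using ghost_form_walk[OF q, of 1] ghost_form.resp cong_sym by auto
    next
      case False
      then have "gen g * (epath p * Vt v) \<approx> 0"
        unfolding eq by (intro cong_zero_right Gh_Ed_neq)
      then show ?thesis by (rule ghost_form_of_zero)
    qed
  qed
qed

lemma ghost_form_scal: "ghost_form v a \<Longrightarrow> ghost_form v (scal c * a)"
proof (induction rule: ghost_form.induct)
  case (zero v)
  then show ?case by (simp add: ghost_form.zero)
next
  case (step F v b x)
  have eq: "scal c * ((\<Sum>e\<in>F. b e * Gh e) + x * Vt v) =
      (\<Sum>e\<in>F. (scal c * b e) * Gh e) + (scal c * x) * Vt v"
    by (simp add: distrib_left sum_distrib_left mult.assoc)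
  have "Poly_Mapping.keys (scal c * x) \<subseteq> Poly_Mapping.keys x"
    using keys_mult[of "scal c" x] by (auto split: if_splits)
  then show ?case unfolding eq using step by (intro ghost_form.step) auto
next
  case (resp v a b)
  then show ?case using ghost_form.resp cong_left by blast
qed

text \<open>The letter is passed on to the coefficients \<open>b e\<close> by induction, so only the
  part without ghost edges needs work; it is expanded into paths.\<close>

lemma ghost_form_gen: "ghost_form v a \<Longrightarrow> ghost_form v (gen g * a)"
proof (induction rule: ghost_form.induct)
  case (zero v)
  then show ?case by (simp add: ghost_form.zero)
next
  case (step F v b x)
  have "ghost_form v (gen g * (Poly_Mapping.single w (Poly_Mapping.lookup x w) * Vt v))"
    if "w \<in> Poly_Mapping.keys x" for w
  proof -
    from that step.hyps obtain u p where p: "w = Word (map Edge p)" "awalk u p v"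
      by (auto simp: walk_words_def)
    have "gen g * (Poly_Mapping.single w (Poly_Mapping.lookup x w) * Vt v) =
        scal (Poly_Mapping.lookup x w) * (gen g * (epath p * Vt v))"
      by (subst single_eq_scal) (simp add: epath_def p mult.assoc scal_left_commute)
    then show ?thesis using ghost_form_scal[OF ghost_form_gen_walk[OF p(2)]] by simp
  qed
  then have "ghost_form v (\<Sum>w\<in>Poly_Mapping.keys x.
      gen g * (Poly_Mapping.single w (Poly_Mapping.lookup x w) * Vt v))"
    by (rule ghost_form_sum)
  also have "(\<Sum>w\<in>Poly_Mapping.keys x. gen g * (Poly_Mapping.single w (Poly_Mapping.lookup x w) * Vt v))
      = gen g * ((\<Sum>w\<in>Poly_Mapping.keys x. Poly_Mapping.single w (Poly_Mapping.lookup x w)) * Vt v)"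
    by (simp add: sum_distrib_left sum_distrib_right)
  finally have 1: "ghost_form v (gen g * (x * Vt v))" by (simp add: sum_single_lookup)
  have 2: "ghost_form v ((\<Sum>e\<in>F. (gen g * b e) * Gh e) + 0 * Vt v)"
    using step by (intro ghost_form.step) auto
  from ghost_form_add[OF 2 1] show ?case
    by (simp add: distrib_left sum_distrib_left mult.assoc)
next
  case (resp v a b)
  then show ?case using ghost_form.resp cong_left by blast
qed

text \<open>Each word is built up in front of v from its right end, one letter at a time.\<close>

lemma ghost_form_mult_V: "ghost_form v (a * Vt v)"
proof (induction a rule: poly_mapping_additive_induct)
  case zero
  then show ?case by (simp add: ghost_form.zero)
next
  case (add a b)
  then show ?case by (simp add: distrib_right ghost_form_add)
next
  case (single w c)
  obtain xs where w: "w = Word xs" by (cases w)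
  have "ghost_form v (Poly_Mapping.single (Word xs) c * Vt v)"
  proof (induction xs)
    case Nil
    show ?case
    proof (cases "v \<in> verts E")
      case True
      then have "awalk v [] v" by (simp add: awalk_Nil_iff)
      from ghost_form_walk[OF this, of c] show ?thesis by (simp add: Word_Nil)
    next
      case False
      then show ?thesis by (intro ghost_form_of_zero cong_zero_left foreign_Vert)
    qed
  next
    case (Cons x xs)
    then show ?case by (simp add: single_Word_Cons mult.assoc ghost_form_gen)
  qed
  then show ?case by (simp add: w)
qed

text \<open>A nonempty word is fixed under right multiplication by one vertex, determined by its
  last letter, and killed by all others. The empty word has no last letter, hence the hypothesis on
  the constant term.\<close>

lemma local_unit:
  assumes "Poly_Mapping.lookup a 0 = 0"
  obtains A where "finite A" "a \<approx> (\<Sum>v\<in>A. a * Vt v)"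
proof -
  define rt where "rt x = (case x of Vert v \<Rightarrow> v | Edge e \<Rightarrow> head E e | Ghost e \<Rightarrow> tail E e)" for x
  have rt: "gen x * Vt v \<approx> (if v = rt x then gen x else 0)" for x v
    using VV VV_neq Ed_V Ed_V_neq Gh_V Gh_V_neq by (auto simp: rt_def split: lpa_gen.split)
  define A where "A = (\<lambda>w. rt (last (letters w))) ` Poly_Mapping.keys a"
  have A: "finite A" by (simp add: A_def)
  have 1: "(\<Sum>v\<in>A. Poly_Mapping.single w c * Vt v) \<approx> Poly_Mapping.single w c"
    if w: "w \<in> Poly_Mapping.keys a" for w c
  proof -
    have "letters w \<noteq> []" using assms w by (cases w) (auto simp: in_keys_iff Word_Nil)
    then obtain xs x where xs: "letters w = xs @ [x]" by (metis rev_exhaust)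
    then have s: "Poly_Mapping.single w c = Poly_Mapping.single (Word xs) c * gen x"
      by (cases w) (simp add: gen_def mult_single Word_plus)
    have x: "rt x \<in> A" using w xs by (auto simp: A_def intro!: image_eqI[of _ _ w])
    have "(\<Sum>v\<in>A. Poly_Mapping.single w c * Vt v) =
        Poly_Mapping.single (Word xs) c * (\<Sum>v\<in>A. gen x * Vt v)"
      by (simp add: s sum_distrib_left mult.assoc)
    also have "\<dots> \<approx> Poly_Mapping.single (Word xs) c * (\<Sum>v\<in>A. if v = rt x then gen x else 0)"
      by (intro cong_left cong_sum rt)
    also have "\<dots> = Poly_Mapping.single w c" using A x by (simp add: s)
    finally show ?thesis .
  qed
  have "(\<Sum>v\<in>A. a * Vt v) =
      (\<Sum>v\<in>A. (\<Sum>w\<in>Poly_Mapping.keys a. Poly_Mapping.single w (Poly_Mapping.lookup a w)) * Vt v)"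
    by (simp add: sum_single_lookup)
  also have "\<dots> = (\<Sum>w\<in>Poly_Mapping.keys a. \<Sum>v\<in>A. Poly_Mapping.single w (Poly_Mapping.lookup a w) * Vt v)"
    by (subst sum.swap) (simp add: sum_distrib_right)
  also have "\<dots> \<approx> (\<Sum>w\<in>Poly_Mapping.keys a. Poly_Mapping.single w (Poly_Mapping.lookup a w))"
    by (rule cong_sum) (rule 1)
  also have "\<dots> = a" by (rule sum_single_lookup)
  finally show ?thesis using that[OF A] cong_sym by blast
qed

text \<open>
  Induction on the number of ghost edges: multiplying by an edge \<open>e\<close> removes them. If all the
  products lie in \<open>I\<close>, the element is congruent to \<open>z (v - \<Sum> e e\<^sup>*)\<close> with \<open>z\<close> a combination of paths.
\<close>

lemma mem_of_vertices_mem: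
  assumes K: "condition_K E" and M: "lpa_ideal E M" and sub: "I \<subseteq> M"
    and vert: "\<And>v. Vt v \<in> M \<Longrightarrow> Vt v \<in> I"
    and brk: "\<And>v. v \<in> breaking_vertices E vertex_set \<Longrightarrow>
       breaking_element E vertex_set v \<in> M \<Longrightarrow> breaking_element E vertex_set v \<in> I"
  shows "ghost_form v a \<Longrightarrow> Poly_Mapping.keys y \<subseteq> walk_words E v \<Longrightarrow> a + y * Vt v \<in> M \<Longrightarrow>
    a + y * Vt v \<in> I"
\<comment> \<open>Multiplication by an edge e leaves \<open>b e\<close> plus a combination of paths;
  \<open>y\<close> makes room for that combination in the induction hypothesis.\<close>
proof (induction arbitrary: y rule: ghost_form.induct)
  case (zero v)
  interpret M: lpa_ideal E M by fact
  show ?case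
  proof (cases "y = 0")
    case False
    then have "Vt v \<in> M"
      using M.vertex_mem_of_walk_combination[OF K zero(1)] zero(2) by simp
    then show ?thesis using vert mult_left_mem by simp
  qed (simp add: zero_mem)
next
  case (resp v a b)
  interpret M: lpa_ideal E M by fact
  have "a + y * Vt v \<approx> b + y * Vt v" using resp.hyps by (intro cong_add cong_refl)
  moreover from this have "M.cong (a + y * Vt v) (b + y * Vt v)"
    using sub by (auto simp: cong_def M.cong_def)
  ultimately show ?case using resp.IH resp.prems cong_mem_iff M.cong_mem_iff by blast
next
  case (step F v b x)
  interpret M: lpa_ideal E M by fact
  have Mcong: "M.cong c d" if "c \<approx> d" for c d
    using that sub by (auto simp: cong_def M.cong_def)
  have vsM: "M.vertex_set = vertex_set"
    using vert sub by (auto simp: vertex_set_def M.vertex_set_def)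
  define z where "z = x + y"
  define a where "a = (\<Sum>e\<in>F. b e * Gh e) + z * Vt v"
  have a_eq: "(\<Sum>e\<in>F. b e * Gh e) + x * Vt v + y * Vt v = a"
    by (simp add: a_def z_def distrib_right)
  have z: "Poly_Mapping.keys z \<subseteq> walk_words E v"
    using keys_add[of x y] step.hyps step.prems by (auto simp: z_def)
  have aM: "a \<in> M" using step.prems by (simp add: a_eq)
  have aV: "a * Vt v \<approx> a"
    unfolding a_def by (rule ghost_form_V[OF ghost_form.step]) (use step z in auto)
  show ?case unfolding a_eq
  proof (cases "Vt v \<in> I")
    case True
    then show "a \<in> I" using aV cong_mem_iff mult_left_mem by blast
  next
    case False
    then have v: "v \<in> verts E" "v \<notin> vertex_set"
      using foreign_Vert by (auto simp: vertex_set_def cong_zero_iff)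
    \<comment> \<open>Modulo \<open>I\<close> this is the product of a with e; its ghost part
      \<open>b e\<close> has one layer less.\<close>
    have b: "b e + (z * Ed e) * Vt (head E e) \<in> I" if e: "e \<in> out_arcs E v" for e
    proof -
      have ge: "Gh f * Ed e \<approx> (if f = e then Vt (head E e) else 0)" for f
        using Gh_Ed[of e] Gh_Ed_neq[of f e] e by auto
      have "a * Ed e = (\<Sum>f\<in>F. b f * (Gh f * Ed e)) + z * (Vt v * Ed e)"
        by (simp add: a_def distrib_right sum_distrib_right mult.assoc)
      also have "\<dots> \<approx> (\<Sum>f\<in>F. b f * (if f = e then Vt (head E e) else 0)) + z * Ed e"
        using V_Ed[of e] e by (intro cong_add cong_sum cong_left ge) auto
      also have "(\<Sum>f\<in>F. b f * (if f = e then Vt (head E e) else 0)) = b e * Vt (head E e)"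
        using step.hyps by (auto simp: if_distrib sum.delta cong: if_cong)
      also have "b e * Vt (head E e) + z * Ed e \<approx> b e + z * (Ed e * Vt (head E e))"
        using step.hyps by (intro cong_add ghost_form_V cong_left cong_sym[OF Ed_V]) auto
      finally have "a * Ed e \<approx> b e + (z * Ed e) * Vt (head E e)" by (simp add: mult.assoc)
      then have "b e + (z * Ed e) * Vt (head E e) \<in> M"
        using Mcong M.cong_mem_iff M.mult_right_mem[OF aM] by blast
      then show ?thesis using step.IH keys_mult_Ed[OF wf_digraph_axioms z e] by blast
    qed
    have bGh: "b e * Gh e \<approx> - (z * (Ed e * Gh e))" if e: "e \<in> out_arcs E v" for e
    proof -
      have "(b e + (z * Ed e) * Vt (head E e)) * Gh e \<in> I" by (intro mult_right_mem b e)
      then have "b e * Gh e + z * (Ed e * (Vt (head E e) * Gh e)) \<approx> 0"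
        by (simp add: cong_zero_iff distrib_right mult.assoc)
      moreover have "b e * Gh e + z * (Ed e * (Vt (head E e) * Gh e)) \<approx> b e * Gh e + z * (Ed e * Gh e)"
        by (intro cong_add cong_left V_Gh cong_refl)
      ultimately have "b e * Gh e + z * (Ed e * Gh e) \<approx> 0" using cong_sym cong_trans by blast
      then show ?thesis by (simp add: cong_def)
    qed
    have zEd: "z * Ed e \<in> I" if "e \<in> out_arcs E v" "e \<notin> F" for e
    proof -
      have "(z * Ed e) * Vt (head E e) \<in> I" using b[OF that(1)] step.hyps(4)[OF that(2)] by simp
      moreover have "(z * Ed e) * Vt (head E e) \<approx> z * Ed e"
        unfolding mult.assoc by (intro cong_left Ed_V)
      ultimately show ?thesis using cong_mem_iff by blast
    qed
    define P where "P = {e \<in> out_arcs E v. head E e \<in> verts E - vertex_set}"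
    have EdI: "Ed e \<in> I" if "e \<in> out_arcs E v - P" for e
      using that by (intro Ed_mem_of_head) (auto simp: P_def vertex_set_def)
    have "a \<approx> (\<Sum>e\<in>F. - (z * (Ed e * Gh e))) + z * Vt v"
      unfolding a_def using step.hyps by (intro cong_add cong_sum bGh cong_refl) auto
    then have a1: "a \<approx> z * (Vt v - (\<Sum>e\<in>F. Ed e * Gh e))"
      by (simp add: right_diff_distrib sum_distrib_left sum_negf)
    have z0: "a \<in> I" if "z = 0"
      using a1 that by (simp add: cong_zero_iff)
    show "a \<in> I"
    proof (cases "finite P")
      case False
      then have "\<not> P \<subseteq> F" using finite_subset[OF _ step.hyps(1)] by auto
      then obtain e where e: "e \<in> P" "e \<notin> F" by auto
      then have ev: "e \<in> out_arcs E v" and h: "Vt (head E e) \<notin> M"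
        using vert by (auto simp: P_def vertex_set_def)
      have "(z * Ed e) * Vt (head E e) \<in> M"
        by (rule subsetD[OF sub mult_right_mem[OF zEd[OF ev e(2)]]])
      from M.vertex_mem_of_walk_combination[OF K keys_mult_Ed[OF wf_digraph_axioms z ev] _ this] h
      have "z * Ed e = 0" by metis
      from mult_Ed_eq_zero[OF this] show ?thesis by (rule z0)
    next
      case finP: True
      \<comment> \<open>Replacing \<open>F\<close> by \<open>P\<close> changes the sum only by
        elements of \<open>I\<close>: the edges in \<open>F - P\<close> belong to \<open>I\<close>,
        and for those in \<open>P - F\<close> the product z e does. This turns the subtracted sum
        into the one of v^H.\<close>
      have "(\<Sum>e\<in>F. z * (Ed e * Gh e)) - (\<Sum>e\<in>P. z * (Ed e * Gh e)) =
          (\<Sum>e\<in>F - P. z * (Ed e * Gh e)) - (\<Sum>e\<in>P - F. z * (Ed e * Gh e))"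
        using sum.Int_Diff[OF step.hyps(1), of "\<lambda>e. z * (Ed e * Gh e)" P]
          sum.Int_Diff[OF finP, of "\<lambda>e. z * (Ed e * Gh e)" F] by (simp add: Int_commute)
      also have "\<dots> \<in> I"
      proof (intro minus_mem sum_mem)
        show "z * (Ed e * Gh e) \<in> I" if "e \<in> F - P" for e
          using that step.hyps(2) by (intro mult_left_mem mult_right_mem EdI) auto
        show "z * (Ed e * Gh e) \<in> I" if "e \<in> P - F" for e
          using mult_right_mem[OF zEd, of e "Gh e"] that by (auto simp: mult.assoc P_def)
      qed
      finally have "z * Vt v - (\<Sum>e\<in>F. z * (Ed e * Gh e)) \<approx> z * Vt v - (\<Sum>e\<in>P. z * (Ed e * Gh e))"
        by (intro cong_minus cong_refl) (simp add: cong_def)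
      with a1 have a2: "a \<approx> z * breaking_element E vertex_set v"
        unfolding breaking_element_def P_def[symmetric]
        by (simp add: right_diff_distrib sum_distrib_left) (rule cong_trans)
      have "v \<in> breaking_vertices E vertex_set" if "\<not> regular_vertex E v" "P \<noteq> {}"
      proof -
        have "out_arcs E v \<noteq> {}" using that(2) unfolding P_def by blast
        then have "infinite_emitter E v" using that(1) v(1) by (simp add: regular_vertex_def infinite_emitter_def)
        then show ?thesis using that(2) v finP unfolding P_def by (simp add: breaking_vertices_def)
      qed
      \<comment> \<open>At a regular vertex v^H lies in \<open>I\<close> by the relation for v; for
        empty \<open>P\<close> it is v itself; in the remaining case the hypothesis on breaking
        vertices applies.\<close>
      then consider (reg) "regular_vertex E v" | (empty) "\<not> regular_vertex E v" "P = {}"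
        | (brk) "v \<in> breaking_vertices E vertex_set"
        by blast
      then show ?thesis
      proof cases
        case reg
        then have fin: "finite (out_arcs E v)" by (simp add: regular_vertex_def)
        have "(\<Sum>e\<in>out_arcs E v. Ed e * Gh e) - (\<Sum>e\<in>P. Ed e * Gh e) =
            (\<Sum>e\<in>out_arcs E v - P. Ed e * Gh e)"
          using fin by (subst sum_diff) (auto simp: P_def)
        also have "\<dots> \<in> I" by (intro sum_mem mult_right_mem EdI)
        finally have "(\<Sum>e\<in>out_arcs E v. Ed e * Gh e) \<approx> (\<Sum>e\<in>P. Ed e * Gh e)"
          by (simp add: cong_def)
        with regular_sum[OF reg] have "Vt v \<approx> (\<Sum>e\<in>P. Ed e * Gh e)" using cong_trans by blast
        then have "breaking_element E vertex_set v \<in> I"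
          by (simp add: breaking_element_def P_def cong_def)
        then show ?thesis using cong_mem_iff[OF a2] mult_left_mem by simp
      next
        case empty
        then have "breaking_element E vertex_set v = (Vt v :: ('v,'e,'k) free_lpa)"
          unfolding breaking_element_def P_def[symmetric] by simp
        then have "z * Vt v \<in> M" using M.cong_mem_iff[OF Mcong[OF a2]] aM by simp
        from M.vertex_mem_of_walk_combination[OF K z _ this] have "z = 0 \<or> Vt v \<in> M" by metis
        then show ?thesis using z0 vert False by blast
      next
        case brk'': brk
        have "z * breaking_element E vertex_set v \<in> M" using M.cong_mem_iff[OF Mcong[OF a2]] aM by simp
        from M.breaking_mem_of_walk_combination[unfolded vsM, OF brk'' z _ this]
        have "z = 0 \<or> breaking_element E vertex_set v \<in> M" by metis
        then show ?thesis using z0 brk[OF brk''] cong_mem_iff[OF a2] mult_left_mem by auto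
      qed
    qed
  qed
qed

text \<open>The common tool for three inclusions: of \<open>M\<close> in an intersection of
  \<open>M\<close> with another ideal, of an ideal in its graded part, and of an ideal in its
  square. Each time the smaller ideal is shown to contain the vertices and the elements v^H of the
  larger one.\<close>

theorem ideal_subset_of_vertices:
  assumes K: "condition_K E" and M: "lpa_ideal E M" and sub: "I \<subseteq> M"
    and vert: "\<And>v. Vt v \<in> M \<Longrightarrow> Vt v \<in> I"
    and brk: "\<And>v. v \<in> breaking_vertices E vertex_set \<Longrightarrow>
       breaking_element E vertex_set v \<in> M \<Longrightarrow> breaking_element E vertex_set v \<in> I"
    and a: "a \<in> M" "Poly_Mapping.lookup a 0 = 0"
  shows "a \<in> I"
proof -
  interpret M: lpa_ideal E M by fact
  obtain A where A: "finite A" "a \<approx> (\<Sum>v\<in>A. a * Vt v)" using local_unit[OF a(2)] .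
  have "a * Vt v \<in> I" for v
    using mem_of_vertices_mem[OF K M sub vert brk ghost_form_mult_V, of 0 v a] M.mult_right_mem[OF a(1)]
    by simp
  then have "(\<Sum>v\<in>A. a * Vt v) \<in> I" by (intro sum_mem)
  with A(2) show ?thesis using cong_mem_iff by blast
qed

end

section \<open>Representations by branching systems\<close>

locale letter_action = module scale
  for scale :: "'k::field \<Rightarrow> 'm::ab_group_add \<Rightarrow> 'm" (infixr "*s" 75) +
  fixes letter_op :: "('v,'e) lpa_gen \<Rightarrow> 'm \<Rightarrow> 'm"
  assumes op_add: "letter_op g (m + n) = letter_op g m + letter_op g n"
    and op_scale: "letter_op g (c *s m) = c *s letter_op g m"
begin

definition act :: "('v,'e,'k) free_lpa \<Rightarrow> 'm \<Rightarrow> 'm" where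
  "act a m = (\<Sum>w\<in>Poly_Mapping.keys a. Poly_Mapping.lookup a w *s foldr letter_op (letters w) m)"

lemma foldr_op_add: "foldr letter_op xs (m + n) = foldr letter_op xs m + foldr letter_op xs n"
  by (induction xs) (simp_all add: op_add)

lemma foldr_op_scale: "foldr letter_op xs (c *s m) = c *s foldr letter_op xs m"
  by (induction xs) (simp_all add: op_scale)

lemma act_zero [simp]: "act 0 m = 0"
  by (simp add: act_def)

lemma act_add: "act (a + b) m = act a m + act b m"
  unfolding act_def by (rule setsum_keys_plus_distrib) (simp_all add: scale_left_distrib)

lemma act_single: "act (Poly_Mapping.single w c) m = c *s foldr letter_op (letters w) m"
  by (simp add: act_def)

lemma act_gen: "act (gen g) m = letter_op g m"
  by (simp add: gen_def act_single)

lemma act_add_right: "act a (m + n) = act a m + act a n"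
  by (simp add: act_def foldr_op_add scale_right_distrib sum.distrib)

lemma act_zero_right [simp]: "act a 0 = 0"
  using act_add_right[of a 0 0] by simp

lemma act_uminus: "act (- a) m = - act a m"
  using act_add[of a "- a" m] by (simp add: eq_neg_iff_add_eq_0 add.commute)

lemma act_diff: "act (a - b) m = act a m - act b m"
  using act_add[of a "- b" m] by (simp add: act_uminus)

lemma act_sum: "act (sum f A) m = (\<Sum>i\<in>A. act (f i) m)"
  by (induction A rule: infinite_finite_induct) (simp_all add: act_add)

lemma act_mult: "act (a * b) m = act a (act b m)"
proof (induction a rule: poly_mapping_additive_induct)
  case (single w c)
  show ?case
    by (induction b rule: poly_mapping_additive_induct)
      (simp_all add: distrib_left act_add act_add_right mult_single act_single foldr_op_scale)
qed (simp_all add: distrib_right act_add)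

definition annihilator :: "('v,'e,'k) free_lpa set" where
  "annihilator = {a. \<forall>m. act a m = 0}"

lemma lpa_ideal_annihilator:
  assumes "wf_digraph E"
    and "\<And>r m. r \<in> lpa_relators E \<Longrightarrow> act r m = 0"
    and "\<And>g m. g \<notin> gens E \<Longrightarrow> letter_op g m = 0"
  shows "lpa_ideal E annihilator"
  using assms
  by (auto simp: lpa_ideal_def lpa_ideal_axioms_def annihilator_def act_add act_mult act_gen)

end

definition scale2 :: "'k::field \<Rightarrow> 'k \<times> 'k \<Rightarrow> 'k \<times> 'k" where
  "scale2 c p = (c * fst p, c * snd p)"

lemma scale2_zero: "scale2 c 0 = 0"
  by (simp add: scale2_def zero_prod_def)

text \<open>
  A branching system: \<open>D v\<close> is the set of points at \<open>v\<close>, and the edge \<open>e\<close> maps \<open>D (head E e)\<close>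
  injectively into \<open>D (tail E e)\<close>. The algebra acts on functions on the points with values in a
  plane; \<open>A e\<close> twists the action of \<open>e\<close> by an automorphism of that plane with inverse \<open>B e\<close>.
\<close>

locale branching_system = wf_digraph E
  for E :: "('v,'e) pre_digraph" +
  fixes D :: "'v \<Rightarrow> 'x set" and f :: "'e \<Rightarrow> 'x \<Rightarrow> 'x"
    and A B :: "'e \<Rightarrow> 'k::field \<times> 'k \<Rightarrow> 'k \<times> 'k"
  assumes disjoint: "x \<in> D v \<Longrightarrow> x \<in> D w \<Longrightarrow> v = w"
    and f_mem: "e \<in> arcs E \<Longrightarrow> x \<in> D (head E e) \<Longrightarrow> f e x \<in> D (tail E e)"
    and f_inj: "e \<in> arcs E \<Longrightarrow> e' \<in> arcs E \<Longrightarrow> x \<in> D (head E e) \<Longrightarrow> x' \<in> D (head E e') \<Longrightarrow>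
       f e x = f e' x' \<Longrightarrow> e = e' \<and> x = x'"
    and covers: "regular_vertex E v \<Longrightarrow> x \<in> D v \<Longrightarrow> \<exists>e\<in>out_arcs E v. x \<in> f e ` D (head E e)"
    and A_add: "A e (p + q) = A e p + A e q" and B_add: "B e (p + q) = B e p + B e q"
    and A_scale: "A e (scale2 c p) = scale2 c (A e p)" and B_scale: "B e (scale2 c p) = scale2 c (B e p)"
    and A_B: "A e (B e p) = p" and B_A: "B e (A e p) = p"
begin

definition pull :: "'e \<Rightarrow> 'x \<Rightarrow> 'x" where
  "pull e = inv_into (D (head E e)) (f e)"

lemma pull_f: "e \<in> arcs E \<Longrightarrow> x \<in> D (head E e) \<Longrightarrow> pull e (f e x) = x"
  unfolding pull_def by (rule inv_into_f_f) (use f_inj in \<open>blast intro: inj_onI\<close>)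

primrec branch_op :: "('v,'e) lpa_gen \<Rightarrow> ('x \<Rightarrow> 'k \<times> 'k) \<Rightarrow> 'x \<Rightarrow> 'k \<times> 'k" where
  "branch_op (Vert v) \<phi> = (\<lambda>x. if v \<in> verts E \<and> x \<in> D v then \<phi> x else 0)"
| "branch_op (Edge e) \<phi> = (\<lambda>x. if e \<in> arcs E \<and> x \<in> f e ` D (head E e) then A e (\<phi> (pull e x)) else 0)"
| "branch_op (Ghost e) \<phi> = (\<lambda>x. if e \<in> arcs E \<and> x \<in> D (head E e) then B e (\<phi> (f e x)) else 0)"

definition fscale :: "'k \<Rightarrow> ('x \<Rightarrow> 'k \<times> 'k) \<Rightarrow> 'x \<Rightarrow> 'k \<times> 'k" where
  "fscale c \<phi> = (\<lambda>x. scale2 c (\<phi> x))"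

sublocale letter_action fscale branch_op
proof
  fix g :: "('v,'e) lpa_gen" and m n :: "'x \<Rightarrow> 'k \<times> 'k" and c
  show "branch_op g (m + n) = branch_op g m + branch_op g n"
    by (cases g) (auto simp: fun_eq_iff A_add B_add)
  show "branch_op g (fscale c m) = fscale c (branch_op g m)"
    by (cases g) (auto simp: fun_eq_iff fscale_def A_scale B_scale scale2_zero)
qed (auto simp: fscale_def scale2_def fun_eq_iff algebra_simps)

lemma A_zero [simp]: "A e 0 = 0" and B_zero [simp]: "B e 0 = 0"
  using A_add[of e 0 0] B_add[of e 0 0] by simp_all

lemma Ed_Gh_apply:
  "branch_op (Edge e) (branch_op (Ghost e) \<phi>) x = (if e \<in> arcs E \<and> x \<in> f e ` D (head E e) then \<phi> x else 0)"
  by (auto simp: pull_f A_B)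

lemma sum_apply: "(\<Sum>i\<in>S. g i) x = (\<Sum>i\<in>S. (g i :: 'x \<Rightarrow> 'k \<times> 'k) x)"
  by (induction S rule: infinite_finite_induct) auto

text \<open>e e^* acts as multiplication by the indicator of the image of \<open>f e\<close>. These
  images are disjoint, so the sum is the indicator of their union, and the difference retains the
  points at v that come from no edge of \<open>F\<close>. For regular v and all its edges there are
  none, by \<open>covers\<close>.\<close>

lemma act_vertex_minus_edges:
  assumes "v \<in> verts E" "finite F" "F \<subseteq> out_arcs E v"
  shows "act (Vt v - (\<Sum>e\<in>F. Ed e * Gh e)) \<phi> x =
    (if x \<in> D v \<and> (\<forall>e\<in>F. x \<notin> f e ` D (head E e)) then \<phi> x else 0)"
proof -
  have eq: "act (Vt v - (\<Sum>e\<in>F. Ed e * Gh e)) \<phi> x =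
      (if x \<in> D v then \<phi> x else 0) - (\<Sum>e\<in>F. if x \<in> f e ` D (head E e) then \<phi> x else 0)"
    using assms by (simp add: act_diff act_sum act_mult act_gen sum_apply Ed_Gh_apply del: branch_op.simps(2,3))
      (auto intro!: sum.cong)
  show ?thesis
  proof (cases "\<exists>e\<in>F. x \<in> f e ` D (head E e)")
    case True
    then obtain e where e: "e \<in> F" "x \<in> f e ` D (head E e)" by blast
    then have x: "x \<in> D v" using assms f_mem by fastforce
    have "x \<notin> f e' ` D (head E e')" if "e' \<in> F" "e' \<noteq> e" for e'
      using that e assms f_inj[of e e'] by (auto simp: subset_iff)
    then have "(\<Sum>e\<in>F. if x \<in> f e ` D (head E e) then \<phi> x else 0) = (\<Sum>e'\<in>F. if e' = e then \<phi> x else 0)"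
      using e by (intro sum.cong) auto
    then show ?thesis using eq e x assms by auto
  next
    case False
    then show ?thesis using eq by auto
  qed
qed

lemma act_vertex: "act (Vt v) \<phi> x = (if v \<in> verts E \<and> x \<in> D v then \<phi> x else 0)"
  by (simp add: act_gen)

lemma lpa_ideal_annihilator: "lpa_ideal E annihilator"
proof (rule lpa_ideal_annihilator)
  show "wf_digraph E" by (rule wf_digraph_axioms)
next
  fix g :: "('v,'e) lpa_gen" and m :: "'x \<Rightarrow> 'k \<times> 'k"
  assume "g \<notin> gens E"
  then show "branch_op g m = 0" by (cases g) (auto simp: gens_def fun_eq_iff)
next
  fix r :: "('v,'e,'k) free_lpa" and m :: "'x \<Rightarrow> 'k \<times> 'k"
  assume r: "r \<in> lpa_relators E"
  have tail: "tail E e \<in> verts E" and head: "head E e \<in> verts E" if "e \<in> arcs E" for e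
    using that wellformed by auto
  have pull_mem: "pull e x \<in> D (head E e)" if "x \<in> f e ` D (head E e)" for e x
    using that unfolding pull_def by (rule inv_into_into)
  from r show "act r m = 0"
    unfolding lpa_relators_def
  proof (elim UnE CollectE exE conjE)
    fix v assume "r = Vt v * Vt v - Vt v" "v \<in> verts E"
    then show ?thesis by (auto simp: fun_eq_iff act_diff act_mult act_gen)
  next
    fix v w assume "r = Vt v * Vt w" "v \<noteq> w"
    then show ?thesis using disjoint by (auto simp: fun_eq_iff act_mult act_gen)
  next
    fix e assume "r = Vt (tail E e) * Ed e - Ed e" "e \<in> arcs E"
    then show ?thesis using f_mem tail by (auto simp: fun_eq_iff act_diff act_mult act_gen)
  next
    fix e assume "r = Ed e * Vt (head E e) - Ed e" "e \<in> arcs E"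
    then show ?thesis using pull_mem head by (auto simp: fun_eq_iff act_diff act_mult act_gen)
  next
    fix e assume "r = Vt (head E e) * Gh e - Gh e" "e \<in> arcs E"
    then show ?thesis using head by (auto simp: fun_eq_iff act_diff act_mult act_gen)
  next
    fix e assume "r = Gh e * Vt (tail E e) - Gh e" "e \<in> arcs E"
    then show ?thesis using f_mem tail by (auto simp: fun_eq_iff act_diff act_mult act_gen)
  next
    fix e assume "r = Gh e * Ed e - Vt (head E e)" "e \<in> arcs E"
    then show ?thesis using head pull_f by (auto simp: fun_eq_iff act_diff act_mult act_gen B_A)
  next
    fix e e' assume "r = Gh e * Ed e'" "e \<in> arcs E" "e' \<in> arcs E" "e \<noteq> e'"
    then show ?thesis using f_inj by (auto simp: fun_eq_iff act_mult act_gen)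
  next
    fix v assume r: "r = Vt v - (\<Sum>e\<in>out_arcs E v. Ed e * Gh e)" and v: "regular_vertex E v"
    show ?thesis
    proof
      fix x
      show "act r m x = 0 x"
        using act_vertex_minus_edges[of v "out_arcs E v" m x] v covers[OF v]
        by (auto simp: r regular_vertex_def)
    qed
  qed
qed

end

section \<open>Ideals separating admissible pairs\<close>

text \<open>
  A vertex outside \<open>H\<close> is forced if paths reaching it have to be continued in \<open>E \ H\<close>. Choosing
  one continuing edge \<open>c v\<close> at every forced vertex, a point is a path that does not end with a
  chosen edge: it stands for the path prolonged indefinitely by chosen edges.
\<close>

lemma admissible_pair_separating_ideal:
  fixes E :: "('v,'e) pre_digraph"
  assumes E: "wf_digraph E" and P: "admissible_pair E (H, S)"
  obtains I :: "('v,'e,'k::field) free_lpa set" where "lpa_ideal E I"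
    "\<And>v. v \<in> verts E \<Longrightarrow> Vt v \<in> I \<longleftrightarrow> v \<in> H"
    "\<And>v. v \<in> breaking_vertices E H \<Longrightarrow> breaking_element E H v \<in> I \<longleftrightarrow> v \<in> S"
proof -
  interpret wf_digraph E by fact
  have H: "H \<subseteq> verts E" and her: "\<And>u p v. u \<in> H \<Longrightarrow> awalk u p v \<Longrightarrow> v \<in> H"
    and sat: "saturated E H" and S: "S \<subseteq> breaking_vertices E H"
    using P by (auto simp: admissible_pair_def hereditary_def)
  define out where "out v = {e \<in> out_arcs E v. head E e \<in> verts E - H}" for v
  \<comment> \<open>The breaking vertices in \<open>S\<close> are forced so that v^H acts as 0
    there; the others keep a point that comes through no edge of \<open>out v\<close>, and v^H does
    not vanish on it.\<close>
  define forced where "forced v \<longleftrightarrow> v \<in> verts E - H \<and> (regular_vertex E v \<or> v \<in> S)" for v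
  have forced: "finite (out v) \<and> out v \<noteq> {}" if "forced v" for v
  proof (cases "v \<in> S")
    case True
    then show ?thesis using S by (auto simp: breaking_vertices_def out_def)
  next
    case False
    with that have r: "regular_vertex E v" "v \<notin> H" by (auto simp: forced_def)
    with sat obtain e where "e \<in> out_arcs E v" "head E e \<notin> H" unfolding saturated_def by blast
    then have "e \<in> out v" by (auto simp: out_def)
    moreover have "finite (out v)"
      by (rule finite_subset[of _ "out_arcs E v"]) (use r(1) in \<open>auto simp: out_def regular_vertex_def\<close>)
    ultimately show ?thesis by blast
  qed
  define c where "c v = (SOME e. e \<in> out v)" for v
  have c: "c v \<in> out v" if "forced v" for v
    unfolding c_def using forced[OF that] by (simp add: some_in_eq)
  define chosen where "chosen e \<longleftrightarrow> forced (tail E e) \<and> e = c (tail E e)" for e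
  \<comment> \<open>The second component is the end of the path, which the empty list cannot
    record.\<close>
  define D where "D v = {(p, u). u \<in> verts E - H \<and> awalk v p u \<and> (p \<noteq> [] \<longrightarrow> \<not> chosen (last p))}" for v
  \<comment> \<open>A chosen edge in front of an empty path gives the empty path at the tail: both
    stand for the same prolonged path, and each prolonged path must have only one name.\<close>
  define f where "f e x = (if fst x = [] \<and> chosen e then ([], tail E e) else (e # fst x, snd x))"
    for e and x :: "'e list \<times> 'v"
  define idt where "idt = (\<lambda>(e::'e) (q::'k \<times> 'k). q)"
  have D_notin_H: "v \<notin> H" if "x \<in> D v" for x v
    using that her by (auto simp: D_def)
  have head_out: "e \<in> out v" if "e \<in> out_arcs E v" "x \<in> D (head E e)" for e v x
    using that D_notin_H by (auto simp: out_def)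
  \<comment> \<open>Only the empty path at an unforced vertex is exempt; it is the point that
    separates breaking vertices outside \<open>S\<close> from those in \<open>S\<close>.\<close>
  have step: "\<exists>e\<in>out v. x \<in> f e ` D (head E e)"
    if x: "x \<in> D v" and nz: "fst x \<noteq> [] \<or> forced v" for x v
  proof (cases "fst x")
    case Nil
    with nz have v: "forced v" by simp
    have xv: "x = ([], v)" using x Nil by (auto simp: D_def awalk_Nil_iff)
    have "chosen (c v)" "tail E (c v) = v" using c[OF v] v by (auto simp: chosen_def out_def)
    moreover have "([], head E (c v)) \<in> D (head E (c v))"
      using c[OF v] by (auto simp: D_def out_def awalk_Nil_iff)
    ultimately show ?thesis using c[OF v] xv by (force simp: f_def)
  next
    case (Cons e q)
    then obtain u where u: "x = (e # q, u)" by (cases x) auto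
    with x have e: "e \<in> out_arcs E v" "(q, u) \<in> D (head E e)"
      by (auto simp: D_def awalk_Cons_iff)
    have "\<not> (q = [] \<and> chosen e)" using x u by (auto simp: D_def)
    then have "x = f e (q, u)" by (auto simp: f_def u)
    with e head_out show ?thesis by blast
  qed
  interpret branching_system E D f idt idt
  proof
    fix x v w assume "x \<in> D v" "x \<in> D w"
    then show "v = w" by (cases "fst x") (auto simp: D_def awalk_Nil_iff awalk_Cons_iff)
  next
    fix e x assume "e \<in> arcs E" "x \<in> D (head E e)"
    then show "f e x \<in> D (tail E e)"
      by (auto simp: f_def D_def awalk_Cons_iff awalk_Nil_iff chosen_def forced_def)
  next
    fix e e' x x' assume "e \<in> arcs E" "e' \<in> arcs E" "x \<in> D (head E e)" "x' \<in> D (head E e')" "f e x = f e' x'"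
    then show "e = e' \<and> x = x'"
      by (cases x; cases x') (auto simp: f_def D_def chosen_def awalk_Nil_iff split: if_splits)
  next
    fix v x assume v: "regular_vertex E v" "x \<in> D v"
    then have "forced v" using D_notin_H by (auto simp: forced_def regular_vertex_def)
    then show "\<exists>e\<in>out_arcs E v. x \<in> f e ` D (head E e)"
      using step[OF v(2)] by (auto simp: out_def)
  qed (simp_all add: idt_def)
  have nil: "([], v) \<in> D v" if "v \<in> verts E - H" for v
    using that by (auto simp: D_def awalk_Nil_iff)
  show ?thesis
  proof (rule that)
    show "lpa_ideal E annihilator" by (rule lpa_ideal_annihilator)
  next
    fix v assume v: "v \<in> verts E"
    show "Vt v \<in> annihilator \<longleftrightarrow> v \<in> H"
    proof
      assume "v \<in> H"
      then have "D v = {}" using D_notin_H by blast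
      then show "Vt v \<in> annihilator" by (auto simp: annihilator_def fun_eq_iff act_vertex)
    next
      assume "Vt v \<in> annihilator"
      then have "act (Vt v) (\<lambda>_. (1, 0)) ([], v) = 0" by (simp add: annihilator_def)
      then show "v \<in> H" using nil[of v] v by (auto simp: act_vertex zero_prod_def split: if_splits)
    qed
  next
    fix v assume v: "v \<in> breaking_vertices E H"
    then have v': "v \<in> verts E - H" "finite (out v)" "out v \<subseteq> out_arcs E v" "\<not> regular_vertex E v"
      by (auto simp: breaking_vertices_def out_def infinite_emitter_def regular_vertex_def)
    have act: "act (breaking_element E H v) \<phi> x =
        (if x \<in> D v \<and> (\<forall>e\<in>out v. x \<notin> f e ` D (head E e)) then \<phi> x else 0)" for \<phi> x
      using act_vertex_minus_edges[of v "out v" \<phi> x] v' unfolding breaking_element_def out_def by simp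
    show "breaking_element E H v \<in> annihilator \<longleftrightarrow> v \<in> S"
    proof
      assume "v \<in> S"
      then have "forced v" using v' by (simp add: forced_def)
      then show "breaking_element E H v \<in> annihilator"
        using step[of _ v] by (auto simp: annihilator_def fun_eq_iff act)
    next
      assume "breaking_element E H v \<in> annihilator"
      then have "act (breaking_element E H v) (\<lambda>_. (1, 0)) ([], v) = 0" by (simp add: annihilator_def)
      then obtain e y where "e \<in> out v" "([], v) = f e y"
        using nil[OF v'(1)] by (auto simp: act zero_prod_def split: if_splits)
      then have "forced v" by (auto simp: f_def chosen_def split: if_splits)
      then show "v \<in> S" using v' by (simp add: forced_def)
    qed
  qed
qed

text \<open>
  If \<open>c\<close> is the only simple closed path at \<open>v\<close>, the points are the paths that reach \<open>v\<close> for the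
  first time at their end, and \<open>c\<close> acts on the single point at \<open>v\<close> by an automorphism \<open>\<alpha>\<close> of the
  plane.
\<close>

lemma unique_simple_closed_path_ideal:
  fixes E :: "('v,'e) pre_digraph" and \<alpha> \<beta> :: "'k::field \<times> 'k \<Rightarrow> 'k \<times> 'k"
  assumes E: "wf_digraph E" and c: "simple_closed_path E v c"
    and uniq: "\<And>c'. simple_closed_path E v c' \<Longrightarrow> c' = c"
    and lin: "\<And>p q. \<alpha> (p + q) = \<alpha> p + \<alpha> q" "\<And>p q. \<beta> (p + q) = \<beta> p + \<beta> q"
      "\<And>k p. \<alpha> (scale2 k p) = scale2 k (\<alpha> p)" "\<And>k p. \<beta> (scale2 k p) = scale2 k (\<beta> p)"
    and inv: "\<And>p. \<alpha> (\<beta> p) = p" "\<And>p. \<beta> (\<alpha> p) = p"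
  obtains I :: "('v,'e,'k) free_lpa set" where "lpa_ideal E I"
    "Vt v - epath c * Vt v \<in> I \<longleftrightarrow> (\<forall>p. p - \<alpha> p = 0)"
    "Vt v - epath c * Vt v + (epath c * Vt v) * (epath c * Vt v) \<in> I \<longleftrightarrow>
      (\<forall>p. p - \<alpha> p + \<alpha> (\<alpha> p) = 0)"
proof -
  interpret wf_digraph E by fact
  define D where "D u = {p. awalk u p v \<and> (\<forall>e\<in>set p. tail E e \<noteq> v)}" for u
  \<comment> \<open>An edge leaving v, followed by a path that returns to v, closes a cycle; the
    result is collapsed to the single point at v.\<close>
  define f where "f e p = (if tail E e = v then [] else e # p)" for e p
  \<comment> \<open>Only edges leaving v are twisted. \<open>c\<close> has exactly one of them, its
    first, so one turn around \<open>c\<close> applies \<alpha> once.\<close>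
  define A where "A e = (if tail E e = v then \<alpha> else (\<lambda>p. p))" for e
  define B where "B e = (if tail E e = v then \<beta> else (\<lambda>p. p))" for e
  \<comment> \<open>Uniqueness of \<open>c\<close> enters here: the only edge leaving v whose head
    carries a point is the first edge of \<open>c\<close>, and the point is the rest of
    \<open>c\<close>. Hence the collapse at v keeps \<open>f\<close> injective.\<close>
  have scp: "e # p = c" if "e \<in> arcs E" "tail E e = v" "p \<in> D (head E e)" for e p
    using that by (intro uniq) (auto simp: D_def simple_closed_path_def awalk_Cons_iff)
  obtain e0 p0 where c_eq: "c = e0 # p0" using c by (cases c) (auto simp: simple_closed_path_def)
  have e0: "e0 \<in> arcs E" "tail E e0 = v" "p0 \<in> D (head E e0)"
    using c by (auto simp: simple_closed_path_def c_eq D_def awalk_Cons_iff)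
  have v: "v \<in> verts E" using e0 by auto
  have Dv: "D v = {[]}"
  proof
    show "D v \<subseteq> {[]}"
    proof
      fix p assume "p \<in> D v"
      then show "p \<in> {[]}" by (cases p) (auto simp: D_def awalk_Cons_iff)
    qed
    show "{[]} \<subseteq> D v" using v by (auto simp: D_def awalk_Nil_iff)
  qed
  interpret branching_system E D f A B
  proof
    fix x u w assume "x \<in> D u" "x \<in> D w"
    then show "u = w" by (cases x) (auto simp: D_def awalk_Nil_iff awalk_Cons_iff)
  next
    fix e x assume ex: "e \<in> arcs E" "x \<in> D (head E e)"
    show "f e x \<in> D (tail E e)"
    proof (cases "tail E e = v")
      case True
      then show ?thesis by (simp add: f_def Dv)
    next
      case False
      then show ?thesis using ex by (simp add: f_def D_def awalk_Cons_iff)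
    qed
  next
    fix e e' x x' assume "e \<in> arcs E" "e' \<in> arcs E" "x \<in> D (head E e)" "x' \<in> D (head E e')" "f e x = f e' x'"
    then show "e = e' \<and> x = x'"
      using scp[of e x] scp[of e' x'] by (auto simp: f_def split: if_splits)
  next
    fix u x assume u: "regular_vertex E u" "x \<in> D u"
    show "\<exists>e\<in>out_arcs E u. x \<in> f e ` D (head E e)"
    proof (cases x)
      case Nil
      then have "u = v" using u by (auto simp: D_def awalk_Nil_iff)
      moreover have "[] \<in> f e0 ` D (head E e0)" using e0 by (auto simp: f_def)
      ultimately show ?thesis using e0 Nil by auto
    next
      case (Cons e q)
      with u have "e \<in> out_arcs E u" "q \<in> D (head E e)" "x = f e q"
        by (auto simp: D_def awalk_Cons_iff f_def)
      then show ?thesis by blast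
    qed
  qed (auto simp: A_def B_def lin inv)
  have first_hit: "act (epath p * Vt v) \<phi> = (\<lambda>x. if x = p then \<phi> [] else 0)" if "p \<in> D u" for p u \<phi>
    using that
  proof (induction p arbitrary: u)
    case Nil
    then show ?case using v Dv by (auto simp: act_vertex fun_eq_iff)
  next
    case (Cons e p)
    then have e: "e \<in> arcs E" "tail E e \<noteq> v" "p \<in> D (head E e)"
      by (auto simp: D_def awalk_Cons_iff)
    have A_e: "A e q = q" for q using e by (simp add: A_def)
    show ?case
    proof
      fix x
      have "x = e # p" if "x = f e y" "pull e x = p" "y \<in> D (head E e)" for y
        using that e pull_f[of e y] by (simp add: f_def)
      moreover have "pull e (e # p) = p" using pull_f[of e p] e by (simp add: f_def)
      moreover have "e # p \<in> f e ` D (head E e)" using e by (auto simp: f_def)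
      ultimately show "act (epath (e # p) * Vt v) \<phi> x = (if x = e # p then \<phi> [] else 0)"
        using e Cons.IH[OF e(3)] A_e
        by (auto simp: epath_Cons mult.assoc act_mult[of "Ed e"] act_gen)
    qed
  qed
  have cyc: "act (epath c * Vt v) \<phi> = (\<lambda>x. if x = [] then \<alpha> (\<phi> []) else 0)" for \<phi>
  proof
    fix x
    have img: "f e0 ` D (head E e0) = {[]}" using e0 by (auto simp: f_def)
    have "A e0 q = \<alpha> q" for q using e0 by (simp add: A_def)
    moreover have "pull e0 [] = p0" using pull_f[of e0 p0] e0 by (simp add: f_def)
    ultimately show "act (epath c * Vt v) \<phi> x = (if x = [] then \<alpha> (\<phi> []) else 0)"
      using e0 first_hit[OF e0(3)] by (auto simp: c_eq epath_Cons mult.assoc act_mult[of "Ed e0"] act_gen img)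
  qed
  have \<alpha>0: "\<alpha> 0 = 0" using lin(1)[of 0 0] by simp
  have V: "act (Vt v) \<phi> = (\<lambda>x. if x = [] then \<phi> [] else 0)" for \<phi>
    using v Dv by (auto simp: act_vertex fun_eq_iff)
  have ext: "(\<forall>\<phi>. (\<lambda>x. if x = [] then g (\<phi> []) else 0) = (0 :: 'e list \<Rightarrow> 'k \<times> 'k)) \<longleftrightarrow> (\<forall>p. g p = 0)" for g
    by (auto simp: fun_eq_iff)
  show ?thesis
  proof (rule that)
    show "lpa_ideal E annihilator" by (rule lpa_ideal_annihilator)
  next
    have "act (Vt v - epath c * Vt v) \<phi> = (\<lambda>x. if x = [] then \<phi> [] - \<alpha> (\<phi> []) else 0)" for \<phi>
      by (auto simp: act_diff V cyc fun_eq_iff)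
    then show "Vt v - epath c * Vt v \<in> annihilator \<longleftrightarrow> (\<forall>p. p - \<alpha> p = 0)"
      unfolding annihilator_def using ext[of "\<lambda>p. p - \<alpha> p"] by simp
  next
    have "act (Vt v - epath c * Vt v + (epath c * Vt v) * (epath c * Vt v)) \<phi> =
        (\<lambda>x. if x = [] then \<phi> [] - \<alpha> (\<phi> []) + \<alpha> (\<alpha> (\<phi> [])) else 0)" for \<phi>
      by (auto simp: act_diff act_add act_mult[of "epath c * Vt v"] V cyc fun_eq_iff)
    then show "Vt v - epath c * Vt v + (epath c * Vt v) * (epath c * Vt v) \<in> annihilator \<longleftrightarrow>
        (\<forall>p. p - \<alpha> p + \<alpha> (\<alpha> p) = 0)"
      unfolding annihilator_def using ext[of "\<lambda>p. p - \<alpha> p + \<alpha> (\<alpha> p)"] by simp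
  qed
qed

text \<open>
  The automorphisms \<open>1\<close> and the companion matrix of \<open>1 - x + x\<^sup>2\<close> separate the polynomials \<open>1 - x\<close>
  and \<open>1 - x + x\<^sup>2\<close>, which are coprime and nonunits over every field.
\<close>

lemma condition_K_of_chain:
  fixes E :: "('v,'e) pre_digraph"
  assumes E: "wf_digraph E"
    and chain: "\<And>I J :: ('v,'e,'k::field) free_lpa set. lpa_ideal E I \<Longrightarrow> lpa_ideal E J \<Longrightarrow>
      (\<forall>a\<in>I. Poly_Mapping.lookup a 0 = 0 \<longrightarrow> a \<in> J) \<or> (\<forall>a\<in>J. Poly_Mapping.lookup a 0 = 0 \<longrightarrow> a \<in> I)"
  shows "condition_K E"
proof (rule ccontr)
  assume "\<not> condition_K E"
  then obtain v c where c: "simple_closed_path E v c" and uniq: "\<And>c'. simple_closed_path E v c' \<Longrightarrow> c' = c"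
    unfolding condition_K_def by blast
  \<comment> \<open>In the basis 1, x of K[x]/(1 - x + x^2), \<alpha> is multiplication by x and
    \<beta> is multiplication by its inverse 1 - x.\<close>
  define \<alpha> :: "'k \<times> 'k \<Rightarrow> 'k \<times> 'k" where "\<alpha> p = (- snd p, fst p + snd p)" for p
  define \<beta> :: "'k \<times> 'k \<Rightarrow> 'k \<times> 'k" where "\<beta> p = (fst p + snd p, - fst p)" for p
  let ?p = "Vt v - epath c * Vt v :: ('v,'e,'k) free_lpa"
  let ?q = "Vt v - epath c * Vt v + (epath c * Vt v) * (epath c * Vt v) :: ('v,'e,'k) free_lpa"
  obtain I :: "('v,'e,'k) free_lpa set" where I: "lpa_ideal E I" "?p \<in> I" "?q \<notin> I"
  proof (rule unique_simple_closed_path_ideal[OF E c uniq, of "\<lambda>p. p" "\<lambda>p. p"])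
    fix I :: "('v,'e,'k) free_lpa set"
    assume "lpa_ideal E I" "?p \<in> I \<longleftrightarrow> (\<forall>p::'k \<times> 'k. p - p = 0)"
      "?q \<in> I \<longleftrightarrow> (\<forall>p::'k \<times> 'k. p - p + p = 0)"
    moreover have "\<exists>p::'k \<times> 'k. p - p + p \<noteq> 0" by (rule exI[of _ "(1, 0)"]) (simp add: zero_prod_def)
    ultimately show thesis using that by simp
  qed auto
  obtain J :: "('v,'e,'k) free_lpa set" where J: "lpa_ideal E J" "?p \<notin> J" "?q \<in> J"
  proof (rule unique_simple_closed_path_ideal[OF E c uniq, of \<alpha> \<beta>])
    fix I :: "('v,'e,'k) free_lpa set"
    assume *: "lpa_ideal E I" "?p \<in> I \<longleftrightarrow> (\<forall>p. p - \<alpha> p = 0)" "?q \<in> I \<longleftrightarrow> (\<forall>p. p - \<alpha> p + \<alpha> (\<alpha> p) = 0)"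
    have "(1, 0) - \<alpha> (1, 0) \<noteq> 0" by (simp add: \<alpha>_def zero_prod_def)
    moreover have "p - \<alpha> p + \<alpha> (\<alpha> p) = 0" for p
      by (cases p) (simp add: \<alpha>_def zero_prod_def)
    ultimately show thesis using that * by blast
  qed (auto simp: \<alpha>_def \<beta>_def scale2_def algebra_simps prod_eq_iff)
  have "Poly_Mapping.lookup (Vt v :: ('v,'e,'k) free_lpa) 0 = 0"
    by (simp add: gen_def lookup_single zero_lpa_word_def)
  moreover have "Poly_Mapping.lookup (epath p * Vt v :: ('v,'e,'k) free_lpa) 0 = 0" for p
    by (simp add: gen_def epath_def mult_single lookup_single zero_lpa_word_def Word_plus)
  moreover have "(epath c * Vt v) * (epath c * Vt v) =
      Poly_Mapping.single (Word (map Edge c @ [Vert v] @ map Edge c @ [Vert v])) (1::'k)"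
    by (simp add: gen_def epath_def mult_single Word_plus)
  ultimately have "Poly_Mapping.lookup ?p 0 = 0" "Poly_Mapping.lookup ?q 0 = 0"
    by (simp_all add: lookup_minus lookup_add lookup_single zero_lpa_word_def)
  then show False using chain[OF I(1) J(1)] I J by blast
qed

section \<open>Ideals of the quotient\<close>

lemma two_sided_ideal_iff:
  assumes "abelian_group R"
  shows "two_sided_ideal R I \<longleftrightarrow> I \<subseteq> carrier R \<and> \<zero>\<^bsub>R\<^esub> \<in> I \<and> (\<forall>a\<in>I. \<forall>b\<in>I. a \<oplus>\<^bsub>R\<^esub> b \<in> I) \<and>
    (\<forall>a\<in>I. \<ominus>\<^bsub>R\<^esub> a \<in> I) \<and> (\<forall>a\<in>I. \<forall>x\<in>carrier R. x \<otimes>\<^bsub>R\<^esub> a \<in> I \<and> a \<otimes>\<^bsub>R\<^esub> x \<in> I)"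
  by (auto simp: two_sided_ideal_def additive_subgroup_def subgroup_def a_inv_def)

lemma two_sided_ideal_Int:
  assumes "abelian_group R" "two_sided_ideal R I" "two_sided_ideal R J"
  shows "two_sided_ideal R (I \<inter> J)"
  using assms by (auto simp: two_sided_ideal_iff)

lemma lookup_mult_zero:
  fixes a b :: "('v,'e,'k::field) free_lpa"
  assumes "Poly_Mapping.lookup a 0 = 0 \<or> Poly_Mapping.lookup b 0 = 0"
  shows "Poly_Mapping.lookup (a * b) 0 = 0"
proof (rule ccontr)
  assume "Poly_Mapping.lookup (a * b) 0 \<noteq> 0"
  then have "0 \<in> Poly_Mapping.keys (a * b)" by (simp add: in_keys_iff)
  then obtain u w where uw: "u \<in> Poly_Mapping.keys a" "w \<in> Poly_Mapping.keys b" "0 = u + w"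
    using keys_mult[of a b] by blast
  then have "u = 0" "w = 0" by (cases u; cases w; simp add: plus_lpa_word_def zero_lpa_word_def)+
  then show False using uw assms by (simp add: in_keys_iff)
qed

text \<open>The retraction onto the free algebra on the letters of the graph: it sends foreign
  letters to 0 and is a ring homomorphism.\<close>

definition restrict_letters :: "('v,'e) pre_digraph \<Rightarrow> ('v,'e,'k::field) free_lpa \<Rightarrow> ('v,'e,'k) free_lpa" where
  "restrict_letters E a =
     (\<Sum>w\<in>{w \<in> Poly_Mapping.keys a. set (letters w) \<subseteq> gens E}. Poly_Mapping.single w (Poly_Mapping.lookup a w))"

lemma lookup_restrict_letters:
  "Poly_Mapping.lookup (restrict_letters E a) w = (if set (letters w) \<subseteq> gens E then Poly_Mapping.lookup a w else 0)"
  by (auto simp: restrict_letters_def lookup_sum lookup_single when_def in_keys_iff)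

lemma restrict_letters_add: "restrict_letters E (a + b) = restrict_letters E a + restrict_letters E b"
  by (rule poly_mapping_eqI) (simp add: lookup_restrict_letters lookup_add)

lemma restrict_letters_diff: "restrict_letters E (a - b) = restrict_letters E a - restrict_letters E b"
  by (rule poly_mapping_eqI) (simp add: lookup_restrict_letters lookup_minus)

lemma restrict_letters_zero [simp]: "restrict_letters E 0 = 0"
  by (rule poly_mapping_eqI) (simp add: lookup_restrict_letters)

lemma restrict_letters_single: "restrict_letters E (Poly_Mapping.single w c) =
    (if set (letters w) \<subseteq> gens E then Poly_Mapping.single w c else 0)"
  by (rule poly_mapping_eqI) (auto simp: lookup_restrict_letters lookup_single when_def)

lemma restrict_letters_mult: "restrict_letters E (a * b) = restrict_letters E a * restrict_letters E b"
proof (induction a rule: poly_mapping_additive_induct)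
  case (single w c)
  show ?case
    by (induction b rule: poly_mapping_additive_induct)
      (auto simp: mult_single restrict_letters_single restrict_letters_add distrib_left)
qed (simp_all add: restrict_letters_add distrib_right)

lemma mem_free_alg_iff:
  "a \<in> carrier (free_alg E) \<longleftrightarrow> Poly_Mapping.lookup a 0 = 0 \<and> restrict_letters E a = a"
proof
  assume a: "a \<in> carrier (free_alg E)"
  then have "0 \<notin> Poly_Mapping.keys a" by (auto simp: free_alg_def)
  moreover have "restrict_letters E a = a"
    using a by (intro poly_mapping_eqI) (auto simp: lookup_restrict_letters free_alg_def in_keys_iff)
  ultimately show "Poly_Mapping.lookup a 0 = 0 \<and> restrict_letters E a = a" by (simp add: in_keys_iff)
next
  assume a: "Poly_Mapping.lookup a 0 = 0 \<and> restrict_letters E a = a"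
  have "letters w \<noteq> [] \<and> set (letters w) \<subseteq> gens E" if "w \<in> Poly_Mapping.keys a" for w
  proof
    show "letters w \<noteq> []"
      using that a by (cases w) (auto simp: in_keys_iff Word_Nil)
    have "Poly_Mapping.lookup (restrict_letters E a) w \<noteq> 0" using that a by (simp add: in_keys_iff)
    then show "set (letters w) \<subseteq> gens E" by (auto simp: lookup_restrict_letters split: if_splits)
  qed
  then show "a \<in> carrier (free_alg E)" by (simp add: free_alg_def)
qed

lemma restrict_letters_mem: "Poly_Mapping.lookup a 0 = 0 \<Longrightarrow> restrict_letters E a \<in> carrier (free_alg E)"
  unfolding mem_free_alg_iff by (auto simp: lookup_restrict_letters intro: poly_mapping_eqI)

lemma free_alg_simps [simp]:
  "a \<oplus>\<^bsub>free_alg E\<^esub> b = a + b" "a \<otimes>\<^bsub>free_alg E\<^esub> b = a * b" "\<zero>\<^bsub>free_alg E\<^esub> = 0"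
  by (simp_all add: free_alg_def)

lemma restrict_letters_scal [simp]: "restrict_letters E (scal c) = scal c"
  by (simp add: restrict_letters_single)

lemma restrict_letters_uminus: "restrict_letters E (- a) = - restrict_letters E a"
  using restrict_letters_diff[of E 0 a] by simp

lemma free_alg_zero: "0 \<in> carrier (free_alg E)"
  and free_alg_add: "a \<in> carrier (free_alg E) \<Longrightarrow> b \<in> carrier (free_alg E) \<Longrightarrow> a + b \<in> carrier (free_alg E)"
  and free_alg_uminus: "a \<in> carrier (free_alg E) \<Longrightarrow> - a \<in> carrier (free_alg E)"
  and free_alg_diff: "a \<in> carrier (free_alg E) \<Longrightarrow> b \<in> carrier (free_alg E) \<Longrightarrow> a - b \<in> carrier (free_alg E)"
  and free_alg_mult: "a \<in> carrier (free_alg E) \<Longrightarrow> b \<in> carrier (free_alg E) \<Longrightarrow> a * b \<in> carrier (free_alg E)"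
  and free_alg_scal: "a \<in> carrier (free_alg E) \<Longrightarrow> scal c * a \<in> carrier (free_alg E)"
  by (simp_all add: mem_free_alg_iff lookup_add lookup_minus restrict_letters_add restrict_letters_uminus
      restrict_letters_diff restrict_letters_mult lookup_mult_zero)

lemma free_alg_sum: "(\<And>i. i \<in> A \<Longrightarrow> f i \<in> carrier (free_alg E)) \<Longrightarrow> sum f A \<in> carrier (free_alg E)"
  by (induction A rule: infinite_finite_induct) (auto intro: free_alg_zero free_alg_add)

lemma gen_mem_free_alg: "g \<in> gens E \<Longrightarrow> gen g \<in> carrier (free_alg E)"
  by (simp add: gen_def free_alg_def)

lemma abelian_group_free_alg: "abelian_group (free_alg E)"
proof (rule abelian_groupI)
  fix a :: "('a,'b,'c) free_lpa" assume "a \<in> carrier (free_alg E)"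
  then show "\<exists>b\<in>carrier (free_alg E). b \<oplus>\<^bsub>free_alg E\<^esub> a = \<zero>\<^bsub>free_alg E\<^esub>"
    by (intro bexI[of _ "- a"]) (simp_all add: free_alg_uminus)
qed (simp_all add: free_alg_zero free_alg_add algebra_simps)

lemma a_inv_free_alg: "a \<in> carrier (free_alg E) \<Longrightarrow> \<ominus>\<^bsub>free_alg E\<^esub> a = - a"
  by (rule abelian_group.minus_equality[OF abelian_group_free_alg]) (simp_all add: free_alg_uminus)

lemma relators_free_alg:
  assumes "wf_digraph E"
  shows "lpa_relators E \<subseteq> carrier (free_alg E)"
proof -
  interpret wf_digraph E by fact
  have [simp]: "Vt v \<in> carrier (free_alg E)" if "v \<in> verts E" for v
    using that by (intro gen_mem_free_alg) (simp add: gens_def)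
  have [simp]: "Ed e \<in> carrier (free_alg E)" "Gh e \<in> carrier (free_alg E)" if "e \<in> arcs E" for e
    using that by (auto intro!: gen_mem_free_alg simp: gens_def)
  show ?thesis
    unfolding lpa_relators_def
    by (auto simp: regular_vertex_def intro!: free_alg_diff free_alg_mult free_alg_sum)
qed

definition lpa_kernel :: "('v,'e) pre_digraph \<Rightarrow> ('v,'e,'k::field) free_lpa set \<Rightarrow> bool" where
  "lpa_kernel E I \<longleftrightarrow> two_sided_ideal (free_alg E) I \<and>
    (\<forall>c. \<forall>p\<in>I. scal c * p \<in> I) \<and> lpa_relators E \<subseteq> I"

lemma lpa_kernel_iff:
  "lpa_kernel E I \<longleftrightarrow> I \<subseteq> carrier (free_alg E) \<and> 0 \<in> I \<and> (\<forall>a\<in>I. \<forall>b\<in>I. a + b \<in> I) \<and>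
    (\<forall>a\<in>I. \<forall>x\<in>carrier (free_alg E). x * a \<in> I \<and> a * x \<in> I) \<and>
    (\<forall>c. \<forall>p\<in>I. scal c * p \<in> I) \<and> lpa_relators E \<subseteq> I"
proof -
  have "- a \<in> I" if "\<forall>c. \<forall>p\<in>I. scal c * p \<in> I" "a \<in> I" for a
  proof -
    have "scal (- 1) * a = - a" by (simp add: single_uminus)
    with that show ?thesis by metis
  qed
  then show ?thesis
    unfolding lpa_kernel_def two_sided_ideal_iff[OF abelian_group_free_alg]
    by (auto simp: a_inv_free_alg subset_iff)
qed

lemma lpa_rel_ideal_eq: "lpa_rel_ideal E = \<Inter>{I. lpa_kernel E I}"
  by (simp add: lpa_rel_ideal_def lpa_kernel_def)

context wf_digraph
begin

lemma lpa_kernel_rel_ideal: "lpa_kernel G (lpa_rel_ideal G :: ('a,'b,'c::field) free_lpa set)"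
proof -
  have "lpa_kernel G (carrier (free_alg G :: ('a,'b,'c) free_lpa ring))"
    using relators_free_alg[OF wf_digraph_axioms]
    by (auto simp: lpa_kernel_iff free_alg_zero free_alg_add free_alg_mult free_alg_scal)
  then have sub: "lpa_rel_ideal G \<subseteq> carrier (free_alg G :: ('a,'b,'c) free_lpa ring)"
    unfolding lpa_rel_ideal_eq by blast
  have mem: "a \<in> lpa_rel_ideal G \<longleftrightarrow> (\<forall>I. lpa_kernel G I \<longrightarrow> a \<in> I)" for a :: "('a,'b,'c) free_lpa"
    unfolding lpa_rel_ideal_eq by blast
  show ?thesis
    unfolding lpa_kernel_iff
  proof (intro conjI ballI allI subsetI)
    fix a b :: "('a,'b,'c) free_lpa" assume "a \<in> lpa_rel_ideal G" "b \<in> lpa_rel_ideal G"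
    then show "a + b \<in> lpa_rel_ideal G" unfolding mem by (simp add: lpa_kernel_iff)
  next
    fix a x :: "('a,'b,'c) free_lpa" assume "a \<in> lpa_rel_ideal G" and x: "x \<in> carrier (free_alg G)"
    then show "x * a \<in> lpa_rel_ideal G" "a * x \<in> lpa_rel_ideal G"
      unfolding mem by (simp_all add: lpa_kernel_iff)
  next
    fix a :: "('a,'b,'c) free_lpa" and c assume "a \<in> lpa_rel_ideal G"
    then show "scal c * a \<in> lpa_rel_ideal G" unfolding mem by (simp add: lpa_kernel_iff)
  next
    fix a :: "('a,'b,'c) free_lpa" assume "a \<in> lpa_relators G"
    then show "a \<in> lpa_rel_ideal G" unfolding mem by (auto simp: lpa_kernel_iff)
  next
    show "0 \<in> (lpa_rel_ideal G :: ('a,'b,'c) free_lpa set)" unfolding mem by (simp add: lpa_kernel_iff)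
  qed (use sub in blast)
qed

text \<open>An arbitrary factor is a scalar plus an element without constant term. The scalar is
  handled by the closure under scalars, the rest by the ideal property in
  \<open>free_alg\<close>.\<close>

lemma lpa_ideal_lift:
  assumes "lpa_kernel G I"
  shows "lpa_ideal G {a. Poly_Mapping.lookup a 0 = 0 \<and> restrict_letters G a \<in> I}" (is "lpa_ideal G ?L")
proof -
  note I = assms[unfolded lpa_kernel_iff]
  have *: "x * a \<in> ?L \<and> a * x \<in> ?L" if a: "a \<in> ?L" for a x
  proof -
    define x' where "x' = x - scal (Poly_Mapping.lookup x 0)"
    have x: "x = scal (Poly_Mapping.lookup x 0) + x'" by (simp add: x'_def)
    have x': "restrict_letters G x' \<in> carrier (free_alg G)"
      by (rule restrict_letters_mem) (simp add: x'_def lookup_minus)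
    have "restrict_letters G (x * a) =
        scal (Poly_Mapping.lookup x 0) * restrict_letters G a + restrict_letters G x' * restrict_letters G a"
      by (subst x) (simp add: distrib_right restrict_letters_mult restrict_letters_add)
    moreover have "restrict_letters G (a * x) =
        scal (Poly_Mapping.lookup x 0) * restrict_letters G a + restrict_letters G a * restrict_letters G x'"
      by (subst x) (simp add: distrib_left restrict_letters_mult restrict_letters_add scal_commute)
    ultimately show ?thesis using a x' I by (simp add: lookup_mult_zero)
  qed
  have rel: "lpa_relators G \<subseteq> ?L"
    using I by (auto simp: mem_free_alg_iff subset_iff)
  have foreign: "gen g \<in> ?L" if "g \<notin> gens G" for g
    using that I by (simp add: gen_def restrict_letters_single lookup_single zero_lpa_word_def)
  show ?thesis
    by unfold_locales (use I * rel foreign in \<open>auto simp: lookup_add restrict_letters_add\<close>)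
qed

end

lemma (in lpa_ideal) foreign_word_mem:
  assumes "\<not> set (letters w) \<subseteq> gens E"
  shows "Poly_Mapping.single w c \<in> I"
proof -
  from assms obtain g where g: "g \<in> set (letters w)" "g \<notin> gens E" by blast
  from split_list[OF g(1)] obtain xs ys where "letters w = xs @ g # ys" by blast
  then have "Poly_Mapping.single w c = (Poly_Mapping.single (Word xs) c * gen g) * Poly_Mapping.single (Word ys) 1"
    by (cases w) (simp add: gen_def mult_single Word_plus)
  then show ?thesis using mult_right_mem[OF mult_left_mem[OF foreign_mem[OF g(2)]]] by metis
qed

lemma (in lpa_ideal) restrict_letters_cong: "restrict_letters E a \<approx> a"
proof (induction a rule: poly_mapping_additive_induct)
  case (add a b)
  then show ?case unfolding restrict_letters_add by (rule cong_add)
next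
  case (single w c)
  then show ?case using foreign_word_mem[of w c] uminus_mem zero_mem
    by (auto simp: restrict_letters_single cong_def)
qed simp

lemma (in lpa_ideal) lpa_kernel_Int: "lpa_kernel E (I \<inter> carrier (free_alg E))"
  using relator_mem relators_free_alg[OF wf_digraph_axioms]
  by (auto simp: lpa_kernel_iff zero_mem add_mem mult_left_mem mult_right_mem
      free_alg_zero free_alg_add free_alg_mult free_alg_scal)

lemma (in lpa_ideal) rel_ideal_subset: "lpa_rel_ideal E \<subseteq> I"
  using lpa_kernel_Int unfolding lpa_rel_ideal_eq by blast

section \<open>The quotient ring, computed on representatives\<close>

abbreviation lpa_proj :: "('v,'e) pre_digraph \<Rightarrow> ('v,'e,'k::field) free_lpa \<Rightarrow> ('v,'e,'k) free_lpa set" where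
  "lpa_proj E a \<equiv> lpa_rel_ideal E +>\<^bsub>free_alg E\<^esub> a"

lemma lpa_proj_eq: "lpa_proj E a = {x. x - a \<in> lpa_rel_ideal E}"
  unfolding a_r_coset_def' by (auto simp: algebra_simps intro: bexI[of _ "_ - a"])

context wf_digraph
begin

lemma rel_ideal_simps:
  "0 \<in> lpa_rel_ideal G" "a \<in> lpa_rel_ideal G \<Longrightarrow> b \<in> lpa_rel_ideal G \<Longrightarrow> a + b \<in> lpa_rel_ideal G"
  "a \<in> lpa_rel_ideal G \<Longrightarrow> a \<in> carrier (free_alg G)"
  "a \<in> lpa_rel_ideal G \<Longrightarrow> x \<in> carrier (free_alg G) \<Longrightarrow> x * a \<in> lpa_rel_ideal G"
  "a \<in> lpa_rel_ideal G \<Longrightarrow> x \<in> carrier (free_alg G) \<Longrightarrow> a * x \<in> lpa_rel_ideal G"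
  using lpa_kernel_rel_ideal by (auto simp: lpa_kernel_iff)

lemma rel_ideal_uminus: "a \<in> lpa_rel_ideal G \<Longrightarrow> - a \<in> lpa_rel_ideal G"
proof -
  assume "a \<in> lpa_rel_ideal G"
  then have "scal (- 1) * a \<in> lpa_rel_ideal G" using lpa_kernel_rel_ideal by (auto simp: lpa_kernel_iff)
  then show ?thesis by (simp add: single_uminus)
qed

lemma lpa_proj_eq_iff: "lpa_proj G a = lpa_proj G b \<longleftrightarrow> a - b \<in> lpa_rel_ideal G"
proof
  assume eq: "lpa_proj G a = lpa_proj G b"
  have "a \<in> lpa_proj G a" by (simp add: lpa_proj_eq rel_ideal_simps)
  then show "a - b \<in> lpa_rel_ideal G" unfolding eq by (simp add: lpa_proj_eq)
next
  assume ab: "a - b \<in> lpa_rel_ideal G"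
  have "x - a \<in> lpa_rel_ideal G \<longleftrightarrow> x - b \<in> lpa_rel_ideal G" for x
    using rel_ideal_simps(2)[OF _ ab, of "x - a"] rel_ideal_simps(2)[OF _ rel_ideal_uminus[OF ab], of "x - b"]
    by (auto simp: algebra_simps)
  then show "lpa_proj G a = lpa_proj G b" by (simp add: lpa_proj_eq)
qed

lemma carrier_lpa: "carrier (leavitt_path_algebra G) = lpa_proj G ` carrier (free_alg G)"
  by (auto simp: leavitt_path_algebra_def FactRing_def A_RCOSETS_def')

lemma zero_lpa: "\<zero>\<^bsub>leavitt_path_algebra G\<^esub> = lpa_proj G 0"
  by (auto simp: leavitt_path_algebra_def FactRing_def lpa_proj_eq)

lemma add_lpa: "lpa_proj G a \<oplus>\<^bsub>leavitt_path_algebra G\<^esub> lpa_proj G b = lpa_proj G (a + b)"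
proof -
  have "lpa_proj G a <+>\<^bsub>free_alg G\<^esub> lpa_proj G b = lpa_proj G (a + b)"
  proof
    show "lpa_proj G a <+>\<^bsub>free_alg G\<^esub> lpa_proj G b \<subseteq> lpa_proj G (a + b)"
    proof
      fix x assume "x \<in> lpa_proj G a <+>\<^bsub>free_alg G\<^esub> lpa_proj G b"
      then obtain h k where hk: "h \<in> lpa_proj G a" "k \<in> lpa_proj G b" "x = h + k"
        unfolding set_add_def' by auto
      then have "(h - a) + (k - b) \<in> lpa_rel_ideal G"
        unfolding lpa_proj_eq by (intro rel_ideal_simps(2)) simp_all
      then show "x \<in> lpa_proj G (a + b)" by (simp add: lpa_proj_eq hk(3) algebra_simps)
    qed
    show "lpa_proj G (a + b) \<subseteq> lpa_proj G a <+>\<^bsub>free_alg G\<^esub> lpa_proj G b"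
    proof
      fix x assume "x \<in> lpa_proj G (a + b)"
      then have "x - b \<in> lpa_proj G a" "b \<in> lpa_proj G b" "x = (x - b) + b"
        by (auto simp: lpa_proj_eq algebra_simps rel_ideal_simps)
      then have "\<exists>h\<in>lpa_proj G a. \<exists>k\<in>lpa_proj G b. x = h + k" by blast
      then show "x \<in> lpa_proj G a <+>\<^bsub>free_alg G\<^esub> lpa_proj G b"
        unfolding set_add_def' by auto
    qed
  qed
  then show ?thesis by (simp add: leavitt_path_algebra_def FactRing_def)
qed

lemma mult_lpa:
  assumes "a \<in> carrier (free_alg G)" "b \<in> carrier (free_alg G)"
  shows "lpa_proj G a \<otimes>\<^bsub>leavitt_path_algebra G\<^esub> lpa_proj G b = lpa_proj G (a * b)"
proof -
  have eq: "lpa_proj G (h * k) = lpa_proj G (a * b)" if "h \<in> lpa_proj G a" "k \<in> lpa_proj G b" for h k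
  proof -
    have h: "h - a \<in> lpa_rel_ideal G" and k: "k - b \<in> lpa_rel_ideal G" using that by (simp_all add: lpa_proj_eq)
    have "k = (k - b) + b" by simp
    with k assms(2) have kF: "k \<in> carrier (free_alg G)" using rel_ideal_simps(3) free_alg_add by metis
    have "(h - a) * k + a * (k - b) \<in> lpa_rel_ideal G"
      by (intro rel_ideal_simps(2) rel_ideal_simps(5)[OF h kF] rel_ideal_simps(4)[OF k assms(1)])
    then show ?thesis by (simp add: lpa_proj_eq_iff algebra_simps)
  qed
  have ne: "lpa_proj G a \<noteq> {}" "lpa_proj G b \<noteq> {}"
    using rel_ideal_simps(1) by (auto simp: lpa_proj_eq intro: exI[of _ a] exI[of _ b])
  have "rcoset_mult (free_alg G) (lpa_rel_ideal G) (lpa_proj G a) (lpa_proj G b) =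
      (\<Union>h\<in>lpa_proj G a. \<Union>k\<in>lpa_proj G b. lpa_proj G (a * b))"
    unfolding rcoset_mult_def free_alg_simps by (intro SUP_cong refl eq)
  also have "\<dots> = lpa_proj G (a * b)" using ne by simp
  finally have "rcoset_mult (free_alg G) (lpa_rel_ideal G) (lpa_proj G a) (lpa_proj G b) = lpa_proj G (a * b)" .
  then show ?thesis by (simp add: leavitt_path_algebra_def FactRing_def)
qed

lemma abelian_group_lpa: "abelian_group (leavitt_path_algebra G)"
proof (rule abelian_groupI)
  fix x assume "x \<in> carrier (leavitt_path_algebra G :: ('a,'b,'c::field) free_lpa set ring)"
  then obtain a where a: "x = lpa_proj G a" "a \<in> carrier (free_alg G)" by (auto simp: carrier_lpa)
  then have "lpa_proj G (- a) \<in> carrier (leavitt_path_algebra G)" by (auto simp: carrier_lpa free_alg_uminus)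
  then show "\<exists>y\<in>carrier (leavitt_path_algebra G). y \<oplus>\<^bsub>leavitt_path_algebra G\<^esub> x = \<zero>\<^bsub>leavitt_path_algebra G\<^esub>"
    using a by (intro bexI[of _ "lpa_proj G (- a)"]) (simp_all add: add_lpa zero_lpa)
qed (auto simp: carrier_lpa add_lpa zero_lpa algebra_simps free_alg_zero intro!: imageI free_alg_add)

lemma a_inv_lpa:
  assumes "a \<in> carrier (free_alg G)"
  shows "\<ominus>\<^bsub>leavitt_path_algebra G\<^esub> lpa_proj G a = lpa_proj G (- a)"
  by (rule abelian_group.minus_equality[OF abelian_group_lpa])
    (use assms in \<open>auto simp: carrier_lpa add_lpa zero_lpa free_alg_uminus\<close>)

section \<open>Transfer of ideals between \<open>L\<close> and the unital algebra\<close>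

definition pull_ideal :: "('a,'b,'k::field) free_lpa set set \<Rightarrow> ('a,'b,'k) free_lpa set" where
  "pull_ideal J = {a. Poly_Mapping.lookup a 0 = 0 \<and> lpa_proj G (restrict_letters G a) \<in> J}"

lemma mem_pull_ideal: "a \<in> carrier (free_alg G) \<Longrightarrow> a \<in> pull_ideal J \<longleftrightarrow> lpa_proj G a \<in> J"
  by (simp add: pull_ideal_def mem_free_alg_iff)

text \<open>Closure under scalars is the point: \<open>J\<close> is an ideal of a ring only. With a
  local unit u for b on the right, c b and b (c u) have the same coset, and c u, cleared of foreign
  letters, represents an element of \<open>L\<close>.\<close>

lemma lpa_ideal_pull_ideal:
  assumes J: "two_sided_ideal (leavitt_path_algebra G) J"
  shows "lpa_ideal G (pull_ideal J)"
proof -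
  note J' = J[unfolded two_sided_ideal_iff[OF abelian_group_lpa]]
  interpret N: lpa_ideal G "{a. Poly_Mapping.lookup a 0 = 0 \<and> restrict_letters G a \<in> lpa_rel_ideal G}"
    by (rule lpa_ideal_lift[OF lpa_kernel_rel_ideal])
  define I where "I = {b \<in> carrier (free_alg G). lpa_proj G b \<in> J}"
  have "scal c * b \<in> I" if b: "b \<in> I" for b c
  proof -
    have bF: "b \<in> carrier (free_alg G)" and bJ: "lpa_proj G b \<in> J" using b by (auto simp: I_def)
    then have b0: "Poly_Mapping.lookup b 0 = 0" "restrict_letters G b = b" by (auto simp: mem_free_alg_iff)
    obtain A where A: "N.cong b (\<Sum>v\<in>A. b * Vt v)" by (rule N.local_unit[OF b0(1)])
    define u where "u = (\<Sum>v\<in>A. Vt v :: ('a,'b,'c) free_lpa)"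
    have "Poly_Mapping.lookup u 0 = 0"
      by (simp add: u_def lookup_sum gen_def lookup_single zero_lpa_word_def)
    then have u: "scal c * restrict_letters G u \<in> carrier (free_alg G)"
      by (intro free_alg_scal restrict_letters_mem)
    have "N.cong b (b * u)" using A by (simp add: u_def sum_distrib_left)
    then have "N.cong (scal c * b) (scal c * (b * u))" by (rule N.cong_left)
    then have "scal c * b - b * (scal c * restrict_letters G u) \<in> lpa_rel_ideal G"
      by (simp add: N.cong_def restrict_letters_diff restrict_letters_mult b0 scal_left_commute)
    then have "lpa_proj G (scal c * b) = lpa_proj G (b * (scal c * restrict_letters G u))"
      by (simp add: lpa_proj_eq_iff)
    also have "\<dots> = lpa_proj G b \<otimes>\<^bsub>leavitt_path_algebra G\<^esub> lpa_proj G (scal c * restrict_letters G u)"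
      by (simp add: mult_lpa bF u)
    also have "\<dots> \<in> J" using J' bJ u by (auto simp: carrier_lpa)
    finally show ?thesis using bF by (simp add: I_def free_alg_scal)
  qed
  moreover have "lpa_rel_ideal G \<subseteq> I"
  proof
    fix r :: "('a,'b,'c) free_lpa" assume r: "r \<in> lpa_rel_ideal G"
    then have "lpa_proj G r = \<zero>\<^bsub>leavitt_path_algebra G\<^esub>" by (simp add: zero_lpa lpa_proj_eq_iff)
    then show "r \<in> I" using r J' rel_ideal_simps(3) by (auto simp: I_def)
  qed
  then have "lpa_relators G \<subseteq> I" using lpa_kernel_rel_ideal[where ?'c = 'c] by (auto simp: lpa_kernel_iff)
  moreover have "0 \<in> I" using J' by (simp add: I_def zero_lpa free_alg_zero)
  moreover have "a + b \<in> I" if "a \<in> I" "b \<in> I" for a b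
    using that J' by (auto simp: I_def free_alg_add add_lpa[symmetric])
  moreover have "x * a \<in> I \<and> a * x \<in> I" if "a \<in> I" "x \<in> carrier (free_alg G)" for a x
    using that J' by (auto simp: I_def free_alg_mult mult_lpa[symmetric] carrier_lpa)
  ultimately have "lpa_kernel G I" by (auto simp: lpa_kernel_iff I_def)
  from lpa_ideal_lift[OF this] show ?thesis
    by (simp add: pull_ideal_def I_def restrict_letters_mem conj_commute cong: conj_cong)
qed

lemma two_sided_ideal_push:
  assumes I: "lpa_ideal G I"
  shows "two_sided_ideal (leavitt_path_algebra G) (lpa_proj G ` (I \<inter> carrier (free_alg G)))"
proof -
  interpret lpa_ideal G I by fact
  show ?thesis
    unfolding two_sided_ideal_iff[OF abelian_group_lpa]
    by (auto simp: carrier_lpa zero_lpa add_lpa mult_lpa a_inv_lpa zero_mem free_alg_zero add_mem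
        mult_left_mem mult_right_mem uminus_mem free_alg_add free_alg_mult free_alg_uminus)
qed

text \<open>Every \<open>lpa_ideal\<close> contains the ideal of relations, so membership does not
  depend on the representative of a coset.\<close>

lemma mem_push_iff:
  assumes I: "lpa_ideal G I" and a: "a \<in> carrier (free_alg G)"
  shows "lpa_proj G a \<in> lpa_proj G ` (I \<inter> carrier (free_alg G)) \<longleftrightarrow> a \<in> I"
proof
  interpret lpa_ideal G I by fact
  assume "lpa_proj G a \<in> lpa_proj G ` (I \<inter> carrier (free_alg G))"
  then obtain b where "b \<in> I" "a - b \<in> lpa_rel_ideal G" by (auto simp: lpa_proj_eq_iff)
  then show "a \<in> I" using rel_ideal_subset add_mem[of "a - b" b] by auto
qed (use a in auto)

text \<open>The unital side compares only elements without constant term. Foreign letters do no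
  harm, since \<open>restrict_letters\<close> changes an element only modulo any
  \<open>lpa_ideal\<close>.\<close>

lemma chain_lpa_iff:
  "(\<forall>I J :: ('a,'b,'k) free_lpa set set. two_sided_ideal (leavitt_path_algebra G) I \<longrightarrow> two_sided_ideal (leavitt_path_algebra G) J \<longrightarrow>
      I \<subseteq> J \<or> J \<subseteq> I) \<longleftrightarrow>
   (\<forall>I J :: ('a,'b,'k::field) free_lpa set. lpa_ideal G I \<longrightarrow> lpa_ideal G J \<longrightarrow>
      (\<forall>a\<in>I. Poly_Mapping.lookup a 0 = 0 \<longrightarrow> a \<in> J) \<or> (\<forall>a\<in>J. Poly_Mapping.lookup a 0 = 0 \<longrightarrow> a \<in> I))"
  (is "?L \<longleftrightarrow> ?R")
proof
  assume L: ?L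
  show ?R
  proof (intro allI impI)
    fix I J :: "('a,'b,'k) free_lpa set" assume IJ: "lpa_ideal G I" "lpa_ideal G J"
    have *: "a \<in> J'"
      if ideals: "lpa_ideal G I'" "lpa_ideal G J'"
        and sub: "lpa_proj G ` (I' \<inter> carrier (free_alg G)) \<subseteq> lpa_proj G ` (J' \<inter> carrier (free_alg G))"
        and a: "a \<in> I'" "Poly_Mapping.lookup a 0 = 0" for I' J' a
    proof -
      have r: "restrict_letters G a \<in> carrier (free_alg G)" by (rule restrict_letters_mem[OF a(2)])
      have "restrict_letters G a \<in> I'"
        using lpa_ideal.cong_mem_iff[OF ideals(1) lpa_ideal.restrict_letters_cong[OF ideals(1)]] a by blast
      then have "restrict_letters G a \<in> J'" using r sub mem_push_iff[OF ideals(2) r] by blast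
      then show ?thesis
        using lpa_ideal.cong_mem_iff[OF ideals(2) lpa_ideal.restrict_letters_cong[OF ideals(2)]] by blast
    qed
    from L[rule_format, OF two_sided_ideal_push[OF IJ(1)] two_sided_ideal_push[OF IJ(2)]]
    show "(\<forall>a\<in>I. Poly_Mapping.lookup a 0 = 0 \<longrightarrow> a \<in> J) \<or> (\<forall>a\<in>J. Poly_Mapping.lookup a 0 = 0 \<longrightarrow> a \<in> I)"
    proof (elim disjE)
      assume "lpa_proj G ` (I \<inter> carrier (free_alg G)) \<subseteq> lpa_proj G ` (J \<inter> carrier (free_alg G))"
      from *[OF IJ this] show ?thesis by blast
    next
      assume "lpa_proj G ` (J \<inter> carrier (free_alg G)) \<subseteq> lpa_proj G ` (I \<inter> carrier (free_alg G))"
      from *[OF IJ(2,1) this] show ?thesis by blast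
    qed
  qed
next
  assume R: ?R
  show ?L
  proof (intro allI impI)
    fix I J :: "('a,'b,'k) free_lpa set set"
    assume I: "two_sided_ideal (leavitt_path_algebra G) I" and J: "two_sided_ideal (leavitt_path_algebra G) J"
    have *: "I' \<subseteq> J'"
      if "two_sided_ideal (leavitt_path_algebra G) I'"
        and sub: "\<forall>a\<in>pull_ideal I'. Poly_Mapping.lookup a 0 = 0 \<longrightarrow> a \<in> pull_ideal J'" for I' J'
    proof
      fix x assume x: "x \<in> I'"
      with that(1) obtain a where "a \<in> carrier (free_alg G)" "x = lpa_proj G a"
        by (auto simp: two_sided_ideal_iff[OF abelian_group_lpa] carrier_lpa)
      with x sub show "x \<in> J'" by (auto simp: mem_pull_ideal mem_free_alg_iff)
    qed
    from R[rule_format, OF lpa_ideal_pull_ideal[OF I] lpa_ideal_pull_ideal[OF J]]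
    show "I \<subseteq> J \<or> J \<subseteq> I"
      using *[OF I] *[OF J] by (elim disjE) simp_all
  qed
qed

end

section \<open>Ideals under Condition (K)\<close>

text \<open>The two elements differ by terms e e^* for edges e ending in \<open>H\<^sub>2\<close>,
  and such edges lie in \<open>I\<close>.\<close>

lemma (in lpa_ideal) breaking_element_cong:
  assumes w: "w \<in> breaking_vertices E H\<^sub>1" and "H\<^sub>1 \<subseteq> H\<^sub>2" and H2: "\<And>v. v \<in> H\<^sub>2 \<Longrightarrow> Vt v \<in> I"
  shows "breaking_element E H\<^sub>2 w \<approx> breaking_element E H\<^sub>1 w"
proof -
  define P where "P H = {e \<in> out_arcs E w. head E e \<in> verts E - H}" for H
  have fin: "finite (P H\<^sub>1)" using w by (simp add: breaking_vertices_def P_def)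
  have sub: "P H\<^sub>2 \<subseteq> P H\<^sub>1" using \<open>H\<^sub>1 \<subseteq> H\<^sub>2\<close> by (auto simp: P_def)
  have "breaking_element E H\<^sub>2 w - (breaking_element E H\<^sub>1 w :: ('v,'e,'k) free_lpa) =
      (\<Sum>e\<in>P H\<^sub>1. Ed e * Gh e) - (\<Sum>e\<in>P H\<^sub>2. Ed e * Gh e)"
    by (simp add: breaking_element_def P_def)
  also have "\<dots> = (\<Sum>e\<in>P H\<^sub>1 - P H\<^sub>2. Ed e * Gh e)"
    by (rule sum_diff[OF fin sub, symmetric])
  also have "\<dots> \<in> I"
    by (intro sum_mem mult_right_mem Ed_mem_of_head H2) (auto simp: P_def)
  finally show ?thesis by (simp add: cong_def)
qed

text \<open>Enlarging the hereditary set only removes edges from the finite sum. Were none left, the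
  new element would be w itself, which is not in \<open>I\<close>.\<close>

lemma (in lpa_ideal) breaking_vertex_transfer:
  assumes w: "w \<in> breaking_vertices E H\<^sub>1" and sub: "H\<^sub>1 \<subseteq> H\<^sub>2" and H2: "\<And>v. v \<in> H\<^sub>2 \<Longrightarrow> Vt v \<in> I"
    and mem: "breaking_element E H\<^sub>1 w \<in> I" and nmem: "Vt w \<notin> I"
  shows "w \<in> breaking_vertices E H\<^sub>2 \<and> breaking_element E H\<^sub>2 w \<in> I"
proof -
  have b: "breaking_element E H\<^sub>2 w \<in> I"
    using breaking_element_cong[OF w sub H2] mem cong_mem_iff by blast
  let ?P = "{e \<in> out_arcs E w. head E e \<in> verts E - H\<^sub>2}"
  have "?P \<noteq> {}"
  proof
    assume empty: "?P = {}"
    have "breaking_element E H\<^sub>2 w = (Vt w :: ('v,'e,'k) free_lpa)"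
      unfolding breaking_element_def empty by simp
    with b nmem show False by simp
  qed
  moreover have "finite ?P"
    by (rule finite_subset[of _ "{e \<in> out_arcs E w. head E e \<in> verts E - H\<^sub>1}"])
      (use w sub in \<open>auto simp: breaking_vertices_def\<close>)
  moreover have "w \<in> verts E - H\<^sub>2" "infinite_emitter E w"
    using w H2 nmem by (auto simp: breaking_vertices_def)
  ultimately show ?thesis using b by (simp add: breaking_vertices_def)
qed

definition (in lpa_ideal) pair_of :: "'v set \<times> 'v set" where
  "pair_of = (vertex_set, {w \<in> breaking_vertices E vertex_set. breaking_element E vertex_set w \<in> I})"

lemma (in lpa_ideal) admissible_pair_of: "admissible_pair E pair_of"
  using hereditary_vertex_set saturated_vertex_set by (auto simp: admissible_pair_def pair_of_def)

lemma lpa_ideal_Int: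
  assumes "lpa_ideal E I" "lpa_ideal E J"
  shows "lpa_ideal E (I \<inter> J)"
proof -
  interpret I: lpa_ideal E I by fact
  interpret J: lpa_ideal E J by fact
  show ?thesis
    by unfold_locales
      (auto intro: I.zero_mem J.zero_mem I.add_mem J.add_mem I.mult_left_mem J.mult_left_mem
        I.mult_right_mem J.mult_right_mem I.foreign_mem J.foreign_mem
        dest: subsetD[OF I.relator_mem] subsetD[OF J.relator_mem])
qed

text \<open>\<open>M\<close> is compared with its intersection with \<open>I\<close>. A breaking
  vertex v of the pair of \<open>M\<close> either lies in the vertex set of \<open>I\<close>, which
  then contains v^H as a multiple of v modulo relations, or belongs to the pair of \<open>I\<close>,
  whose element at v is congruent to that of \<open>M\<close>.\<close>

lemma ideal_subset_of_pair_le: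
  assumes K: "condition_K E" and I: "lpa_ideal E I" and M: "lpa_ideal E M"
    and le: "admissible_le (lpa_ideal.pair_of E M) (lpa_ideal.pair_of E I)"
    and a: "a \<in> M" "Poly_Mapping.lookup a 0 = 0"
  shows "a \<in> I"
proof -
  interpret I: lpa_ideal E I by fact
  interpret M: lpa_ideal E M by fact
  interpret N: lpa_ideal E "I \<inter> M" by (rule lpa_ideal_Int[OF I M])
  have sub: "M.vertex_set \<subseteq> I.vertex_set"
    using le by (simp add: admissible_le_def M.pair_of_def I.pair_of_def)
  have vs: "N.vertex_set = M.vertex_set"
    using sub by (auto simp: N.vertex_set_def M.vertex_set_def I.vertex_set_def)
  have vert: "Vt v \<in> I \<inter> M" if "Vt v \<in> M" for v
  proof (cases "v \<in> verts E")
    case True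
    with that sub show ?thesis by (auto simp: M.vertex_set_def I.vertex_set_def)
  next
    case False
    then have "Vt v \<in> I" using I.foreign_Vert I.cong_zero_iff by blast
    with that show ?thesis by simp
  qed
  have brk: "breaking_element E N.vertex_set v \<in> I \<inter> M"
    if v: "v \<in> breaking_vertices E N.vertex_set" and mem: "breaking_element E N.vertex_set v \<in> M" for v
  proof -
    have "v \<in> snd M.pair_of" using v mem by (simp add: M.pair_of_def vs)
    with le have "v \<in> I.vertex_set \<or> v \<in> snd I.pair_of"
      by (auto simp: admissible_le_def M.pair_of_def I.pair_of_def)
    then have "breaking_element E M.vertex_set v \<in> I"
    proof
      assume "v \<in> I.vertex_set"
      then have "Vt v \<in> I" by (simp add: I.vertex_set_def)
      then show ?thesis
        using I.V_breaking I.cong_mem_iff I.mult_right_mem by blast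
    next
      assume "v \<in> snd I.pair_of"
      then have "breaking_element E I.vertex_set v \<in> I" by (simp add: I.pair_of_def)
      moreover have "I.cong (breaking_element E I.vertex_set v) (breaking_element E M.vertex_set v)"
        using v sub by (intro I.breaking_element_cong) (auto simp: vs I.vertex_set_def)
      ultimately show ?thesis using I.cong_mem_iff by blast
    qed
    then show ?thesis using mem by (simp add: vs)
  qed
  have "a \<in> I \<inter> M"
    by (rule N.ideal_subset_of_vertices[OF K M _ vert brk a]) auto
  then show ?thesis by simp
qed

section \<open>Degrees and homogeneous components\<close>

definition homog :: "int \<Rightarrow> ('v,'e,'k::field) free_lpa \<Rightarrow> ('v,'e,'k) free_lpa" where
  "homog n a = (\<Sum>w\<in>{w \<in> Poly_Mapping.keys a. word_degree w = n}. Poly_Mapping.single w (Poly_Mapping.lookup a w))"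

lemma lookup_homog: "Poly_Mapping.lookup (homog n a) w = (if word_degree w = n then Poly_Mapping.lookup a w else 0)"
  by (auto simp: homog_def lookup_sum lookup_single when_def in_keys_iff)

lemma homog_add: "homog n (a + b) = homog n a + homog n b"
  by (rule poly_mapping_eqI) (simp add: lookup_homog lookup_add)

lemma homog_zero [simp]: "homog n 0 = 0"
  by (rule poly_mapping_eqI) (simp add: lookup_homog)

lemma homog_single: "homog n (Poly_Mapping.single w c) = (if word_degree w = n then Poly_Mapping.single w c else 0)"
  by (rule poly_mapping_eqI) (auto simp: lookup_homog lookup_single when_def)

lemma word_degree_add: "word_degree (u + w) = word_degree u + word_degree w"
  by (simp add: word_degree_def)

lemma homog_single_mult:
  "homog n (Poly_Mapping.single w c * a) = Poly_Mapping.single w c * homog (n - word_degree w) a"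
proof (induction a rule: poly_mapping_additive_induct)
  case (single w' c')
  have "word_degree w + word_degree w' = n \<longleftrightarrow> word_degree w' = n - word_degree w" by auto
  then show ?case by (auto simp: mult_single homog_single word_degree_add)
qed (simp_all add: distrib_left homog_add)

lemma homog_mult_single:
  "homog n (a * Poly_Mapping.single w c) = homog (n - word_degree w) a * Poly_Mapping.single w c"
proof (induction a rule: poly_mapping_additive_induct)
  case (single w' c')
  have "word_degree w' + word_degree w = n \<longleftrightarrow> word_degree w' = n - word_degree w" by auto
  then show ?case by (auto simp: mult_single homog_single word_degree_add)
qed (simp_all add: distrib_right homog_add)

lemma sum_homog: "(\<Sum>n\<in>word_degree ` Poly_Mapping.keys a. homog n a) = a"
proof (rule poly_mapping_eqI)
  fix w
  have "Poly_Mapping.lookup (\<Sum>n\<in>word_degree ` Poly_Mapping.keys a. homog n a) w =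
      (\<Sum>n\<in>word_degree ` Poly_Mapping.keys a. if word_degree w = n then Poly_Mapping.lookup a w else 0)"
    by (simp add: lookup_sum lookup_homog)
  also have "\<dots> = Poly_Mapping.lookup a w"
    by (auto simp: in_keys_iff)
  finally show "Poly_Mapping.lookup (\<Sum>n\<in>word_degree ` Poly_Mapping.keys a. homog n a) w = Poly_Mapping.lookup a w" .
qed

definition homogeneous :: "int \<Rightarrow> ('v,'e,'k::field) free_lpa \<Rightarrow> bool" where
  "homogeneous d a \<longleftrightarrow> (\<forall>w\<in>Poly_Mapping.keys a. word_degree w = d)"

lemma homog_homogeneous: "homogeneous d a \<Longrightarrow> homog n a = (if n = d then a else 0)"
  by (rule poly_mapping_eqI) (auto simp: homogeneous_def lookup_homog in_keys_iff)

lemma homogeneous_mult: "homogeneous m a \<Longrightarrow> homogeneous n b \<Longrightarrow> homogeneous (m + n) (a * b)"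
  using keys_mult[of a b] by (fastforce simp: homogeneous_def word_degree_add)

lemma homogeneous_diff: "homogeneous n a \<Longrightarrow> homogeneous n b \<Longrightarrow> homogeneous n (a - b)"
  by (auto simp: homogeneous_def in_keys_iff lookup_minus)

lemma homogeneous_sum: "(\<And>i. i \<in> A \<Longrightarrow> homogeneous n (f i)) \<Longrightarrow> homogeneous n (sum f A)"
proof (induction A rule: infinite_finite_induct)
  case (insert i A)
  then show ?case using keys_add[of "f i" "sum f A"] by (auto simp: homogeneous_def)
qed (simp_all add: homogeneous_def)

lemma homogeneous_gen: "homogeneous (gen_degree g) (gen g)"
  by (simp add: homogeneous_def gen_def word_degree_def)

lemma homogeneous_Vt: "homogeneous 0 (Vt v)"
  and homogeneous_Ed: "homogeneous 1 (Ed e)" and homogeneous_Gh: "homogeneous (- 1) (Gh e)"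
  using homogeneous_gen[of "Vert v"] homogeneous_gen[of "Edge e"] homogeneous_gen[of "Ghost e"] by simp_all

lemma homogeneous_Ed_Gh: "homogeneous 0 (Ed e * Gh f)" and homogeneous_Gh_Ed: "homogeneous 0 (Gh e * Ed f)"
  using homogeneous_mult[OF homogeneous_Ed homogeneous_Gh] homogeneous_mult[OF homogeneous_Gh homogeneous_Ed]
  by (metis add.right_inverse add.left_inverse)+

lemma homogeneous_breaking_element: "homogeneous 0 (breaking_element E H v)"
  unfolding breaking_element_def
  by (intro homogeneous_diff homogeneous_sum homogeneous_Vt homogeneous_Ed_Gh)

lemma homogeneous_relator: "r \<in> lpa_relators E \<Longrightarrow> \<exists>d. homogeneous d r"
  unfolding lpa_relators_def
proof (elim UnE CollectE exE conjE)
  note VV = homogeneous_mult[OF homogeneous_Vt homogeneous_Vt, simplified]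
  note VE = homogeneous_mult[OF homogeneous_Vt homogeneous_Ed, simplified]
    homogeneous_mult[OF homogeneous_Ed homogeneous_Vt, simplified]
  note VG = homogeneous_mult[OF homogeneous_Vt homogeneous_Gh, simplified]
    homogeneous_mult[OF homogeneous_Gh homogeneous_Vt, simplified]
  show "\<exists>d. homogeneous d r" if "r = Vt v * Vt v - Vt v" for v
    unfolding that by (intro exI[of _ 0] homogeneous_diff VV homogeneous_Vt)
  show "\<exists>d. homogeneous d r" if "r = Vt v * Vt w" for v w
    unfolding that by (intro exI[of _ 0] VV)
  show "\<exists>d. homogeneous d r" if "r = Vt (tail E e) * Ed e - Ed e" for e
    unfolding that by (intro exI[of _ 1] homogeneous_diff VE homogeneous_Ed)
  show "\<exists>d. homogeneous d r" if "r = Ed e * Vt (head E e) - Ed e" for e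
    unfolding that by (intro exI[of _ 1] homogeneous_diff VE homogeneous_Ed)
  show "\<exists>d. homogeneous d r" if "r = Vt (head E e) * Gh e - Gh e" for e
    unfolding that by (intro exI[of _ "- 1"] homogeneous_diff VG homogeneous_Gh)
  show "\<exists>d. homogeneous d r" if "r = Gh e * Vt (tail E e) - Gh e" for e
    unfolding that by (intro exI[of _ "- 1"] homogeneous_diff VG homogeneous_Gh)
  show "\<exists>d. homogeneous d r" if "r = Gh e * Ed e - Vt (head E e)" for e
    unfolding that by (intro exI[of _ 0] homogeneous_diff homogeneous_Gh_Ed homogeneous_Vt)
  show "\<exists>d. homogeneous d r" if "r = Gh e * Ed f" for e f
    unfolding that by (intro exI[of _ 0] homogeneous_Gh_Ed)
  show "\<exists>d. homogeneous d r" if "r = Vt v - (\<Sum>e\<in>out_arcs E v. Ed e * Gh e)" for v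
    unfolding that by (intro exI[of _ 0] homogeneous_diff homogeneous_sum homogeneous_Vt homogeneous_Ed_Gh)
qed

context lpa_ideal
begin

text \<open>The largest graded ideal inside \<open>I\<close>; it still contains the relators and the
  foreign letters because these are homogeneous.\<close>

definition graded_part :: "('v,'e,'k) free_lpa set" where
  "graded_part = {a. \<forall>n. homog n a \<in> I}"

lemma homogeneous_graded_part: "homogeneous d a \<Longrightarrow> a \<in> I \<Longrightarrow> a \<in> graded_part"
  by (auto simp: graded_part_def homog_homogeneous zero_mem)

lemma graded_part_subset: "graded_part \<subseteq> I"
proof
  fix a assume "a \<in> graded_part"
  then have "(\<Sum>n\<in>word_degree ` Poly_Mapping.keys a. homog n a) \<in> I"
    by (intro sum_mem) (simp add: graded_part_def)
  then show "a \<in> I" by (simp add: sum_homog)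
qed

lemma lpa_ideal_graded_part: "lpa_ideal E graded_part"
proof
  show "x * a \<in> graded_part" if "a \<in> graded_part" for a x
  proof (induction x rule: poly_mapping_additive_induct)
    case (single w c)
    then show ?case using that by (simp add: graded_part_def homog_single_mult mult_left_mem)
  qed (simp_all add: graded_part_def distrib_right homog_add zero_mem add_mem)
  show "a * x \<in> graded_part" if "a \<in> graded_part" for a x
  proof (induction x rule: poly_mapping_additive_induct)
    case (single w c)
    then show ?case using that by (simp add: graded_part_def homog_mult_single mult_right_mem)
  qed (simp_all add: graded_part_def distrib_left homog_add zero_mem add_mem)
  show "lpa_relators E \<subseteq> graded_part"
    using relator_mem homogeneous_relator homogeneous_graded_part by blast
  show "gen g \<in> graded_part" if "g \<notin> gens E" for g
    by (rule homogeneous_graded_part[OF homogeneous_gen foreign_mem[OF that]])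
qed (simp_all add: graded_part_def homog_add zero_mem add_mem)

text \<open>Vertices and elements v^H are homogeneous, so those in \<open>I\<close> are already in
  the graded part, which therefore has the same elements without constant term.\<close>

lemma homog_mem:
  assumes K: "condition_K E" and a: "a \<in> I" "Poly_Mapping.lookup a 0 = 0"
  shows "homog n a \<in> I"
proof -
  interpret gr: lpa_ideal E graded_part by (rule lpa_ideal_graded_part)
  have "a \<in> graded_part"
    by (rule gr.ideal_subset_of_vertices[OF K lpa_ideal_axioms graded_part_subset _ _ a])
      (blast intro: homogeneous_graded_part homogeneous_Vt homogeneous_breaking_element)+
  then show ?thesis by (simp add: graded_part_def)
qed

end

context wf_digraph
begin

lemma finsum_lpa:
  fixes f :: "'n \<Rightarrow> ('a,'b,'c::field) free_lpa"
  assumes "finite N" "\<And>n. n \<in> N \<Longrightarrow> f n \<in> carrier (free_alg G)"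
  shows "finsum (leavitt_path_algebra G) (\<lambda>n. lpa_proj G (f n)) N = lpa_proj G (sum f N)"
  using assms
proof (induction N rule: finite_induct)
  case empty
  interpret L: abelian_group "leavitt_path_algebra G :: ('a,'b,'c) free_lpa set ring"
    by (rule abelian_group_lpa)
  show ?case using L.finsum_empty by (simp add: zero_lpa)
next
  case (insert n N)
  interpret L: abelian_group "leavitt_path_algebra G :: ('a,'b,'c) free_lpa set ring"
    by (rule abelian_group_lpa)
  have "finsum (leavitt_path_algebra G) (\<lambda>n. lpa_proj G (f n)) (insert n N) =
      lpa_proj G (f n) \<oplus>\<^bsub>leavitt_path_algebra G\<^esub> finsum (leavitt_path_algebra G) (\<lambda>n. lpa_proj G (f n)) N"
    using insert by (intro L.finsum_insert) (auto simp: carrier_lpa)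
  also have "finsum (leavitt_path_algebra G) (\<lambda>n. lpa_proj G (f n)) N = lpa_proj G (sum f N)"
    using insert by simp
  finally show ?case using insert by (simp add: add_lpa)
qed

lemma lpa_graded_ideal_of_condition_K:
  assumes K: "condition_K G" and J: "two_sided_ideal (leavitt_path_algebra G) J"
  shows "lpa_graded_ideal G J"
  unfolding lpa_graded_ideal_def
proof (intro conjI ballI J)
  fix x assume x: "x \<in> J"
  interpret P: lpa_ideal G "pull_ideal J" by (rule lpa_ideal_pull_ideal[OF J])
  obtain a where a: "a \<in> carrier (free_alg G)" "x = lpa_proj G a"
    using x J by (auto simp: two_sided_ideal_iff[OF abelian_group_lpa] carrier_lpa)
  have keys: "Poly_Mapping.keys (homog n a) \<subseteq> {w \<in> Poly_Mapping.keys a. word_degree w = n}" for n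
    by (auto simp: in_keys_iff lookup_homog split: if_splits)
  have hF: "homog n a \<in> carrier (free_alg G)" for n
    using keys[of n] a(1) by (auto simp: free_alg_def)
  have hJ: "lpa_proj G (homog n a) \<in> J" for n
    using P.homog_mem[OF K, of a n] a x mem_pull_ideal[OF a(1)] mem_pull_ideal[OF hF]
    by (simp add: mem_free_alg_iff)
  show "\<exists>N f. finite N \<and> (\<forall>n\<in>N. f n \<in> J \<inter> lpa_component G n) \<and> x = finsum (leavitt_path_algebra G) f N"
  proof (intro exI conjI ballI)
    show "finite (word_degree ` Poly_Mapping.keys a)" by simp
    show "lpa_proj G (homog n a) \<in> J \<inter> lpa_component G n" for n
      using hJ hF keys[of n] by (auto simp: lpa_component_def)
    show "x = finsum (leavitt_path_algebra G) (\<lambda>n. lpa_proj G (homog n a)) (word_degree ` Poly_Mapping.keys a)"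
      using finsum_lpa[of "word_degree ` Poly_Mapping.keys a" "\<lambda>n. homog n a"] hF a(2)
      by (simp add: sum_homog)
  qed
qed

section \<open>Products and squares of ideals of \<open>L\<close>\<close>

lemma ideal_prod_subset:
  assumes A: "two_sided_ideal (leavitt_path_algebra G) A" and B: "two_sided_ideal (leavitt_path_algebra G) B"
  shows "ideal_prod (leavitt_path_algebra G) A B \<subseteq> A \<inter> B"
proof
  fix x assume "x \<in> ideal_prod (leavitt_path_algebra G) A B"
  then show "x \<in> A \<inter> B"
    using A B by (induction rule: ideal_prod.induct) (auto simp: two_sided_ideal_iff[OF abelian_group_lpa])
qed

text \<open>Associativity and distributivity are read off from representatives in the free
  algebra.\<close>

lemma two_sided_ideal_prod:
  fixes A :: "('a,'b,'k::field) free_lpa set set"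
  assumes A: "two_sided_ideal (leavitt_path_algebra G) A" and B: "two_sided_ideal (leavitt_path_algebra G) B"
  shows "two_sided_ideal (leavitt_path_algebra G) (ideal_prod (leavitt_path_algebra G) A B)"
proof -
  let ?L = "leavitt_path_algebra G :: ('a,'b,'k) free_lpa set ring"
  note A' = A[unfolded two_sided_ideal_iff[OF abelian_group_lpa]]
  note B' = B[unfolded two_sided_ideal_iff[OF abelian_group_lpa]]
  let ?P = "ideal_prod ?L A B"
  have sub: "?P \<subseteq> carrier ?L" using ideal_prod_subset[OF A B] A' by blast
  have zero: "\<zero>\<^bsub>?L\<^esub> \<in> ?P"
  proof -
    have "\<zero>\<^bsub>?L\<^esub> \<otimes>\<^bsub>?L\<^esub> \<zero>\<^bsub>?L\<^esub> \<in> ?P" using A' B' by (intro ideal_prod.prod) auto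
    then show ?thesis by (simp add: zero_lpa mult_lpa free_alg_zero)
  qed
  have rep: "\<exists>a\<in>carrier (free_alg G). x = lpa_proj G a" if "x \<in> carrier ?L" for x
    using that by (auto simp: carrier_lpa)
  have 1: "\<ominus>\<^bsub>?L\<^esub> x \<in> ?P" if "x \<in> ?P" for x
    using that
  proof (induction rule: ideal_prod.induct)
    case (prod i j)
    then obtain a b where ab: "a \<in> carrier (free_alg G)" "i = lpa_proj G a"
      "b \<in> carrier (free_alg G)" "j = lpa_proj G b" using rep A' B' by (meson subsetD)
    have "\<ominus>\<^bsub>?L\<^esub> i \<otimes>\<^bsub>?L\<^esub> j \<in> ?P" using prod A' by (intro ideal_prod.prod) auto
    then show ?case using ab by (simp add: mult_lpa a_inv_lpa free_alg_mult free_alg_uminus)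
  next
    case (sum x y)
    then obtain a b where ab: "a \<in> carrier (free_alg G)" "x = lpa_proj G a"
      "b \<in> carrier (free_alg G)" "y = lpa_proj G b" using rep sub by (meson subsetD)
    have "\<ominus>\<^bsub>?L\<^esub> x \<oplus>\<^bsub>?L\<^esub> \<ominus>\<^bsub>?L\<^esub> y \<in> ?P" using sum by (intro ideal_prod.sum)
    then show ?case using ab by (simp add: add_lpa a_inv_lpa free_alg_add algebra_simps)
  qed
  have 2: "z \<otimes>\<^bsub>?L\<^esub> x \<in> ?P \<and> x \<otimes>\<^bsub>?L\<^esub> z \<in> ?P" if "x \<in> ?P" and z: "z \<in> carrier ?L" for x z
    using that(1)
  proof (induction rule: ideal_prod.induct)
    case (prod i j)
    then obtain a b where ab: "a \<in> carrier (free_alg G)" "i = lpa_proj G a"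
      "b \<in> carrier (free_alg G)" "j = lpa_proj G b" using rep A' B' by (meson subsetD)
    obtain c where c: "c \<in> carrier (free_alg G)" "z = lpa_proj G c" using rep[OF z] by blast
    have "(z \<otimes>\<^bsub>?L\<^esub> i) \<otimes>\<^bsub>?L\<^esub> j \<in> ?P" "i \<otimes>\<^bsub>?L\<^esub> (j \<otimes>\<^bsub>?L\<^esub> z) \<in> ?P"
      using prod A' B' z by (auto intro: ideal_prod.prod)
    then show ?case using ab c by (simp add: mult_lpa free_alg_mult mult.assoc)
  next
    case (sum x y)
    then obtain a b where ab: "a \<in> carrier (free_alg G)" "x = lpa_proj G a"
      "b \<in> carrier (free_alg G)" "y = lpa_proj G b" using rep sub by (meson subsetD)
    obtain c where c: "c \<in> carrier (free_alg G)" "z = lpa_proj G c" using rep[OF z] by blast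
    have "(z \<otimes>\<^bsub>?L\<^esub> x) \<oplus>\<^bsub>?L\<^esub> (z \<otimes>\<^bsub>?L\<^esub> y) \<in> ?P" "(x \<otimes>\<^bsub>?L\<^esub> z) \<oplus>\<^bsub>?L\<^esub> (y \<otimes>\<^bsub>?L\<^esub> z) \<in> ?P"
      using sum by (auto intro: ideal_prod.sum)
    then show ?case using ab c by (simp add: mult_lpa add_lpa free_alg_add free_alg_mult distrib_left distrib_right)
  qed
  show ?thesis
    unfolding two_sided_ideal_iff[OF abelian_group_lpa]
    using sub zero 1 2 by (auto intro: ideal_prod.sum)
qed

lemma ideal_idempotent_of_condition_K:
  fixes A :: "('a,'b,'k::field) free_lpa set set"
  assumes K: "condition_K G" and A: "two_sided_ideal (leavitt_path_algebra G) A"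
  shows "A \<subseteq> ideal_prod (leavitt_path_algebra G) A A"
proof -
  let ?L = "leavitt_path_algebra G :: ('a,'b,'k) free_lpa set ring"
  let ?P = "ideal_prod ?L A A"
  have P: "two_sided_ideal ?L ?P" by (rule two_sided_ideal_prod[OF A A])
  interpret A: lpa_ideal G "pull_ideal A" by (rule lpa_ideal_pull_ideal[OF A])
  interpret P: lpa_ideal G "pull_ideal ?P" by (rule lpa_ideal_pull_ideal[OF P])
  have sq: "a * b \<in> pull_ideal ?P" if "a \<in> pull_ideal A" "b \<in> pull_ideal A" for a b
  proof -
    have "lpa_proj G (restrict_letters G a) \<otimes>\<^bsub>?L\<^esub> lpa_proj G (restrict_letters G b) \<in> ?P"
      using that by (intro ideal_prod.prod) (simp_all add: pull_ideal_def)
    then show ?thesis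
      using that by (simp add: pull_ideal_def mult_lpa restrict_letters_mem restrict_letters_mult lookup_mult_zero)
  qed
  have sub: "pull_ideal ?P \<subseteq> pull_ideal A"
    using ideal_prod_subset[OF A A] by (auto simp: pull_ideal_def)
  have vert: "Vt v \<in> pull_ideal ?P" if "Vt v \<in> pull_ideal A" for v
    using P.VV P.cong_mem_iff sq[OF that that] by blast
  have brk: "breaking_element G P.vertex_set v \<in> pull_ideal ?P"
    if "v \<in> breaking_vertices G P.vertex_set" "breaking_element G P.vertex_set v \<in> pull_ideal A" for v
    using P.breaking_idem[OF that(1)] P.cong_mem_iff sq[OF that(2) that(2)] by blast
  show ?thesis
  proof
    fix x assume x: "x \<in> A"
    obtain a where a: "a \<in> carrier (free_alg G)" "x = lpa_proj G a"
      using x A by (auto simp: two_sided_ideal_iff[OF abelian_group_lpa] carrier_lpa)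
    have "a \<in> pull_ideal A" using a x by (simp add: mem_pull_ideal)
    then have "a \<in> pull_ideal ?P"
      using P.ideal_subset_of_vertices[OF K A.lpa_ideal_axioms sub vert brk] a(1)
      by (simp add: mem_free_alg_iff)
    then show "x \<in> ?P" using a by (simp add: mem_pull_ideal)
  qed
qed

end

section \<open>Proof of the theorem\<close>

lemma lookup_Vt_zero: "Poly_Mapping.lookup (Vt v) 0 = 0"
  by (simp add: gen_def lookup_single zero_lpa_word_def)

lemma lookup_breaking_element_zero:
  "Poly_Mapping.lookup (breaking_element E H v :: ('v,'e,'k::field) free_lpa) 0 = 0"
proof -
  have "Poly_Mapping.lookup (Ed e * Gh e :: ('v,'e,'k) free_lpa) 0 = 0" for e
    by (rule lookup_mult_zero) (simp add: gen_def lookup_single zero_lpa_word_def)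
  then show ?thesis by (simp add: breaking_element_def lookup_minus lookup_sum lookup_Vt_zero)
qed

text \<open>A vertex w of \<open>S\<^sub>1\<close> outside \<open>H\<^sub>2\<close> is not in
  \<open>J\<close>, but its breaking element for \<open>H\<^sub>1\<close> is. By
  \<open>breaking_vertex_transfer\<close> it is then breaking for \<open>H\<^sub>2\<close> with its
  new element in \<open>J\<close>, that is, in \<open>S\<^sub>2\<close>.\<close>

lemma admissible_le_of_ideal_subset:
  fixes I J :: "('v,'e,'k::field) free_lpa set"
  assumes H1: "H\<^sub>1 \<subseteq> verts E" and S1: "S\<^sub>1 \<subseteq> breaking_vertices E H\<^sub>1"
    and I1: "\<And>v. v \<in> verts E \<Longrightarrow> Vt v \<in> I \<longleftrightarrow> v \<in> H\<^sub>1"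
    and I2: "\<And>v. v \<in> breaking_vertices E H\<^sub>1 \<Longrightarrow> breaking_element E H\<^sub>1 v \<in> I \<longleftrightarrow> v \<in> S\<^sub>1"
    and H2: "H\<^sub>2 \<subseteq> verts E" and J: "lpa_ideal E J"
    and J1: "\<And>v. v \<in> verts E \<Longrightarrow> Vt v \<in> J \<longleftrightarrow> v \<in> H\<^sub>2"
    and J2: "\<And>v. v \<in> breaking_vertices E H\<^sub>2 \<Longrightarrow> breaking_element E H\<^sub>2 v \<in> J \<longleftrightarrow> v \<in> S\<^sub>2"
    and sub: "\<forall>a\<in>I. Poly_Mapping.lookup a 0 = 0 \<longrightarrow> a \<in> J"
  shows "admissible_le (H\<^sub>1, S\<^sub>1) (H\<^sub>2, S\<^sub>2)"
proof -
  interpret lpa_ideal E J by fact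
  have le: "H\<^sub>1 \<subseteq> H\<^sub>2"
  proof
    fix v assume "v \<in> H\<^sub>1"
    then have v: "v \<in> verts E" "Vt v \<in> I" using H1 I1 by auto
    have "Vt v \<in> J" using bspec[OF sub v(2)] by (simp add: lookup_Vt_zero)
    then show "v \<in> H\<^sub>2" using J1 v by simp
  qed
  have "w \<in> H\<^sub>2 \<union> S\<^sub>2" if w: "w \<in> S\<^sub>1" for w
  proof (cases "w \<in> H\<^sub>2")
    case False
    have wb: "w \<in> breaking_vertices E H\<^sub>1" using w S1 by blast
    then have wv: "w \<in> verts E" by (simp add: breaking_vertices_def)
    have "breaking_element E H\<^sub>1 w \<in> I" using I2[OF wb] w by simp
    from bspec[OF sub this] have "breaking_element E H\<^sub>1 w \<in> J" by (simp add: lookup_breaking_element_zero)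
    moreover have "Vt w \<notin> J" using J1[OF wv] False by simp
    moreover have "Vt v \<in> J" if "v \<in> H\<^sub>2" for v using J1 H2 that by blast
    ultimately have "w \<in> breaking_vertices E H\<^sub>2 \<and> breaking_element E H\<^sub>2 w \<in> J"
      using breaking_vertex_transfer[OF wb le] by simp
    then show ?thesis using J2 by blast
  qed simp
  with le show ?thesis by (auto simp: admissible_le_def)
qed

lemma admissible_pairs_chain_of_chain:
  fixes E :: "('v,'e) pre_digraph"
  assumes E: "wf_digraph E"
    and chain: "\<And>I J :: ('v,'e,'k::field) free_lpa set. lpa_ideal E I \<Longrightarrow> lpa_ideal E J \<Longrightarrow>
      (\<forall>a\<in>I. Poly_Mapping.lookup a 0 = 0 \<longrightarrow> a \<in> J) \<or> (\<forall>a\<in>J. Poly_Mapping.lookup a 0 = 0 \<longrightarrow> a \<in> I)"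
    and P: "admissible_pair E P" and Q: "admissible_pair E Q"
  shows "admissible_le P Q \<or> admissible_le Q P"
proof -
  obtain H\<^sub>1 S\<^sub>1 H\<^sub>2 S\<^sub>2 where PQ: "P = (H\<^sub>1, S\<^sub>1)" "Q = (H\<^sub>2, S\<^sub>2)" by (metis surj_pair)
  obtain I :: "('v,'e,'k) free_lpa set" where I: "lpa_ideal E I"
    "\<forall>v\<in>verts E. Vt v \<in> I \<longleftrightarrow> v \<in> H\<^sub>1"
    "\<forall>v\<in>breaking_vertices E H\<^sub>1. breaking_element E H\<^sub>1 v \<in> I \<longleftrightarrow> v \<in> S\<^sub>1"
    by (rule admissible_pair_separating_ideal[OF E P[unfolded PQ]]) (use that in blast)
  obtain J :: "('v,'e,'k) free_lpa set" where J: "lpa_ideal E J"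
    "\<forall>v\<in>verts E. Vt v \<in> J \<longleftrightarrow> v \<in> H\<^sub>2"
    "\<forall>v\<in>breaking_vertices E H\<^sub>2. breaking_element E H\<^sub>2 v \<in> J \<longleftrightarrow> v \<in> S\<^sub>2"
    by (rule admissible_pair_separating_ideal[OF E Q[unfolded PQ]]) (use that in blast)
  have sub: "H\<^sub>1 \<subseteq> verts E" "S\<^sub>1 \<subseteq> breaking_vertices E H\<^sub>1" "H\<^sub>2 \<subseteq> verts E" "S\<^sub>2 \<subseteq> breaking_vertices E H\<^sub>2"
    using P Q by (auto simp: PQ admissible_pair_def hereditary_def)
  from chain[OF I(1) J(1)] show ?thesis
  proof
    assume "\<forall>a\<in>I. Poly_Mapping.lookup a 0 = 0 \<longrightarrow> a \<in> J"
    from admissible_le_of_ideal_subset[OF sub(1,2) bspec[OF I(2)] bspec[OF I(3)] sub(3) J(1)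
        bspec[OF J(2)] bspec[OF J(3)] this]
    show ?thesis by (simp add: PQ)
  next
    assume "\<forall>a\<in>J. Poly_Mapping.lookup a 0 = 0 \<longrightarrow> a \<in> I"
    from admissible_le_of_ideal_subset[OF sub(3,4) bspec[OF J(2)] bspec[OF J(3)] sub(1) I(1)
        bspec[OF I(2)] bspec[OF I(3)] this]
    show ?thesis by (simp add: PQ)
  qed
qed

theorem theorem3p19:
  fixes E :: "('v,'e) pre_digraph"
    and L :: "('v,'e,'k::field) free_lpa set ring"
  assumes E: "wf_digraph E"
    and L: "L = leavitt_path_algebra E"
  defines "stmt1 \<equiv> \<forall>I. two_sided_ideal L I \<longrightarrow> strongly_irreducible_ideal L I"
    and "stmt2 \<equiv> (\<forall>I. two_sided_ideal L I \<longrightarrow> lpa_graded_ideal E I) \<and>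
           (\<forall>I J. two_sided_ideal L I \<longrightarrow> two_sided_ideal L J \<longrightarrow> I \<subseteq> J \<or> J \<subseteq> I)"
    and "stmt3 \<equiv> condition_K E \<and>
           (\<forall>P Q. admissible_pair E P \<longrightarrow> admissible_pair E Q \<longrightarrow>
              admissible_le P Q \<or> admissible_le Q P)"
    and "stmt4 \<equiv> \<forall>I. two_sided_ideal L I \<longrightarrow> I \<noteq> carrier L \<longrightarrow> prime_two_sided_ideal L I"
  shows "(stmt1 \<longleftrightarrow> stmt2) \<and> (stmt2 \<longleftrightarrow> stmt3) \<and> (stmt3 \<longleftrightarrow> stmt4)"
proof -
  interpret wf_digraph E by (rule E)
  \<comment> \<open>The chain condition without gradedness links all four statements; gradedness is
    recovered from Condition (K) through \<open>stmt3\<close>.\<close>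
  define chain where "chain \<longleftrightarrow> (\<forall>I J. two_sided_ideal L I \<longrightarrow> two_sided_ideal L J \<longrightarrow> I \<subseteq> J \<or> J \<subseteq> I)"
  have Int: "two_sided_ideal L (A \<inter> B)" if "two_sided_ideal L A" "two_sided_ideal L B" for A B
    using two_sided_ideal_Int[OF abelian_group_lpa] that unfolding L .
  have prod: "ideal_prod L A B \<subseteq> A \<inter> B" if "two_sided_ideal L A" "two_sided_ideal L B" for A B
    using ideal_prod_subset that unfolding L .
  have 1: "stmt1 \<longleftrightarrow> chain"
  proof
    assume *: stmt1
    show chain
      unfolding chain_def
    proof (intro allI impI)
      fix I J assume IJ: "two_sided_ideal L I" "two_sided_ideal L J"
      then have "strongly_irreducible_ideal L (I \<inter> J)" using * Int unfolding stmt1_def by blast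
      with IJ have "I \<subseteq> I \<inter> J \<or> J \<subseteq> I \<inter> J" unfolding strongly_irreducible_ideal_def by blast
      then show "I \<subseteq> J \<or> J \<subseteq> I" by blast
    qed
  next
    assume *: chain
    have "A \<subseteq> I \<or> B \<subseteq> I" if "two_sided_ideal L A" "two_sided_ideal L B" "A \<inter> B \<subseteq> I" for A B I
      using * that unfolding chain_def by (metis inf.absorb1 inf.absorb2)
    then show stmt1 unfolding stmt1_def strongly_irreducible_ideal_def by blast
  qed
  have 2: "chain \<longleftrightarrow> stmt3"
  proof
    assume *: chain
    have chain': "(\<forall>a\<in>I. Poly_Mapping.lookup a 0 = 0 \<longrightarrow> a \<in> J) \<or> (\<forall>a\<in>J. Poly_Mapping.lookup a 0 = 0 \<longrightarrow> a \<in> I)"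
      if "lpa_ideal E I" "lpa_ideal E J" for I J :: "('v,'e,'k) free_lpa set"
      using *[unfolded chain_def L chain_lpa_iff] that by simp
    show stmt3
      unfolding stmt3_def
      using condition_K_of_chain[OF E chain'] admissible_pairs_chain_of_chain[OF E chain'] by simp
  next
    assume *: stmt3
    show chain
      unfolding chain_def L chain_lpa_iff
    proof (intro allI impI)
      fix I J :: "('v,'e,'k) free_lpa set" assume I: "lpa_ideal E I" and J: "lpa_ideal E J"
      have K: "condition_K E" using * by (simp add: stmt3_def)
      have "admissible_le (lpa_ideal.pair_of E I) (lpa_ideal.pair_of E J) \<or>
          admissible_le (lpa_ideal.pair_of E J) (lpa_ideal.pair_of E I)"
        using *[unfolded stmt3_def, THEN conjunct2] lpa_ideal.admissible_pair_of[OF I]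
          lpa_ideal.admissible_pair_of[OF J] by blast
      then show "(\<forall>a\<in>I. Poly_Mapping.lookup a 0 = 0 \<longrightarrow> a \<in> J) \<or> (\<forall>a\<in>J. Poly_Mapping.lookup a 0 = 0 \<longrightarrow> a \<in> I)"
        using ideal_subset_of_pair_le[OF K J I] ideal_subset_of_pair_le[OF K I J] by auto
    qed
  qed
  have 3: "stmt2 \<longleftrightarrow> stmt3"
  proof
    show "stmt2 \<Longrightarrow> stmt3" unfolding 2[symmetric] by (simp add: stmt2_def chain_def)
    assume *: stmt3
    then have "lpa_graded_ideal E I" if "two_sided_ideal L I" for I
      using lpa_graded_ideal_of_condition_K that by (simp add: stmt3_def L)
    with * show stmt2 unfolding 2[symmetric] by (simp add: stmt2_def chain_def)
  qed
  have 4: "stmt3 \<Longrightarrow> stmt4"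
    unfolding stmt4_def prime_two_sided_ideal_def
  proof (intro allI impI conjI)
    fix I A B
    assume *: stmt3 and A: "two_sided_ideal L A" and B: "two_sided_ideal L B"
      and AB: "ideal_prod L A B \<subseteq> I"
    have K: "condition_K E" using * by (simp add: stmt3_def)
    have idem: "C \<subseteq> ideal_prod L C C" if "two_sided_ideal L C" for C
      using ideal_idempotent_of_condition_K[OF K] that unfolding L .
    have mono: "ideal_prod L C C \<subseteq> ideal_prod L A B" if "C \<subseteq> A" "C \<subseteq> B" for C
    proof
      fix x assume "x \<in> ideal_prod L C C"
      then show "x \<in> ideal_prod L A B"
        using that by (induction rule: ideal_prod.induct) (auto intro: ideal_prod.intros)
    qed
    from * have "A \<subseteq> B \<or> B \<subseteq> A" using A B unfolding 2[symmetric] chain_def by blast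
    then show "A \<subseteq> I \<or> B \<subseteq> I"
    proof
      assume "A \<subseteq> B"
      then show ?thesis using idem[OF A] mono[of A] AB by blast
    next
      assume "B \<subseteq> A"
      then show ?thesis using idem[OF B] mono[of B] AB by blast
    qed
  qed simp_all
  have 5: "stmt4 \<Longrightarrow> chain"
    unfolding chain_def
  proof (intro allI impI)
    fix I J assume *: stmt4 and IJ: "two_sided_ideal L I" "two_sided_ideal L J"
    show "I \<subseteq> J \<or> J \<subseteq> I"
    proof (cases "I \<inter> J = carrier L")
      \<comment> \<open>Prime ideals are proper, so \<open>stmt4\<close> is silent here; but now
        both ideals are all of \<open>L\<close>.\<close>
      case True
      then show ?thesis using IJ by (auto simp: L two_sided_ideal_iff[OF abelian_group_lpa])
    next
      case False
      then have "prime_two_sided_ideal L (I \<inter> J)" using * Int[OF IJ] by (simp add: stmt4_def)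
      then have "I \<subseteq> I \<inter> J \<or> J \<subseteq> I \<inter> J"
        using prod[OF IJ] IJ unfolding prime_two_sided_ideal_def by blast
      then show ?thesis by blast
    qed
  qed
  from 1 2 3 4 5 show ?thesis by blast
qed

end
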